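(* Consider the Gaussian random many-access channel with $\ell_n$ users at blocklength $n$, each active independently with probability $\alpha_n$, and let $k_n=\alpha_n\ell_n$ be the average number of active users. Assume that $k_n=\Omega(1)$. The largest rate per unit-energy $\dot C_\bot$ achievable (under the joint probability of error, with symmetric codes) with an orthogonal-access scheme satisfies the following: 1) If $\ell_n=o(n/\log n)$, then $\dot C_\bot=\frac{\log e}{N_0}$. 2) If $\ell_n=\omega(n/\log n)$, then $\dot C_\bot=0$. 3) If $\ell_n=\Theta(n/\log n)$, then $0<\dot C_\bot<\frac{\log e}{N_0}$.
   Context: Logarithms $\log$ are to base 2. For nonnegative sequences: $a_n=o(b_n)$ means $\lim a_n/b_n=0$; $a_n=\Omega(b_n)$ means $\liminf a_n/b_n>0$; $a_n=\Theta(b_n)$ means $\limsup a_n/b_n<\infty$ and $\liminf a_n/b_n>0$; $a_n=\omega(b_n)$ means $\lim a_n/b_n=\infty$. Channel. At blocklength $n$ there are $\ell_n$ users (a positive integer depending on $n$), and $\alpha_n\in(0,1]$. The messages $W_1,\ldots,W_{\ell_n}$ are independent, with $\Pr\{W_i=0\}=1-\alpha_n$ (user $i$ inactive) and $\Pr\{W_i=w\}=\alpha_n/M_n$ for $w\in\{1,\ldots,M_n\}$. User $i$ sends a codeword $\mathbf{x}_i(W_i)\in\mathbb{R}^n$ and the receiver observes $\mathbf{Y}=\sum_{i=1}^{\ell_n}\mathbf{x}_i(W_i)+\mathbf{Z}$, where $\mathbf{Z}$ has $n$ i.i.d. $\mathcal{N}(0,N_0/2)$ components, independent of the messages; $N_0>0$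 is fixed. Codes. A symmetric $(n,M_n,E_n,\epsilon)$ code consists of encoding functions $w\mapsto\mathbf{x}_i(w)$ on $\{0,1,\ldots,M_n\}$, $i=1,\ldots,\ell_n$ (one codebook per user), with $\mathbf{x}_i(0)=\mathbf{0}$ and $\sum_{j=1}^n x_{ij}(w)^2\le E_n$ for all $w$, and a decoding function mapping $\mathbf{Y}$ to $(\hat W_1,\ldots,\hat W_{\ell_n})\in\{0,1,\ldots,M_n\}^{\ell_n}$ whose joint probability of error satisfies $P_e^{(n)}=\Pr\{(\hat W_1,\ldots,\hat W_{\ell_n})\ne(W_1,\ldots,W_{\ell_n})\}\le\epsilon$. A code uses an orthogonal-access scheme if, for any two distinct users $i$ and $j$, the inner product between $\mathbf{x}_i(w)$ and $\mathbf{x}_j(w')$ is zero for all $w,w'\in\{1,\ldots,M_n\}$. A rate per unit-energy $\dot R$ is achievable with an orthogonal-access scheme if for every $0<\epsilon<1$ and every $\delta>0$ there exists $n_0$ such that for every $n\ge n_0$ there is an $(n,M_n,E_n,\epsilon)$ code using an orthogonal-access scheme with $\frac{\log M_n}{E_n}>\dot R-\delta$. $\dot C_\bot$ is the supremum of all rates per unit-energy achievable with an orthogonal-access scheme. *)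

theory Defs
  imports "HOL-Probability.Probability" "HOL-Library.Landau_Symbols"
begin

text \<open>
  Users are indexed by \<open>{1..L}\<close> and vectors of length \<open>n\<close> are functions on the index
  set \<open>{1..n}\<close>; values of codewords at other indices are never inspected.
  A codebook \<open>x\<close> is read as \<open>x i w j\<close>: component \<open>j\<close> of the codeword of user \<open>i\<close>
  for message \<open>w\<close>.
\<close>

definition message_pmf :: "real \<Rightarrow> nat \<Rightarrow> nat pmf" where
  "message_pmf a M =
     bind_pmf (bernoulli_pmf a) (\<lambda>active. if active then pmf_of_set {1..M} else return_pmf 0)"

lemma pmf_message_0:
  assumes "0 < a" "a \<le> 1" "1 \<le> M"
  shows "pmf (message_pmf a M) 0 = 1 - a"
  using assms by (simp add: message_pmf_def pmf_bind integral_measure_pmf[of UNIV] UNIV_bool)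

lemma pmf_message_active:
  assumes "0 < a" "a \<le> 1" "w \<in> {1..M}"
  shows "pmf (message_pmf a M) w = a / real M"
  using assms by (auto simp: message_pmf_def pmf_bind integral_measure_pmf[of UNIV] UNIV_bool)

definition messages :: "real \<Rightarrow> nat \<Rightarrow> nat \<Rightarrow> (nat \<Rightarrow> nat) measure" where
  "messages a L M = (\<Pi>\<^sub>M i\<in>{1..L}. measure_pmf (message_pmf a M))"

text \<open>The second parameter of \<^const>\<open>normal_density\<close> is the standard deviation.\<close>

definition noise :: "real \<Rightarrow> nat \<Rightarrow> (nat \<Rightarrow> real) measure" where
  "noise N0 n = (\<Pi>\<^sub>M j\<in>{1..n}. density lborel (normal_density 0 (sqrt (N0 / 2))))"

definition channel_output ::
  "nat \<Rightarrow> nat \<Rightarrow> (nat \<Rightarrow> nat \<Rightarrow> nat \<Rightarrow> real) \<Rightarrow> (nat \<Rightarrow> nat) \<Rightarrow> (nat \<Rightarrow> real) \<Rightarrow> nat \<Rightarrow> real" where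
  "channel_output L n x W Z = (\<lambda>j\<in>{1..n}. (\<Sum>i=1..L. x i (W i) j) + Z j)"

text \<open>
  Decoders are required to be Borel measurable, so that the error event below is an event.
\<close>

definition decoders :: "nat \<Rightarrow> nat \<Rightarrow> nat \<Rightarrow> ((nat \<Rightarrow> real) \<Rightarrow> nat \<Rightarrow> nat) set" where
  "decoders L n M =
     measurable (\<Pi>\<^sub>M j\<in>{1..n}. borel) (count_space ({1..L} \<rightarrow>\<^sub>E {0..M}))"

definition error_event ::
  "real \<Rightarrow> real \<Rightarrow> nat \<Rightarrow> nat \<Rightarrow> nat \<Rightarrow> (nat \<Rightarrow> nat \<Rightarrow> nat \<Rightarrow> real) \<Rightarrow>
   ((nat \<Rightarrow> real) \<Rightarrow> nat \<Rightarrow> nat) \<Rightarrow> ((nat \<Rightarrow> nat) \<times> (nat \<Rightarrow> real)) set" where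
  "error_event N0 a L n M x D =
     {(W, Z) \<in> space (messages a L M \<Otimes>\<^sub>M noise N0 n). D (channel_output L n x W Z) \<noteq> W}"

lemma error_event_measurable:
  assumes "D \<in> decoders L n M"
  shows "error_event N0 a L n M x D \<in> sets (messages a L M \<Otimes>\<^sub>M noise N0 n)"
proof -
  let ?P = "messages a L M \<Otimes>\<^sub>M noise N0 n"
  have W: "(\<lambda>p. fst p i) \<in> measurable ?P (count_space UNIV)" if "i \<in> {1..L}" for i
  proof -
    have "(\<lambda>W. W i) \<in> measurable (messages a L M) (measure_pmf (message_pmf a M))"
      unfolding messages_def using that by (rule measurable_component_singleton)
    then have "(\<lambda>W. W i) \<in> measurable (messages a L M) (count_space UNIV)" by simp
    then show ?thesis by (rule measurable_compose[OF measurable_fst])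
  qed
  have Z: "(\<lambda>p. snd p j) \<in> measurable ?P borel" if "j \<in> {1..n}" for j
  proof -
    have "(\<lambda>Z. Z j) \<in> measurable (noise N0 n) (density lborel (normal_density 0 (sqrt (N0 / 2))))"
      unfolding noise_def using that by (rule measurable_component_singleton)
    then have "(\<lambda>Z. Z j) \<in> measurable (noise N0 n) borel" by simp
    then show ?thesis by (rule measurable_compose[OF measurable_snd])
  qed
  have Y: "(\<lambda>p. channel_output L n x (fst p) (snd p)) \<in> measurable ?P (\<Pi>\<^sub>M j\<in>{1..n}. borel)"
    unfolding channel_output_def
  proof (rule measurable_restrict)
    fix j assume j: "j \<in> {1..n}"
    have X: "(\<lambda>p. x i (fst p i) j) \<in> borel_measurable ?P" if "i \<in> {1..L}" for i
      by (rule measurable_compose[OF W[OF that]]) simp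
    show "(\<lambda>p. (\<Sum>i=1..L. x i (fst p i) j) + snd p j) \<in> borel_measurable ?P"
      by (rule borel_measurable_add[OF borel_measurable_sum[OF X] Z[OF j]])
  qed
  have D: "(\<lambda>p. D (channel_output L n x (fst p) (snd p))) \<in> measurable ?P (count_space ({1..L} \<rightarrow>\<^sub>E {0..M}))"
    using assms unfolding decoders_def by (rule measurable_compose[OF Y])
  have Di: "(\<lambda>p. D (channel_output L n x (fst p) (snd p)) i) \<in> measurable ?P (count_space UNIV)" for i
    by (rule measurable_compose[OF D]) simp
  have ext: "D (channel_output L n x (fst p) (snd p)) \<in> extensional {1..L}"
       "fst p \<in> extensional {1..L}" if "p \<in> space ?P" for p
    using measurable_space[OF D that] that
    by (auto simp: space_pair_measure messages_def space_PiM PiE_def)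
  have "error_event N0 a L n M x D =
      (\<Union>i\<in>{1..L}. {p \<in> space ?P. D (channel_output L n x (fst p) (snd p)) i \<noteq> fst p i})"
  proof (rule set_eqI)
    fix p
    show "p \<in> error_event N0 a L n M x D \<longleftrightarrow> p \<in>
        (\<Union>i\<in>{1..L}. {p \<in> space ?P. D (channel_output L n x (fst p) (snd p)) i \<noteq> fst p i})"
    proof (cases "p \<in> space ?P")
      case True
      have "D (channel_output L n x (fst p) (snd p)) \<noteq> fst p \<longleftrightarrow>
          (\<exists>i\<in>{1..L}. D (channel_output L n x (fst p) (snd p)) i \<noteq> fst p i)"
        using extensionalityI[OF ext[OF True]] by metis
      then show ?thesis using True unfolding error_event_def by (simp add: case_prod_beta)
    next
      case False
      then show ?thesis unfolding error_event_def by (simp add: case_prod_beta)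
    qed
  qed
  also have "\<dots> \<in> sets ?P"
  proof (intro sets.finite_UN)
    fix i assume i: "i \<in> {1..L}"
    let ?f = "\<lambda>p. D (channel_output L n x (fst p) (snd p)) i"
    have "{p \<in> space ?P. ?f p \<noteq> fst p i} =
        (\<Union>k. (?f -` {k} \<inter> space ?P) - ((\<lambda>p. fst p i) -` {k} \<inter> space ?P))"
      by auto
    also have "\<dots> \<in> sets ?P"
      using measurable_sets[OF Di[of i]] measurable_sets[OF W[OF i]]
      by (intro sets.countable_UN image_subsetI sets.Diff) simp_all
    finally show "{p \<in> space ?P. ?f p \<noteq> fst p i} \<in> sets ?P" .
  qed simp
  finally show ?thesis .
qed

definition error_prob ::
  "real \<Rightarrow> real \<Rightarrow> nat \<Rightarrow> nat \<Rightarrow> nat \<Rightarrow> (nat \<Rightarrow> nat \<Rightarrow> nat \<Rightarrow> real) \<Rightarrow>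
   ((nat \<Rightarrow> real) \<Rightarrow> nat \<Rightarrow> nat) \<Rightarrow> real" where
  "error_prob N0 a L n M x D =
     measure (messages a L M \<Otimes>\<^sub>M noise N0 n) (error_event N0 a L n M x D)"

definition symmetric_code ::
  "real \<Rightarrow> real \<Rightarrow> nat \<Rightarrow> nat \<Rightarrow> nat \<Rightarrow> real \<Rightarrow> real \<Rightarrow> (nat \<Rightarrow> nat \<Rightarrow> nat \<Rightarrow> real) \<Rightarrow>
   ((nat \<Rightarrow> real) \<Rightarrow> nat \<Rightarrow> nat) \<Rightarrow> bool" where
  "symmetric_code N0 a L n M E \<epsilon> x D \<longleftrightarrow>
     1 \<le> M \<and> 0 < E \<and>
     (\<forall>i\<in>{1..L}. \<forall>j\<in>{1..n}. x i 0 j = 0) \<and>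
     (\<forall>i\<in>{1..L}. \<forall>w\<in>{0..M}. (\<Sum>j=1..n. (x i w j)\<^sup>2) \<le> E) \<and>
     D \<in> decoders L n M \<and>
     error_prob N0 a L n M x D \<le> \<epsilon>"

definition orthogonal_access ::
  "nat \<Rightarrow> nat \<Rightarrow> nat \<Rightarrow> (nat \<Rightarrow> nat \<Rightarrow> nat \<Rightarrow> real) \<Rightarrow> bool" where
  "orthogonal_access L n M x \<longleftrightarrow>
     (\<forall>i\<in>{1..L}. \<forall>i'\<in>{1..L}. i \<noteq> i' \<longrightarrow>
        (\<forall>w\<in>{1..M}. \<forall>w'\<in>{1..M}. (\<Sum>j=1..n. x i w j * x i' w' j) = 0))"

definition orthogonal_achievable ::
  "real \<Rightarrow> (nat \<Rightarrow> real) \<Rightarrow> (nat \<Rightarrow> nat) \<Rightarrow> real \<Rightarrow> bool" where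
  "orthogonal_achievable N0 \<alpha> L R \<longleftrightarrow>
     (\<forall>\<epsilon> \<delta>. 0 < \<epsilon> \<and> \<epsilon> < 1 \<and> 0 < \<delta> \<longrightarrow>
        (\<exists>n0. \<forall>n\<ge>n0. \<exists>M E x D.
           symmetric_code N0 (\<alpha> n) (L n) n M E \<epsilon> x D \<and>
           orthogonal_access (L n) n M x \<and>
           log 2 (real M) / E > R - \<delta>))"

text \<open>
  Rates are nonnegative and the supremum is taken in \<open>[0, \<infinity>]\<close>. In particular it is \<open>0\<close>
  if no rate is achievable, which does occur: if there are many more users than channel
  uses, orthogonality forces many codebooks to vanish, and then the activity of those users
  cannot be detected.
\<close>

definition orthogonal_capacity :: "real \<Rightarrow> (nat \<Rightarrow> real) \<Rightarrow> (nat \<Rightarrow> nat) \<Rightarrow> ennreal" where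
  "orthogonal_capacity N0 \<alpha> L = (SUP R\<in>{R. 0 \<le> R \<and> orthogonal_achievable N0 \<alpha> L R}. ennreal R)"

end

theory Submission
  imports Defs "HOL-Real_Asymp.Real_Asymp"
begin

text \<open>
  Everything rests on the density of the translated noise, which is exponential in an inner
  product. Weighting the success event by the number of active users splits the success
  probability into contributions of single users.

  Converse. Comparing each codeword with a reference signal shows that \<open>M\<close> messages
  need energy about \<open>N0 ln M\<close>, whatever the access scheme. Reliability for all users
  costs more. If \<open>\<alpha> \<le> 1/2\<close>, an active user is hidden among about \<open>L\<close>
  inactive ones, so \<open>N0 ln (L M)\<close> is needed. If \<open>\<alpha> > 1/2\<close>, attenuating one
  random active codeword changes the output law by a chi-square distance of order
  \<open>exp (O(E)) / L\<close> by orthogonality, so an energy below a multiple of \<open>ln L\<close> with a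
  rate near the maximum fails. Finally the codebooks span orthogonal spaces, so half of them
  have dimension at most \<open>2n/L\<close>; if this is small compared to \<open>E\<close>, a lattice cover
  by few balls of small energy bounds the rate.

  Achievability. Each user gets \<open>n div L\<close> channel uses, antipodal codewords with small
  pairwise correlation, and energy \<open>E = A ln n\<close>, so that correlation thresholds fail with
  probability at most \<open>n\<^sup>-\<^sup>2\<close> per user.
\<close>

section \<open>Gaussian noise and translations\<close>

text \<open>The weight by active users is needed because their mean number may stay bounded: then
  the event that nobody is active can keep a fixed probability, and plain success probabilities
  prove nothing. All converses bound weighted success by \<open>(1 - \<beta>) * (a * L)\<close>,
  which gives an error floor uniform over all codes. About the decoder only the disjointness of its
  regions is used. Moving a region from one signal to another at squared distance \<open>e\<close>
  costs a factor of about \<open>exp (e / N0)\<close>; this is the origin of the threshold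
  \<open>N0 * ln M\<close>. In the critical regime \<open>n\<close> has the order of
  \<open>L * ln L\<close>, so the dimension available to a user and the energy forced on it both
  have order \<open>ln L\<close>. Codes are therefore split at \<open>E = A * ln L\<close>: above,
  dimensions are too small; below, reliability for all users fails. The split of
  \<open>\<alpha>\<close> at 1/2 is forced too: hiding an active user needs many inactive ones,
  attenuation needs many active ones. Strictness in the critical case needs a gap valid for every
  achievable rate, so the constants are fixed in the order \<open>\<kappa>\<close>,
  \<open>A\<close>, \<open>\<theta>\<close>, \<open>\<eta>\<close>.\<close>

declare One_nat_def [simp del] \<comment> \<open>keeps the index sets \<open>{1..n}\<close> from becoming \<open>{Suc 0..n}\<close>\<close>

definition ip :: "nat \<Rightarrow> (nat \<Rightarrow> real) \<Rightarrow> (nat \<Rightarrow> real) \<Rightarrow> real" where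
  "ip n u v = (\<Sum>j=1..n. u j * v j)"

definition translate :: "nat \<Rightarrow> (nat \<Rightarrow> real) \<Rightarrow> (nat \<Rightarrow> real) \<Rightarrow> nat \<Rightarrow> real" where
  "translate n v z = (\<lambda>j\<in>{1..n}. v j + z j)"

abbreviation outputs :: "nat \<Rightarrow> (nat \<Rightarrow> real) measure" where
  "outputs n \<equiv> (\<Pi>\<^sub>M j\<in>{1..n}. borel)"

definition hit_prob :: "real \<Rightarrow> nat \<Rightarrow> (nat \<Rightarrow> real) \<Rightarrow> (nat \<Rightarrow> real) set \<Rightarrow> real" where
  "hit_prob N0 n v A = measure (noise N0 n) {z \<in> space (noise N0 n). translate n v z \<in> A}"

lemma ip_commute: "ip n u v = ip n v u"
  by (simp add: ip_def mult.commute)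

lemma ip_add_left: "ip n (\<lambda>j. u j + v j) w = ip n u w + ip n v w"
  by (simp add: ip_def algebra_simps sum.distrib)

lemma ip_diff_left: "ip n (\<lambda>j. u j - v j) w = ip n u w - ip n v w"
  by (simp add: ip_def algebra_simps sum_subtractf)

lemma ip_scale_left: "ip n (\<lambda>j. c * u j) w = c * ip n u w"
  by (simp add: ip_def algebra_simps sum_distrib_left)

lemma ip_sum_left: "ip n (\<lambda>j. \<Sum>i\<in>I. f i j) w = (\<Sum>i\<in>I. ip n (f i) w)"
proof -
  have "ip n (\<lambda>j. \<Sum>i\<in>I. f i j) w = (\<Sum>j=1..n. \<Sum>i\<in>I. f i j * w j)"
    by (simp add: ip_def sum_distrib_right)
  also have "\<dots> = (\<Sum>i\<in>I. \<Sum>j=1..n. f i j * w j)" by (rule sum.swap)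
  finally show ?thesis by (simp add: ip_def)
qed

lemma ip_add_right: "ip n u (\<lambda>j. v j + w j) = ip n u v + ip n u w"
  by (metis ip_commute ip_add_left)

lemma ip_scale_right: "ip n u (\<lambda>j. c * w j) = c * ip n u w"
  by (metis ip_commute ip_scale_left)

lemma ip_self_nonneg [simp]: "0 \<le> ip n u u"
  by (simp add: ip_def sum_nonneg)

lemma sets_noise [measurable_cong]: "sets (noise N0 n) = sets (outputs n)"
  unfolding noise_def by (intro sets_PiM_cong) auto

lemma space_noise: "space (noise N0 n) = space (outputs n)"
  by (rule sets_eq_imp_space_eq[OF sets_noise])

lemma prob_space_noise: "N0 > 0 \<Longrightarrow> prob_space (noise N0 n)"
  unfolding noise_def by (intro prob_space_PiM prob_space_normal_density) simp

lemma measurable_translate [measurable]: "translate n v \<in> measurable (outputs n) (outputs n)"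
  unfolding translate_def by measurable

lemma measurable_translate_noise [measurable]: "translate n v \<in> measurable (noise N0 n) (outputs n)"
  by (subst measurable_cong_sets[OF sets_noise refl]) (rule measurable_translate)

lemma measurable_ip [measurable]: "ip n v \<in> borel_measurable (outputs n)"
  unfolding ip_def by measurable

lemma measurable_ip_noise [measurable]: "ip n v \<in> borel_measurable (noise N0 n)"
  unfolding measurable_cong_sets[OF sets_noise refl] by (rule measurable_ip)

lemma normal_density_shift:
  assumes "N0 > 0"
  shows "normal_density 0 (sqrt (N0/2)) (z - m)
    = normal_density 0 (sqrt (N0/2)) z * exp ((2 * m * z - m\<^sup>2) / N0)"
proof -
  have "- (z - m)\<^sup>2 / N0 = - z\<^sup>2 / N0 + (2 * m * z - m\<^sup>2) / N0"
    using assms by (simp add: field_simps power2_eq_square)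
  then show ?thesis
    using assms by (simp add: normal_density_def exp_add[symmetric] field_simps)
qed

lemma emeasure_normal_shift:
  assumes N0: "N0 > 0" and A [measurable]: "A \<in> sets borel"
  defines "N \<equiv> density lborel (normal_density 0 (sqrt (N0/2)))"
  shows "emeasure N {z. m + z \<in> A}
    = (\<integral>\<^sup>+ z. indicator A z * ennreal (exp ((2 * m * z - m\<^sup>2) / N0)) \<partial>N)"
proof -
  let ?f = "normal_density 0 (sqrt (N0/2))"
  have m: "{z. m + z \<in> A} \<in> sets borel" by measurable
  have "emeasure N {z. m + z \<in> A} = (\<integral>\<^sup>+ z. ?f z * indicator {z. m + z \<in> A} z \<partial>lborel)"
    unfolding N_def using m by (subst emeasure_density) (auto simp: ennreal_mult' ennreal_indicator)
  also have "\<dots> = (\<integral>\<^sup>+ z. ?f (-m + 1 * z) * indicator {z. m + z \<in> A} (-m + 1 * z) \<partial>lborel)"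
    using m by (subst nn_integral_real_affine[where c = 1 and t = "-m"]) auto
  also have "\<dots> = (\<integral>\<^sup>+ z. ?f z * (indicator A z * ennreal (exp ((2 * m * z - m\<^sup>2) / N0))) \<partial>lborel)"
    using normal_density_shift[OF N0, of _ m]
    by (intro nn_integral_cong) (auto simp: indicator_def ennreal_mult' )
  also have "\<dots> = (\<integral>\<^sup>+ z. indicator A z * ennreal (exp ((2 * m * z - m\<^sup>2) / N0)) \<partial>N)"
    unfolding N_def by (subst nn_integral_density) auto
  finally show ?thesis .
qed

lemma exp_sum_ennreal: "finite I \<Longrightarrow> ennreal (exp (\<Sum>i\<in>I. f i)) = (\<Prod>i\<in>I. ennreal (exp (f i)))"
  by (simp add: exp_sum prod_ennreal)

text \<open>The Cameron-Martin formula in finite dimension. Both measures are compared on boxes with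
  the product of the shifted one-dimensional laws \<open>M\<close>; on a box the exponential of the
  inner product factors over coordinates.\<close>

lemma noise_translate:
  assumes N0: "N0 > 0"
  shows "distr (noise N0 n) (outputs n) (translate n v)
    = density (noise N0 n) (\<lambda>z. ennreal (exp ((2 * ip n v z - ip n v v) / N0)))"
proof -
  define N where "N = density lborel (normal_density 0 (sqrt (N0/2)))"
  have noise: "noise N0 n = PiM {1..n} (\<lambda>_. N)" by (simp add: noise_def N_def)
  have N: "prob_space N" unfolding N_def using N0 by (intro prob_space_normal_density) simp
  then interpret N: prob_space N .
  have sN: "sets N = sets borel" "space N = UNIV" by (auto simp: N_def)
  interpret NP: product_sigma_finite "\<lambda>_. N" by standard
  define M where "M j = distr N borel (\<lambda>z. v j + z)" for j
  have sM: "sets (M j) = sets borel" for j by (simp add: M_def)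
  have mN: "(\<lambda>z. v j + z) \<in> measurable N borel" for j
    unfolding measurable_cong_sets[OF sN(1) refl] by measurable
  have "prob_space (M j)" for j unfolding M_def by (rule N.prob_space_distr[OF mN])
  then interpret MP: product_prob_space M by (intro product_prob_spaceI)
  have sPiM: "sets (PiM {1..n} M) = sets (outputs n)" by (intro sets_PiM_cong) (auto simp: sM)
  have eM: "emeasure (M j) A = emeasure N {z. v j + z \<in> A}" if "A \<in> sets (M j)" for j A
    using that mN unfolding M_def by (subst emeasure_distr) (auto simp: sN vimage_def)
  have "distr (noise N0 n) (outputs n) (translate n v) = PiM {1..n} M"
  proof (rule MP.PiM_eqI)
    fix A assume A: "\<And>i. i \<in> {1..n} \<Longrightarrow> A i \<in> sets (M i)"
    have box: "Pi\<^sub>E {1..n} A \<in> sets (outputs n)" using A by (intro sets_PiM_I_finite) (auto simp: sM)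
    have "emeasure (distr (noise N0 n) (outputs n) (translate n v)) (Pi\<^sub>E {1..n} A)
        = emeasure (noise N0 n) (Pi\<^sub>E {1..n} (\<lambda>j. {z. v j + z \<in> A j}))"
      by (subst emeasure_distr[OF measurable_translate_noise box])
         (auto intro!: arg_cong2[where f = emeasure] simp: translate_def space_noise space_PiM PiE_iff extensional_def)
    also have "\<dots> = (\<Prod>j\<in>{1..n}. emeasure N {z. v j + z \<in> A j})"
      unfolding noise using A mN
      by (subst NP.emeasure_PiM) (auto simp: sN sM intro!: measurable_sets_borel)
    also have "\<dots> = (\<Prod>j\<in>{1..n}. emeasure (M j) (A j))" using A by (intro prod.cong) (auto simp: eM)
    finally show "emeasure (distr (noise N0 n) (outputs n) (translate n v)) (Pi\<^sub>E {1..n} A) = \<dots>" .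
  qed (simp_all only: sets_distr sPiM finite_atLeastAtMost)
  moreover have "density (noise N0 n) (\<lambda>z. ennreal (exp ((2 * ip n v z - ip n v v) / N0))) = PiM {1..n} M"
  proof (rule MP.PiM_eqI)
    fix A assume A: "\<And>i. i \<in> {1..n} \<Longrightarrow> A i \<in> sets (M i)"
    let ?g = "\<lambda>j z. indicator (A j) z * ennreal (exp ((2 * v j * z - (v j)\<^sup>2) / N0))"
    have box: "Pi\<^sub>E {1..n} A \<in> sets (noise N0 n)" unfolding sets_noise
      using A by (intro sets_PiM_I_finite) (auto simp: sM)
    have "emeasure (density (noise N0 n) (\<lambda>z. ennreal (exp ((2 * ip n v z - ip n v v) / N0)))) (Pi\<^sub>E {1..n} A)
       = (\<integral>\<^sup>+ z. ennreal (exp ((2 * ip n v z - ip n v v) / N0)) * indicator (Pi\<^sub>E {1..n} A) z \<partial>noise N0 n)"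
      by (rule emeasure_density[OF _ box]) measurable
    also have "\<dots> = (\<integral>\<^sup>+ z. (\<Prod>j\<in>{1..n}. ?g j (z j)) \<partial>noise N0 n)"
    proof (rule nn_integral_cong)
      fix z assume z: "z \<in> space (noise N0 n)"
      have "(2 * ip n v z - ip n v v) / N0 = (\<Sum>j\<in>{1..n}. (2 * v j * z j - (v j)\<^sup>2) / N0)"
        by (simp add: ip_def sum_divide_distrib[symmetric] sum_subtractf sum_distrib_left power2_eq_square mult.assoc)
      moreover have "indicator (Pi\<^sub>E {1..n} A) z = (\<Prod>j\<in>{1..n}. indicator (A j) (z j) :: ennreal)"
        using z by (auto simp: indicator_def space_noise space_PiM PiE_iff prod_zero_iff)
      ultimately show "ennreal (exp ((2 * ip n v z - ip n v v) / N0)) * indicator (Pi\<^sub>E {1..n} A) z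
          = (\<Prod>j\<in>{1..n}. ?g j (z j))"
        by (simp add: exp_sum_ennreal prod.distrib mult.commute)
    qed
    also have "\<dots> = (\<Prod>j\<in>{1..n}. \<integral>\<^sup>+ z. ?g j z \<partial>N)"
      unfolding noise using A
      by (intro NP.product_nn_integral_prod) (auto simp: sM measurable_cong_sets[OF sN(1) refl])
    also have "\<dots> = (\<Prod>j\<in>{1..n}. emeasure (M j) (A j))"
      using A N0 by (intro prod.cong) (auto simp: eM sM N_def emeasure_normal_shift)
    finally show "emeasure (density (noise N0 n) (\<lambda>z. ennreal (exp ((2 * ip n v z - ip n v v) / N0)))) (Pi\<^sub>E {1..n} A) = \<dots>" .
  qed (simp_all only: sets_density sets_noise sPiM finite_atLeastAtMost)
  ultimately show ?thesis by simp
qed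

lemma emeasure_translate:
  assumes N0: "N0 > 0" and A [measurable]: "A \<in> sets (outputs n)"
  shows "ennreal (hit_prob N0 n (\<lambda>j. u j + v j) A)
    = (\<integral>\<^sup>+ z. indicator {z \<in> space (noise N0 n). translate n u z \<in> A} z
         * ennreal (exp ((2 * ip n v z - ip n v v) / N0)) \<partial>noise N0 n)"
proof -
  interpret prob_space "noise N0 n" by (rule prob_space_noise[OF N0])
  let ?B = "{z \<in> space (noise N0 n). translate n u z \<in> A}"
  have B: "?B \<in> sets (noise N0 n)" by measurable
  then have B': "?B \<in> sets (outputs n)" by (simp add: sets_noise)
  have "ennreal (hit_prob N0 n (\<lambda>j. u j + v j) A)
      = emeasure (noise N0 n) {z \<in> space (noise N0 n). translate n (\<lambda>j. u j + v j) z \<in> A}"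
    by (simp add: hit_prob_def emeasure_eq_measure)
  also have "\<dots> = emeasure (distr (noise N0 n) (outputs n) (translate n v)) ?B"
    by (subst emeasure_distr[OF measurable_translate_noise B'])
       (auto simp: translate_def space_noise space_PiM algebra_simps intro!: arg_cong2[where f = emeasure]
             cong: restrict_cong)
  also have "\<dots> = (\<integral>\<^sup>+ z. ennreal (exp ((2 * ip n v z - ip n v v) / N0)) * indicator ?B z \<partial>noise N0 n)"
    unfolding noise_translate[OF N0] by (rule emeasure_density[OF _ B]) measurable
  finally show ?thesis by (simp add: mult.commute)
qed

text \<open>The form in which the density is used below: with integrability and value together, a
  pointwise inequality between integrands becomes one between hit probabilities.\<close>

lemma has_integral_translate:
  assumes N0: "N0 > 0" and A: "A \<in> sets (outputs n)"
  shows "has_bochner_integral (noise N0 n)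
    (\<lambda>z. indicator {z \<in> space (noise N0 n). translate n u z \<in> A} z
         * exp ((2 * ip n v z - ip n v v) / N0))
    (hit_prob N0 n (\<lambda>j. u j + v j) A)"
proof -
  let ?B = "{z \<in> space (noise N0 n). translate n u z \<in> A}"
  have B [measurable]: "?B \<in> sets (noise N0 n)" using A by measurable
  have "(\<integral>\<^sup>+ z. ennreal (indicator ?B z * exp ((2 * ip n v z - ip n v v) / N0)) \<partial>noise N0 n)
     = ennreal (hit_prob N0 n (\<lambda>j. u j + v j) A)"
    unfolding emeasure_translate[OF N0 A]
    by (intro nn_integral_cong) (simp add: ennreal_mult' ennreal_indicator)
  then show ?thesis
    by (subst (asm) nn_integral_eq_integrable) (auto simp: has_bochner_integral_iff hit_prob_def)
qed

section \<open>Hit probabilities, exponential moments and change of measure\<close>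

lemma hit_prob_nonneg [simp]: "0 \<le> hit_prob N0 n v A"
  by (simp add: hit_prob_def)

lemma hit_prob_le_1:
  assumes "N0 > 0"
  shows "hit_prob N0 n v A \<le> 1"
  unfolding hit_prob_def by (rule prob_space.prob_le_1[OF prob_space_noise[OF assms]])

lemma hit_prob_space:
  assumes "N0 > 0"
  shows "hit_prob N0 n v (space (outputs n)) = 1"
proof -
  have "{z \<in> space (noise N0 n). translate n v z \<in> space (outputs n)} = space (noise N0 n)"
    using measurable_space[OF measurable_translate_noise] by blast
  then show ?thesis
    by (simp add: hit_prob_def prob_space.prob_space[OF prob_space_noise[OF assms]])
qed

lemma hit_prob_cong: "(\<And>j. j \<in> {1..n} \<Longrightarrow> u j = v j) \<Longrightarrow> hit_prob N0 n u A = hit_prob N0 n v A"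
  by (simp add: hit_prob_def translate_def cong: restrict_cong)

lemma hit_event_sets [measurable (raw)]:
  "A \<in> sets (outputs n) \<Longrightarrow> {z \<in> space (noise N0 n). translate n v z \<in> A} \<in> sets (noise N0 n)"
  using measurable_sets[OF measurable_translate_noise[where v = v]]
  by (auto simp: vimage_def Int_def conj_commute)

lemma has_bochner_integral_mono:
  fixes f g :: "'a \<Rightarrow> real"
  assumes "has_bochner_integral M f x" "has_bochner_integral M g y" "\<And>z. f z \<le> g z"
  shows "x \<le> y"
  using assms integral_mono[of M f g] by (auto simp: has_bochner_integral_iff)

lemma hit_prob_mono:
  assumes "N0 > 0" "A \<subseteq> B" "B \<in> sets (outputs n)"
  shows "hit_prob N0 n v A \<le> hit_prob N0 n v B"
proof -
  interpret prob_space "noise N0 n" by (rule prob_space_noise) fact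
  show ?thesis unfolding hit_prob_def using assms
    by (intro finite_measure_mono hit_event_sets) auto
qed

lemma hit_prob_compl:
  assumes "N0 > 0" "A \<in> sets (outputs n)"
  shows "hit_prob N0 n v (space (outputs n) - A) = 1 - hit_prob N0 n v A"
proof -
  interpret prob_space "noise N0 n" by (rule prob_space_noise) fact
  have "{z \<in> space (noise N0 n). translate n v z \<in> space (outputs n) - A}
    = space (noise N0 n) - {z \<in> space (noise N0 n). translate n v z \<in> A}"
    using measurable_space[OF measurable_translate_noise] by blast
  then show ?thesis unfolding hit_prob_def using assms by (simp add: prob_compl hit_event_sets)
qed

lemma hit_prob_UN_le:
  assumes "N0 > 0" "finite I" "\<And>i. i \<in> I \<Longrightarrow> A i \<in> sets (outputs n)"
  shows "hit_prob N0 n v (\<Union>i\<in>I. A i) \<le> (\<Sum>i\<in>I. hit_prob N0 n v (A i))"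
proof -
  interpret prob_space "noise N0 n" by (rule prob_space_noise) fact
  have "{z \<in> space (noise N0 n). translate n v z \<in> (\<Union>i\<in>I. A i)}
     = (\<Union>i\<in>I. {z \<in> space (noise N0 n). translate n v z \<in> A i})" by auto
  then show ?thesis unfolding hit_prob_def using assms
    by (auto intro!: finite_measure_subadditive_finite hit_event_sets)
qed

lemma sum_hit_prob_le_1:
  assumes "N0 > 0" "finite I" "\<And>i. i \<in> I \<Longrightarrow> A i \<in> sets (outputs n)" "disjoint_family_on A I"
  shows "(\<Sum>i\<in>I. hit_prob N0 n v (A i)) \<le> 1"
proof -
  interpret prob_space "noise N0 n" by (rule prob_space_noise) fact
  have "(\<Sum>i\<in>I. hit_prob N0 n v (A i))
      = prob (\<Union>i\<in>I. {z \<in> space (noise N0 n). translate n v z \<in> A i})"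
    unfolding hit_prob_def using assms
    by (intro finite_measure_finite_Union[symmetric])
       (auto simp: disjoint_family_on_def intro!: hit_event_sets)
  then show ?thesis by simp
qed

text \<open>No Gaussian integral is computed: the density of the translated noise has total mass
  one, and up to a constant factor that is the moment generating function.\<close>

lemma noise_mgf:
  assumes N0: "N0 > 0"
  shows "has_bochner_integral (noise N0 n) (\<lambda>z. exp (2 * ip n v z / N0)) (exp (ip n v v / N0))"
proof -
  have "has_bochner_integral (noise N0 n)
     (\<lambda>z. indicator {z \<in> space (noise N0 n). translate n (\<lambda>_. 0) z \<in> space (outputs n)} z
         * exp ((2 * ip n v z - ip n v v) / N0)) 1"
    using has_integral_translate[OF N0 sets.top, of n "\<lambda>_. 0" v] by (simp add: hit_prob_space[OF N0])
  then have "has_bochner_integral (noise N0 n) (\<lambda>z. exp ((2 * ip n v z - ip n v v) / N0)) 1"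
    using measurable_space[OF measurable_translate_noise, of _ N0 n "\<lambda>_. 0"]
    by (subst has_bochner_integral_cong[OF refl _ refl]) (auto simp: indicator_def)
  from has_bochner_integral_mult_right[OF this, of "exp (ip n v v / N0)"]
  show ?thesis by (simp add: exp_add[symmetric] diff_divide_distrib)
qed

lemma noise_chernoff:
  assumes N0: "N0 > 0" and t: "t \<ge> 0" and e: "ip n v v \<le> e" "e > 0"
  shows "measure (noise N0 n) {z \<in> space (noise N0 n). t \<le> ip n v z} \<le> exp (- t\<^sup>2 / (N0 * e))"
proof -
  interpret prob_space "noise N0 n" by (rule prob_space_noise) fact
  \<comment> \<open>The minimiser of the Chernoff exponent
    \<open>(s * s * e - 2 * (s * t)) / N0\<close>.\<close>
  define s where "s = t / e"
  have s: "s \<ge> 0" using t e by (simp add: s_def)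
  have mgf: "has_bochner_integral (noise N0 n) (\<lambda>z. exp (2 * (s * ip n v z) / N0)) (exp (s * s * ip n v v / N0))"
    using noise_mgf[OF N0, of n "\<lambda>j. s * v j"] by (simp add: ip_scale_left ip_scale_right mult.assoc)
  have "measure (noise N0 n) {z \<in> space (noise N0 n). t \<le> ip n v z}
     \<le> measure (noise N0 n) {z \<in> space (noise N0 n). exp (2 * (s * t) / N0) \<le> exp (2 * (s * ip n v z) / N0)}"
    using s N0 by (intro finite_measure_mono) (auto intro!: divide_right_mono mult_left_mono)
  also have "\<dots> \<le> (\<integral>z. exp (2 * (s * ip n v z) / N0) \<partial>noise N0 n) / exp (2 * (s * t) / N0)"
    using mgf by (intro integral_Markov_inequality_measure[where A = "space (noise N0 n)"]) (auto simp: has_bochner_integral_iff)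
  also have "\<dots> = exp (s * s * ip n v v / N0 - 2 * (s * t) / N0)"
    using mgf by (simp add: has_bochner_integral_iff exp_diff)
  also have "\<dots> \<le> exp (s * s * e / N0 - 2 * (s * t) / N0)"
    using e N0 by (auto intro!: divide_right_mono mult_left_mono)
  also have "s * s * e / N0 - 2 * (s * t) / N0 = - t\<^sup>2 / (N0 * e)"
    using e N0 by (simp add: s_def field_simps power2_eq_square)
  finally show ?thesis .
qed

text \<open>Where the likelihood ratio is at most \<open>\<gamma>\<close>, it is replaced by
  \<open>\<gamma>\<close>; elsewhere it is at most \<open>\<gamma> powr (-s)\<close> times its power
  \<open>1 + s\<close>, whose mean is known from \<open>noise_mgf\<close>. For
  \<open>\<gamma> = exp ((1 + \<delta>) * e / N0)\<close> the last term is
  \<open>exp (s * (s - \<delta>) * e / N0)\<close>, hence small for large \<open>e\<close> and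
  \<open>0 < s < \<delta>\<close>.\<close>

lemma hit_prob_change_of_measure:
  assumes N0: "N0 > 0" and A: "A \<in> sets (outputs n)" and g: "\<gamma> > 0" and s: "s \<ge> 0" and e: "ip n d d \<le> e"
  shows "hit_prob N0 n (\<lambda>j. v j + d j) A \<le> \<gamma> * hit_prob N0 n v A + \<gamma> powr (-s) * exp (s * (1 + s) * e / N0)"
proof -
  interpret prob_space "noise N0 n" by (rule prob_space_noise) fact
  let ?B = "{z \<in> space (noise N0 n). translate n v z \<in> A}"
  let ?l = "\<lambda>z. (2 * ip n d z - ip n d d) / N0"
  have B [measurable]: "?B \<in> sets (noise N0 n)" using A by measurable
  note I1 = has_integral_translate[OF N0 A, of v d]
  have I2: "has_bochner_integral (noise N0 n) (\<lambda>z. exp ((1 + s) * ?l z)) (exp (s * (1 + s) * ip n d d / N0))"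
  proof -
    have "has_bochner_integral (noise N0 n) (\<lambda>z. exp (2 * ((1 + s) * ip n d z) / N0)) (exp ((1 + s) * (1 + s) * ip n d d / N0))"
      using noise_mgf[OF N0, of n "\<lambda>j. (1 + s) * d j"] by (simp add: ip_scale_left ip_scale_right mult.assoc)
    from has_bochner_integral_mult_right[OF this, of "exp (- (1 + s) * ip n d d / N0)"]
    show ?thesis by (simp add: exp_add[symmetric] diff_divide_distrib algebra_simps add_divide_distrib)
  qed
  have I3: "has_bochner_integral (noise N0 n) (\<lambda>z. indicator ?B z) (hit_prob N0 n v A)"
    unfolding hit_prob_def by (rule has_bochner_integral_real_indicator[OF B]) (simp add: emeasure_eq_measure)
  have pt: "indicator ?B z * exp (?l z) \<le> \<gamma> * indicator ?B z + \<gamma> powr (-s) * exp ((1 + s) * ?l z)" for z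
  proof (cases "?l z \<le> ln \<gamma>")
    case True
    then have "exp (?l z) \<le> \<gamma>" using g by (metis exp_le_cancel_iff exp_ln)
    then show ?thesis by (auto simp: indicator_def intro!: add_increasing2)
  next
    case False
    then have "0 \<le> s * (?l z - ln \<gamma>)" using s by simp
    then have "?l z \<le> - s * ln \<gamma> + (1 + s) * ?l z" by (simp only: algebra_simps)
    then have "exp (?l z) \<le> \<gamma> powr (-s) * exp ((1 + s) * ?l z)"
      using g by (simp add: powr_def exp_add[symmetric])
    then show ?thesis using g by (auto simp: indicator_def intro: add_increasing)
  qed
  have "hit_prob N0 n (\<lambda>j. v j + d j) A
     \<le> \<gamma> * hit_prob N0 n v A + \<gamma> powr (-s) * exp (s * (1 + s) * ip n d d / N0)"
    by (rule has_bochner_integral_mono[OF I1 _ pt]) (intro has_bochner_integral_add has_bochner_integral_mult_right I2 I3)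
  also have "\<dots> \<le> \<gamma> * hit_prob N0 n v A + \<gamma> powr (-s) * exp (s * (1 + s) * e / N0)"
    using e s N0 by (auto intro!: mult_left_mono divide_right_mono)
  finally show ?thesis .
qed

text \<open>Likelihood ratios of orthogonal shifts are uncorrelated, so their average has mean one
  and variance at most \<open>exp (2 * e / N0) / card I\<close>. A large family of perturbations is
  thus invisible on average even if each single one is visible.\<close>

lemma hit_prob_mixture:
  assumes N0: "N0 > 0" and A: "A \<in> sets (outputs n)" and I: "finite I" "I \<noteq> {}" and t: "t > 0"
    and e: "\<And>i. i \<in> I \<Longrightarrow> ip n (d i) (d i) \<le> e"
    and orth: "\<And>i i'. i \<in> I \<Longrightarrow> i' \<in> I \<Longrightarrow> i \<noteq> i' \<Longrightarrow> ip n (d i) (d i') = 0"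
  shows "(\<Sum>i\<in>I. hit_prob N0 n (\<lambda>j. v j + d i j) A) / card I
    \<le> hit_prob N0 n v A + t + exp (2 * e / N0) / (4 * t * card I)"
proof -
  interpret prob_space "noise N0 n" by (rule prob_space_noise) fact
  let ?B = "{z \<in> space (noise N0 n). translate n v z \<in> A}"
  let ?L = "\<lambda>i z. exp ((2 * ip n (d i) z - ip n (d i) (d i)) / N0)"
  define m where "m = real (card I)"
  have m: "m > 0" using I by (simp add: m_def card_gt_0_iff)
  have B [measurable]: "?B \<in> sets (noise N0 n)" using A by measurable
  have I3: "has_bochner_integral (noise N0 n) (\<lambda>z. indicator ?B z) (hit_prob N0 n v A)"
    unfolding hit_prob_def by (rule has_bochner_integral_real_indicator[OF B]) (simp add: emeasure_eq_measure)
  have L1: "has_bochner_integral (noise N0 n) (?L i) 1" for i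
    using has_bochner_integral_mult_right[OF noise_mgf[OF N0, of n "d i"], of "exp (- ip n (d i) (d i) / N0)"]
    by (simp add: exp_add[symmetric] diff_divide_distrib)
  have L2: "has_bochner_integral (noise N0 n) (\<lambda>z. ?L i z * ?L k z) (exp (2 * ip n (d i) (d k) / N0))" for i k
  proof -
    have "has_bochner_integral (noise N0 n) (\<lambda>z. exp (2 * (ip n (d i) z + ip n (d k) z) / N0))
        (exp ((ip n (d i) (d i) + 2 * ip n (d i) (d k) + ip n (d k) (d k)) / N0))"
      using noise_mgf[OF N0, of n "\<lambda>j. d i j + d k j"]
      by (simp add: ip_add_left ip_add_right ip_commute[of n "d k" "d i"] algebra_simps)
    from has_bochner_integral_mult_right[OF this, of "exp (- (ip n (d i) (d i) + ip n (d k) (d k)) / N0)"]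
    show ?thesis by (simp add: exp_add[symmetric] diff_divide_distrib add_divide_distrib algebra_simps)
  qed
  let ?\<Lambda> = "\<lambda>z. (\<Sum>i\<in>I. ?L i z) / m"
  have LL: "has_bochner_integral (noise N0 n) (\<lambda>z. (\<Sum>i\<in>I. \<Sum>k\<in>I. ?L i z * ?L k z)) (\<Sum>i\<in>I. \<Sum>k\<in>I. exp (2 * ip n (d i) (d k) / N0))"
    by (intro has_bochner_integral_sum L2)
  have Isq: "has_bochner_integral (noise N0 n) (\<lambda>z. (?\<Lambda> z - 1)\<^sup>2)
      ((\<Sum>i\<in>I. \<Sum>k\<in>I. exp (2 * ip n (d i) (d k) / N0)) / m\<^sup>2 - 2 * ((\<Sum>i\<in>I. 1) / m) + 1)"
  proof -
    have "(?\<Lambda> z - 1)\<^sup>2 = (\<Sum>i\<in>I. \<Sum>k\<in>I. ?L i z * ?L k z) / m\<^sup>2 - 2 * ((\<Sum>i\<in>I. ?L i z) / m) + 1" for z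
      by (simp add: power2_eq_square sum_product[symmetric] diff_divide_distrib add_divide_distrib algebra_simps)
    moreover have "has_bochner_integral (noise N0 n) (\<lambda>z. 1 :: real) 1"
      by (simp add: has_bochner_integral_iff prob_space)
    ultimately show ?thesis
      by (simp only:) (intro has_bochner_integral_add has_bochner_integral_diff has_bochner_integral_mult_right
          has_bochner_integral_divide_zero has_bochner_integral_sum LL L1; assumption)
  qed
  \<comment> \<open>Only the diagonal entry of the Gram matrix is large; orthogonality makes each
    other entry exactly 1.\<close>
  have "(\<Sum>k\<in>I. exp (2 * ip n (d i) (d k) / N0)) \<le> exp (2 * e / N0) + m" if i: "i \<in> I" for i
  proof -
    have "(\<Sum>k\<in>I. exp (2 * ip n (d i) (d k) / N0))
       = exp (2 * ip n (d i) (d i) / N0) + (\<Sum>k\<in>I-{i}. exp (2 * ip n (d i) (d k) / N0))"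
      using i I by (simp add: sum.remove)
    also have "(\<Sum>k\<in>I-{i}. exp (2 * ip n (d i) (d k) / N0)) = (\<Sum>k\<in>I-{i}. 1)"
      using orth i by (intro sum.cong) auto
    also have "\<dots> \<le> m" using I by (simp add: m_def card_Diff1_le)
    also have "exp (2 * ip n (d i) (d i) / N0) \<le> exp (2 * e / N0)"
      using e[OF i] N0 by (simp add: divide_right_mono)
    finally show ?thesis by simp
  qed
  then have "(\<Sum>i\<in>I. \<Sum>k\<in>I. exp (2 * ip n (d i) (d k) / N0)) \<le> (\<Sum>i\<in>I. exp (2 * e / N0) + m)"
    by (rule sum_mono)
  also have "\<dots> = m * exp (2 * e / N0) + m\<^sup>2"
    by (simp add: m_def power2_eq_square algebra_simps)
  finally have "(\<Sum>i\<in>I. \<Sum>k\<in>I. exp (2 * ip n (d i) (d k) / N0)) / m\<^sup>2 \<le> (m * exp (2 * e / N0) + m\<^sup>2) / m\<^sup>2"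
    using m by (intro divide_right_mono) auto
  also have "\<dots> = exp (2 * e / N0) / m + 1" using m by (simp add: field_simps power2_eq_square)
  finally have chi: "(\<Sum>i\<in>I. \<Sum>k\<in>I. exp (2 * ip n (d i) (d k) / N0)) / m\<^sup>2 - 2 * ((\<Sum>i\<in>I. 1) / m) + 1
     \<le> exp (2 * e / N0) / m" using m by (simp add: m_def)
  have I1: "has_bochner_integral (noise N0 n) (\<lambda>z. (\<Sum>i\<in>I. indicator ?B z * ?L i z) / m)
       ((\<Sum>i\<in>I. hit_prob N0 n (\<lambda>j. v j + d i j) A) / m)"
    by (intro has_bochner_integral_divide_zero has_bochner_integral_sum has_integral_translate N0 A)
  \<comment> \<open>In place of Cauchy-Schwarz: \<open>y \<le> t + y^2 / (4 * t)\<close> for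
    \<open>y\<close> the deviation of the averaged ratio from 1, which is the square of
    \<open>y - 2 * t\<close>.\<close>
  have pt: "(\<Sum>i\<in>I. indicator ?B z * ?L i z) / m \<le> (1 + t) * indicator ?B z + (?\<Lambda> z - 1)\<^sup>2 / (4 * t)" for z
  proof -
    have "0 \<le> (?\<Lambda> z - 1 - 2 * t)\<^sup>2 / (4 * t)" using t by simp
    also have "\<dots> = (?\<Lambda> z - 1)\<^sup>2 / (4 * t) - ?\<Lambda> z + 1 + t"
      using t by (simp add: power2_eq_square diff_divide_distrib add_divide_distrib algebra_simps)
    finally have "?\<Lambda> z \<le> 1 + t + (?\<Lambda> z - 1)\<^sup>2 / (4 * t)" by simp
    then show ?thesis using t by (auto simp: indicator_def)
  qed
  have "(\<Sum>i\<in>I. hit_prob N0 n (\<lambda>j. v j + d i j) A) / m \<le> (1 + t) * hit_prob N0 n v A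
    + ((\<Sum>i\<in>I. \<Sum>k\<in>I. exp (2 * ip n (d i) (d k) / N0)) / m\<^sup>2 - 2 * ((\<Sum>i\<in>I. 1) / m) + 1) / (4 * t)"
    by (rule has_bochner_integral_mono[OF I1 _ pt])
       (intro has_bochner_integral_add has_bochner_integral_divide_zero has_bochner_integral_mult_right Isq I3)
  also have "\<dots> \<le> (1 + t) * hit_prob N0 n v A + exp (2 * e / N0) / m / (4 * t)"
    using t by (intro add_left_mono divide_right_mono chi) auto
  also have "\<dots> \<le> hit_prob N0 n v A + t + exp (2 * e / N0) / m / (4 * t)"
    using hit_prob_le_1[OF N0, of n v A] t by (simp add: algebra_simps mult_left_le)
  finally show ?thesis by (simp add: m_def mult.commute)
qed

section \<open>Message vectors and the error probability\<close>

definition superposition :: "nat \<Rightarrow> (nat \<Rightarrow> nat \<Rightarrow> nat \<Rightarrow> real) \<Rightarrow> (nat \<Rightarrow> nat) \<Rightarrow> nat \<Rightarrow> real" where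
  "superposition L x W j = (\<Sum>i=1..L. x i (W i) j)"

abbreviation message_vectors :: "nat \<Rightarrow> nat \<Rightarrow> (nat \<Rightarrow> nat) set" where
  "message_vectors L M \<equiv> {1..L} \<rightarrow>\<^sub>E {0..M}"

definition message_prob :: "real \<Rightarrow> nat \<Rightarrow> nat \<Rightarrow> (nat \<Rightarrow> nat) \<Rightarrow> real" where
  "message_prob a L M W = (\<Prod>i=1..L. pmf (message_pmf a M) (W i))"

definition decision_region :: "nat \<Rightarrow> ((nat \<Rightarrow> real) \<Rightarrow> nat \<Rightarrow> nat) \<Rightarrow> (nat \<Rightarrow> nat) \<Rightarrow> (nat \<Rightarrow> real) set" where
  "decision_region n D W = {y \<in> space (outputs n). D y = W}"

lemma decision_region_sets:
  assumes "D \<in> decoders L n M"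
  shows "decision_region n D W \<in> sets (outputs n)"
proof (cases "W \<in> message_vectors L M")
  case True
  then have "D -` {W} \<inter> space (outputs n) \<in> sets (outputs n)"
    using assms unfolding decoders_def by (intro measurable_sets) auto
  then show ?thesis by (simp add: decision_region_def vimage_def Int_def conj_commute)
next
  case False
  then have "decision_region n D W = {}"
    using measurable_space[of D "outputs n"] assms by (fastforce simp: decision_region_def decoders_def)
  then show ?thesis by simp
qed

text \<open>Success, unlike error, is a finite disjoint union of rectangles, one per message vector.
  Vectors outside \<open>message_vectors L M\<close> drop out because a decoder never outputs
  them.\<close>

lemma error_prob_eq:
  assumes N0: "N0 > 0" and a: "0 < a" "a \<le> 1" and M: "1 \<le> M" and D: "D \<in> decoders L n M"
  shows "error_prob N0 a L n M x D
    = 1 - (\<Sum>W\<in>message_vectors L M. message_prob a L M W * hit_prob N0 n (superposition L x W) (decision_region n D W))"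
proof -
  let ?\<Omega> = "message_vectors L M"
  interpret Z: prob_space "noise N0 n" by (rule prob_space_noise) fact
  have mW: "prob_space (messages a L M)" unfolding messages_def
    by (intro prob_space_PiM prob_space_measure_pmf)
  then interpret W: prob_space "messages a L M" .
  interpret P: pair_prob_space "messages a L M" "noise N0 n" by standard
  let ?P = "messages a L M \<Otimes>\<^sub>M noise N0 n"
  interpret PM: product_sigma_finite "\<lambda>_. measure_pmf (message_pmf a M)" by standard
  let ?E = "error_event N0 a L n M x D"
  let ?R = "\<lambda>W. {z \<in> space (noise N0 n). translate n (superposition L x W) z \<in> decision_region n D W}"
  have co: "channel_output L n x W z = translate n (superposition L x W) z" for W z
    by (simp add: channel_output_def translate_def superposition_def)
  have Dmap: "D y \<in> ?\<Omega>" if "y \<in> space (outputs n)" for y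
    using D that measurable_space[of D "outputs n"] by (fastforce simp: decoders_def)
  have tr: "translate n v z \<in> space (outputs n)" if "z \<in> space (noise N0 n)" for v z
    using measurable_space[OF measurable_translate_noise] that by blast
  have sp: "space (messages a L M) = {1..L} \<rightarrow>\<^sub>E UNIV" by (simp add: messages_def space_PiM)
  have succ: "space ?P - ?E = (\<Union>W\<in>?\<Omega>. {W} \<times> ?R W)"
  proof (intro equalityI subsetI)
    fix p assume "p \<in> space ?P - ?E"
    then obtain W z where p: "p = (W, z)" "z \<in> space (noise N0 n)" "D (translate n (superposition L x W) z) = W"
      by (auto simp: error_event_def space_pair_measure co)
    have "W \<in> ?\<Omega>" using Dmap[OF tr[OF p(2)], of "superposition L x W"] p(3) by simp
    moreover have "z \<in> ?R W" using p tr[OF p(2)] by (simp add: decision_region_def)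
    ultimately show "p \<in> (\<Union>W\<in>?\<Omega>. {W} \<times> ?R W)" using p(1) by blast
  next
    fix p assume "p \<in> (\<Union>W\<in>?\<Omega>. {W} \<times> ?R W)"
    then show "p \<in> space ?P - ?E"
      by (auto simp: error_event_def space_pair_measure co decision_region_def sp PiE_iff)
  qed
  have R: "?R W \<in> sets (noise N0 n)" for W
    using measurable_sets[OF measurable_translate_noise decision_region_sets[OF D]]
    by (simp add: vimage_def Int_def conj_commute)
  have W1: "{W} \<in> sets (messages a L M)" "measure (messages a L M) {W} = message_prob a L M W" if "W \<in> ?\<Omega>" for W
  proof -
    have eq: "{W} = PiE {1..L} (\<lambda>i. {W i})" using that by (subst PiE_singleton) (auto simp: PiE_def)
    show "{W} \<in> sets (messages a L M)" unfolding messages_def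
      by (subst eq, intro sets_PiM_I_finite) auto
    have "emeasure (messages a L M) {W} = (\<Prod>i=1..L. emeasure (measure_pmf (message_pmf a M)) {W i})"
      unfolding messages_def by (subst eq, subst PM.emeasure_PiM) auto
    also have "\<dots> = ennreal (message_prob a L M W)"
      by (simp add: emeasure_pmf_single message_prob_def prod_ennreal)
    finally show "measure (messages a L M) {W} = message_prob a L M W"
      by (simp add: W.emeasure_eq_measure message_prob_def prod_nonneg)
  qed
  have "measure ?P (\<Union>W\<in>?\<Omega>. {W} \<times> ?R W) = (\<Sum>W\<in>?\<Omega>. measure ?P ({W} \<times> ?R W))"
    using W1 R by (intro P.P.finite_measure_finite_Union) (auto simp: disjoint_family_on_def finite_PiE)
  also have "\<dots> = (\<Sum>W\<in>?\<Omega>. message_prob a L M W * hit_prob N0 n (superposition L x W) (decision_region n D W))"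
  proof (rule sum.cong[OF refl])
    fix W assume W: "W \<in> ?\<Omega>"
    have "measure ?P ({W} \<times> ?R W) = measure (messages a L M) {W} * measure (noise N0 n) (?R W)"
      unfolding measure_def by (subst Z.emeasure_pair_measure_Times[OF W1(1)[OF W] R]) (rule enn2real_mult)
    then show "measure ?P ({W} \<times> ?R W) = message_prob a L M W * hit_prob N0 n (superposition L x W) (decision_region n D W)"
      by (simp only: W1(2)[OF W] hit_prob_def)
  qed
  finally have "measure ?P (\<Union>W\<in>?\<Omega>. {W} \<times> ?R W) = \<dots>" .
  then have "1 - error_prob N0 a L n M x D = \<dots>"
    using succ P.P.prob_compl[OF error_event_measurable[OF D, of N0 a x]]
    by (simp only: error_prob_def)
  then show ?thesis by simp
qed

lemma message_prob_nonneg [simp]: "0 \<le> message_prob a L M W"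
  by (simp add: message_prob_def prod_nonneg)

lemma sum_pmf_message_active:
  assumes "0 < a" "a \<le> 1" "1 \<le> M"
  shows "(\<Sum>w=1..M. pmf (message_pmf a M) w) = a"
  using assms by (simp add: pmf_message_active)

lemma sum_pmf_message:
  assumes "0 < a" "a \<le> 1" "1 \<le> M"
  shows "(\<Sum>w=0..M. pmf (message_pmf a M) w) = 1"
proof -
  have "{0..M} = insert 0 {1..M}" by auto
  then show ?thesis using assms by (simp add: sum_pmf_message_active pmf_message_0)
qed

section \<open>Independence of the messages and moments of the number of active users\<close>

lemma sum_message_prob_prod:
  assumes "0 < a" "a \<le> 1" "1 \<le> M"
  shows "(\<Sum>W\<in>message_vectors L M. message_prob a L M W * (\<Prod>i=1..L. f i (W i)))
    = (\<Prod>i=1..L. \<Sum>w=0..M. pmf (message_pmf a M) w * f i w)"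
  by (subst prod_sum_PiE) (auto simp: message_prob_def prod.distrib)

lemma sum_message_prob:
  assumes "0 < a" "a \<le> 1" "1 \<le> M"
  shows "(\<Sum>W\<in>message_vectors L M. message_prob a L M W) = 1"
  using sum_message_prob_prod[OF assms, where f = "\<lambda>_ _. 1"] sum_pmf_message[OF assms] by simp

text \<open>Needed for singletons and pairs, which give the first two moments of
  \<open>num_active\<close>. Padding the product of indicators with ones lets the sum factor over
  all users.\<close>

lemma prob_active_set:
  assumes a: "0 < a" "a \<le> 1" "1 \<le> M" and J: "J \<subseteq> {1..L}"
  shows "(\<Sum>W\<in>message_vectors L M. message_prob a L M W * (\<Prod>i\<in>J. of_bool (W i \<noteq> 0))) = a ^ card J"
proof -
  have "(\<Prod>i\<in>J. of_bool (W i \<noteq> 0)) = (\<Prod>i=1..L. if i \<in> J then of_bool (W i \<noteq> 0) else (1::real))" for W :: "nat \<Rightarrow> nat"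
    using J by (intro prod.mono_neutral_cong_left) auto
  then have "(\<Sum>W\<in>message_vectors L M. message_prob a L M W * (\<Prod>i\<in>J. of_bool (W i \<noteq> 0)))
    = (\<Prod>i=1..L. \<Sum>w=0..M. pmf (message_pmf a M) w * (if i \<in> J then of_bool (w \<noteq> 0) else 1))"
    using sum_message_prob_prod[OF a, where f = "\<lambda>i w. if i \<in> J then of_bool (w \<noteq> 0) else 1" and L = L] by simp
  also have "\<dots> = (\<Prod>i=1..L. if i \<in> J then a else 1)"
  proof (rule prod.cong[OF refl])
    have "(\<Sum>w=0..M. pmf (message_pmf a M) w * of_bool (w \<noteq> 0)) = (\<Sum>w=1..M. pmf (message_pmf a M) w)"
      by (intro sum.mono_neutral_cong_right) auto
    then show "(\<Sum>w=0..M. pmf (message_pmf a M) w * (if i \<in> J then of_bool (w \<noteq> 0) else 1))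
      = (if i \<in> J then a else 1)" for i
      using sum_pmf_message[OF a] sum_pmf_message_active[OF a] by simp
  qed
  also have "\<dots> = a ^ card J" using J by (simp add: prod.If_cases Int_absorb1)
  finally show ?thesis .
qed

definition num_active :: "nat \<Rightarrow> (nat \<Rightarrow> nat) \<Rightarrow> real" where
  "num_active L W = (\<Sum>i=1..L. of_bool (W i \<noteq> 0))"

lemma num_active_nonneg [simp]: "0 \<le> num_active L W"
  by (simp add: num_active_def sum_nonneg)

lemma sum_num_active:
  assumes a: "0 < a" "a \<le> 1" "1 \<le> M"
  shows "(\<Sum>W\<in>message_vectors L M. message_prob a L M W * num_active L W) = a * L"
proof -
  have "(\<Sum>W\<in>message_vectors L M. message_prob a L M W * num_active L W)
     = (\<Sum>i=1..L. \<Sum>W\<in>message_vectors L M. message_prob a L M W * of_bool (W i \<noteq> 0))"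
    unfolding num_active_def sum_distrib_left by (rule sum.swap)
  also have "\<dots> = (\<Sum>i=1..L. a)"
  proof (rule sum.cong[OF refl])
    fix i assume "i \<in> {1..L}"
    then show "(\<Sum>W\<in>message_vectors L M. message_prob a L M W * of_bool (W i \<noteq> 0)) = a"
      using prob_active_set[OF a, of "{i}" L] by simp
  qed
  finally show ?thesis by simp
qed

lemma sum_num_active_square:
  assumes a: "0 < a" "a \<le> 1" "1 \<le> M"
  shows "(\<Sum>W\<in>message_vectors L M. message_prob a L M W * (num_active L W)\<^sup>2) \<le> a * L + (a * L)\<^sup>2"
proof -
  have "(\<Sum>W\<in>message_vectors L M. message_prob a L M W * (num_active L W)\<^sup>2)
     = (\<Sum>W\<in>message_vectors L M. \<Sum>i=1..L. \<Sum>k=1..L. message_prob a L M W * (of_bool (W i \<noteq> 0) * of_bool (W k \<noteq> 0)))"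
    unfolding num_active_def power2_eq_square sum_product by (simp only: sum_distrib_left)
  also have "\<dots> = (\<Sum>i=1..L. \<Sum>W\<in>message_vectors L M. \<Sum>k=1..L. message_prob a L M W * (of_bool (W i \<noteq> 0) * of_bool (W k \<noteq> 0)))"
    by (rule sum.swap)
  also have "\<dots> = (\<Sum>i=1..L. \<Sum>k=1..L. \<Sum>W\<in>message_vectors L M. message_prob a L M W * (of_bool (W i \<noteq> 0) * of_bool (W k \<noteq> 0)))"
    by (rule sum.cong[OF refl], rule sum.swap)
  \<comment> \<open>Diagonal pairs contribute \<open>a\<close>, the others \<open>a^2\<close>;
    granting \<open>a^2\<close> to the diagonal as well gives the closed form.\<close>
  also have "\<dots> \<le> (\<Sum>i=1..L. \<Sum>k=1..L. (if k = i then a else 0) + a\<^sup>2)"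
  proof (intro sum_mono)
    fix i k assume ik: "i \<in> {1..L}" "k \<in> {1..L}"
    show "(\<Sum>W\<in>message_vectors L M. message_prob a L M W * (of_bool (W i \<noteq> 0) * of_bool (W k \<noteq> 0)))
      \<le> (if k = i then a else 0) + a\<^sup>2"
    proof (cases "k = i")
      case True
      have "of_bool (W i \<noteq> 0) * of_bool (W i \<noteq> 0) = (of_bool (W i \<noteq> 0) :: real)" for W :: "nat \<Rightarrow> nat" by (cases "W i = 0") auto
      then show ?thesis unfolding True using prob_active_set[OF a, of "{i}" L] ik by (simp only: if_True) simp
    next
      case False
      then show ?thesis using prob_active_set[OF a, of "{i, k}" L] ik by (auto simp: power2_eq_square)
    qed
  qed
  also have "\<dots> = a * L + (a * L)\<^sup>2"
    by (simp add: sum.distrib power2_eq_square algebra_simps)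
  finally show ?thesis .
qed

text \<open>
  Weighting the success probability by the number of active users makes it a sum over users.
  The second moment of that number turns a bound on the weighted probability back into one
  on the error probability.
\<close>

lemma error_prob_lower_bound:
  assumes N0: "N0 > 0" and a: "0 < a" "a \<le> 1" and L: "1 \<le> L" and M: "1 \<le> M" and D: "D \<in> decoders L n M"
    and \<beta>: "0 < \<beta>" "\<beta> \<le> 1"
    and S: "(\<Sum>W\<in>message_vectors L M. message_prob a L M W * num_active L W *
        hit_prob N0 n (superposition L x W) (decision_region n D W)) \<le> (1 - \<beta>) * (a * L)"
  shows "\<beta>\<^sup>2 * (a * L) / (1 + a * L) \<le> error_prob N0 a L n M x D"
proof -
  let ?\<Omega> = "message_vectors L M" and ?p = "message_prob a L M" and ?m = "num_active L"
  let ?S = "\<lambda>W. hit_prob N0 n (superposition L x W) (decision_region n D W)"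
  define k where "k = a * L"
  have k: "k > 0" using a L by (simp add: k_def)
  \<comment> \<open>Chosen so that \<open>t * (k + k\<^sup>2)\<close>, the second-moment term, uses
    up exactly half of the deficit \<open>\<beta> * k\<close>.\<close>
  define t where "t = \<beta> / (2 * (1 + k))"
  have t: "t > 0" using \<beta> k by (simp add: t_def)
  \<comment> \<open>The inequality of arithmetic and geometric means with weight \<open>t\<close>;
    the square of the error probability of \<open>W\<close> is then bounded by that probability
    itself.\<close>
  have pt: "?m W * (1 - ?S W) \<le> t * (?m W)\<^sup>2 + (1 - ?S W) / (4 * t)" for W
  proof -
    let ?e = "1 - ?S W"
    have e: "0 \<le> ?e" "?e \<le> 1" using hit_prob_le_1[OF N0] by auto
    have "0 \<le> (2 * t * ?m W - ?e)\<^sup>2" by simp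
    then have "4 * t * (?m W * ?e) \<le> 4 * t * (t * (?m W)\<^sup>2) + ?e\<^sup>2"
      by (simp add: power2_eq_square algebra_simps)
    also have "?e\<^sup>2 \<le> ?e" using e by (simp add: power2_eq_square mult_left_le)
    finally show ?thesis using t by (simp add: field_simps)
  qed
  have "\<beta> * k \<le> (\<Sum>W\<in>?\<Omega>. ?p W * ?m W) - (\<Sum>W\<in>?\<Omega>. ?p W * ?m W * ?S W)"
    using S unfolding sum_num_active[OF a M] k_def by (simp add: left_diff_distrib)
  also have "\<dots> = (\<Sum>W\<in>?\<Omega>. ?p W * (?m W * (1 - ?S W)))"
    by (simp add: sum_subtractf[symmetric] algebra_simps)
  also have "\<dots> \<le> (\<Sum>W\<in>?\<Omega>. ?p W * (t * (?m W)\<^sup>2 + (1 - ?S W) / (4 * t)))"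
    using pt by (intro sum_mono mult_left_mono) auto
  also have "\<dots> = t * (\<Sum>W\<in>?\<Omega>. ?p W * (?m W)\<^sup>2) + (\<Sum>W\<in>?\<Omega>. ?p W * (1 - ?S W)) / (4 * t)"
    by (simp add: sum_distrib_left sum.distrib algebra_simps sum_divide_distrib)
  also have "(\<Sum>W\<in>?\<Omega>. ?p W * (1 - ?S W)) = error_prob N0 a L n M x D"
    by (simp add: error_prob_eq[OF N0 a M D] algebra_simps sum_subtractf sum_message_prob[OF a M])
  also have "t * (\<Sum>W\<in>?\<Omega>. ?p W * (?m W)\<^sup>2) \<le> t * (k + k\<^sup>2)"
    using t sum_num_active_square[OF a M, of L] by (intro mult_left_mono) (auto simp: k_def)
  also have "t * (k + k\<^sup>2) = \<beta> * k / 2"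
    using k by (simp add: t_def power2_eq_square field_simps)
  finally have "2 * t * (\<beta> * k) \<le> error_prob N0 a L n M x D"
    using t by (simp add: field_simps)
  also have "2 * t * (\<beta> * k) = \<beta>\<^sup>2 * k / (1 + k)"
    using k by (simp add: t_def power2_eq_square field_simps)
  finally show ?thesis by (simp add: k_def)
qed

section \<open>Weighted success probabilities\<close>

text \<open>The offset \<open>v\<close> carries the codewords of all other users, revealed to the receiver.\<close>

definition user_bound :: "real \<Rightarrow> nat \<Rightarrow> nat \<Rightarrow> (nat \<Rightarrow> nat \<Rightarrow> real) \<Rightarrow> real \<Rightarrow> bool" where
  "user_bound N0 n M c s \<longleftrightarrow> (\<forall>v B. (\<forall>w. B w \<in> sets (outputs n)) \<longrightarrow> disjoint_family_on B {1..M} \<longrightarrow>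
     (\<Sum>w=1..M. hit_prob N0 n (\<lambda>j. v j + c w j) (B w)) \<le> M * s)"

lemma user_boundD:
  assumes "user_bound N0 n M c s" "\<And>w. B w \<in> sets (outputs n)" "disjoint_family_on B {1..M}"
  shows "(\<Sum>w=1..M. hit_prob N0 n (\<lambda>j. v j + c w j) (B w)) \<le> M * s"
  using assms by (simp add: user_bound_def)

lemma user_bound_mono: "user_bound N0 n M c s \<Longrightarrow> s \<le> t \<Longrightarrow> user_bound N0 n M c t"
  unfolding user_bound_def by (meson mult_left_mono of_nat_0_le_iff order_trans)

lemma user_bound_1:
  assumes "N0 > 0"
  shows "user_bound N0 n M c 1"
  unfolding user_bound_def
proof (intro allI impI)
  fix v B
  have "(\<Sum>w=1..M. hit_prob N0 n (\<lambda>j. v j + c w j) (B w)) \<le> (\<Sum>w=1..M. 1)"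
    by (intro sum_mono hit_prob_le_1[OF assms])
  then show "(\<Sum>w=1..M. hit_prob N0 n (\<lambda>j. v j + c w j) (B w)) \<le> real M * 1" by simp
qed

text \<open>
  Codewords are compared with the centres of a cover of the codebook: at a common centre the
  decision regions compete for total probability one.
\<close>

lemma user_bound_cover:
  fixes \<gamma> s e :: real
  assumes N0: "N0 > 0" and M: "1 \<le> M" and g: "\<gamma> > 0" and s: "s \<ge> 0" and C: "finite C"
    and z: "\<And>w. w \<in> {1..M} \<Longrightarrow> z w \<in> C"
    and e: "\<And>w. w \<in> {1..M} \<Longrightarrow> ip n (\<lambda>j. c w j - u (z w) j) (\<lambda>j. c w j - u (z w) j) \<le> e"
  shows "user_bound N0 n M c (\<gamma> * card C / M + \<gamma> powr (-s) * exp (s * (1 + s) * e / N0))"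
  unfolding user_bound_def
proof (intro allI impI)
  fix v B assume B: "\<forall>w. B w \<in> sets (outputs n)" and dis: "disjoint_family_on B {1..M}"
  let ?\<tau> = "\<gamma> powr (-s) * exp (s * (1 + s) * e / N0)"
  have "(\<Sum>w=1..M. hit_prob N0 n (\<lambda>j. v j + c w j) (B w))
      \<le> (\<Sum>w=1..M. \<gamma> * hit_prob N0 n (\<lambda>j. v j + u (z w) j) (B w) + ?\<tau>)"
  proof (rule sum_mono)
    fix w assume w: "w \<in> {1..M}"
    have "hit_prob N0 n (\<lambda>j. v j + c w j) (B w)
        = hit_prob N0 n (\<lambda>j. (v j + u (z w) j) + (c w j - u (z w) j)) (B w)"
      by (rule hit_prob_cong) simp
    also have "\<dots> \<le> \<gamma> * hit_prob N0 n (\<lambda>j. v j + u (z w) j) (B w) + ?\<tau>"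
      using B by (intro hit_prob_change_of_measure[where e = e] e[OF w]) (use N0 g s in auto)
    finally show "hit_prob N0 n (\<lambda>j. v j + c w j) (B w) \<le> \<dots>" .
  qed
  also have "\<dots> = \<gamma> * (\<Sum>w=1..M. hit_prob N0 n (\<lambda>j. v j + u (z w) j) (B w)) + M * ?\<tau>"
    by (simp add: sum.distrib sum_distrib_left)
  also have "(\<Sum>w=1..M. hit_prob N0 n (\<lambda>j. v j + u (z w) j) (B w))
      \<le> (\<Sum>w=1..M. \<Sum>k\<in>C. hit_prob N0 n (\<lambda>j. v j + u k j) (B w))"
    using C z by (intro sum_mono member_le_sum) auto
  also have "\<dots> = (\<Sum>k\<in>C. \<Sum>w=1..M. hit_prob N0 n (\<lambda>j. v j + u k j) (B w))"
    by (rule sum.swap)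
  also have "\<dots> \<le> (\<Sum>k\<in>C. 1)"
    using B dis by (intro sum_mono sum_hit_prob_le_1 N0) auto
  finally show "(\<Sum>w=1..M. hit_prob N0 n (\<lambda>j. v j + c w j) (B w)) \<le> M * (\<gamma> * card C / M + ?\<tau>)"
    using g M by (simp add: algebra_simps)
qed

text \<open>The cover with one centre, the zero codeword. The bound becomes small for large
  \<open>e\<close> once \<open>ln M\<close> exceeds \<open>e / N0\<close> by a fixed factor.\<close>

lemma user_bound_ball:
  fixes \<gamma> s e :: real
  assumes N0: "N0 > 0" and M: "1 \<le> M" and g: "\<gamma> > 0" and s: "s \<ge> 0"
    and e: "\<And>w. w \<in> {1..M} \<Longrightarrow> ip n (c w) (c w) \<le> e"
  shows "user_bound N0 n M c (\<gamma> / M + \<gamma> powr (-s) * exp (s * (1 + s) * e / N0))"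
  using user_bound_cover[OF N0 M g s, of "{0::nat}" "\<lambda>_. 0" n c "\<lambda>_ _. 0" e] e by simp

text \<open>For bounded energy the ball bound may exceed 1, so misses are compared in the opposite
  direction: codewords rarely missed would also be rarely missed at the zero signal, but there the
  misses add up to at least \<open>M - 1\<close>.\<close>

lemma user_bound_small_energy:
  assumes N0: "N0 > 0" and M: "2 \<le> M" and e: "\<And>w. w \<in> {1..M} \<Longrightarrow> ip n (c w) (c w) \<le> e"
  shows "user_bound N0 n M c (1 - exp (- 2 * e / N0) / 16)"
  unfolding user_bound_def
proof (intro allI impI)
  fix v B assume B: "\<forall>w. B w \<in> sets (outputs n)" and dis: "disjoint_family_on B {1..M}"
  \<comment> \<open>With \<open>s = 1\<close> this makes the remainder 1/4. Since
    \<open>M - 1 \<ge> M / 2\<close>, misses of at least \<open>M / 4\<close> are left after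
    subtracting it.\<close>
  define \<gamma> where "\<gamma> = 4 * exp (2 * e / N0)"
  have g: "\<gamma> > 0" by (simp add: \<gamma>_def)
  have tau: "\<gamma> powr (-1) * exp (1 * (1 + 1) * e / N0) = 1/4"
    by (simp add: \<gamma>_def powr_minus_divide)
  have "(\<Sum>w=1..M. 1 - hit_prob N0 n v (B w))
      \<le> (\<Sum>w=1..M. \<gamma> * (1 - hit_prob N0 n (\<lambda>j. v j + c w j) (B w)) + 1/4)"
  proof (rule sum_mono)
    fix w assume w: "w \<in> {1..M}"
    let ?A = "space (outputs n) - B w"
    have A: "?A \<in> sets (outputs n)" using B by auto
    have neg: "ip n (\<lambda>j. - c w j) (\<lambda>j. - c w j) \<le> e" using e[OF w] by (simp add: ip_def)
    have "1 - hit_prob N0 n v (B w) = hit_prob N0 n (\<lambda>j. (v j + c w j) + - c w j) ?A"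
      using B by (simp add: hit_prob_compl[OF N0])
    also have "\<dots> \<le> \<gamma> * hit_prob N0 n (\<lambda>j. v j + c w j) ?A + 1/4"
      unfolding tau[symmetric] by (rule hit_prob_change_of_measure[OF N0 A g _ neg]) simp
    also have "hit_prob N0 n (\<lambda>j. v j + c w j) ?A = 1 - hit_prob N0 n (\<lambda>j. v j + c w j) (B w)"
      using B by (simp add: hit_prob_compl[OF N0])
    finally show "1 - hit_prob N0 n v (B w) \<le> \<gamma> * (1 - hit_prob N0 n (\<lambda>j. v j + c w j) (B w)) + 1/4" .
  qed
  also have "\<dots> = \<gamma> * (M - (\<Sum>w=1..M. hit_prob N0 n (\<lambda>j. v j + c w j) (B w))) + M / 4"
    by (simp add: sum.distrib sum_distrib_left[symmetric] sum_subtractf)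
  finally have "real M - (\<Sum>w=1..M. hit_prob N0 n v (B w)) \<le> \<dots>" by (simp add: sum_subtractf)
  moreover have "(\<Sum>w=1..M. hit_prob N0 n v (B w)) \<le> 1"
    using B dis by (intro sum_hit_prob_le_1 N0) auto
  ultimately have "real M / 4 \<le> \<gamma> * (M - (\<Sum>w=1..M. hit_prob N0 n (\<lambda>j. v j + c w j) (B w)))"
    using M by simp
  then have "real M / 4 / \<gamma> \<le> M - (\<Sum>w=1..M. hit_prob N0 n (\<lambda>j. v j + c w j) (B w))"
    using g by (simp add: divide_simps mult.commute)
  moreover have "real M / 4 / \<gamma> = M * (exp (- 2 * e / N0) / 16)"
    by (simp add: \<gamma>_def exp_minus field_simps)
  ultimately show "(\<Sum>w=1..M. hit_prob N0 n (\<lambda>j. v j + c w j) (B w)) \<le> M * (1 - exp (- 2 * e / N0) / 16)"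
    unfolding right_diff_distrib by linarith
qed

section \<open>Conditioning on the messages of all other users\<close>

lemma sum_message_vectors_split:
  assumes i: "i \<in> {1..L}"
  shows "(\<Sum>W\<in>message_vectors L M. f W)
    = (\<Sum>V\<in>{1..L} - {i} \<rightarrow>\<^sub>E {0..M}. \<Sum>w=0..M. f (V(i := w)))"
proof -
  have "(\<Sum>V\<in>{1..L} - {i} \<rightarrow>\<^sub>E {0..M}. \<Sum>w=0..M. f (V(i := w)))
     = (\<Sum>(V, w)\<in>({1..L} - {i} \<rightarrow>\<^sub>E {0..M}) \<times> {0..M}. f (V(i := w)))"
    by (rule sum.cartesian_product)
  also have "\<dots> = (\<Sum>W\<in>message_vectors L M. f W)"
  proof (rule sum.reindex_bij_witness[where i = "\<lambda>W. (W(i := undefined), W i)" and j = "\<lambda>(V, w). V(i := w)"])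
    fix p assume "p \<in> ({1..L} - {i} \<rightarrow>\<^sub>E {0..M}) \<times> {0..M}"
    then obtain V w where p: "p = (V, w)" "V \<in> {1..L} - {i} \<rightarrow>\<^sub>E {0..M}" "w \<in> {0..M}" by blast
    have "V i = undefined" by (rule PiE_arb[OF p(2)]) simp
    then show "((case p of (V, w) \<Rightarrow> V(i := w))(i := undefined), (case p of (V, w) \<Rightarrow> V(i := w)) i) = p"
      unfolding p(1) by (simp add: fun_upd_idem)
    have "V(i := w) \<in> insert i ({1..L} - {i}) \<rightarrow>\<^sub>E {0..M}" using p(2,3) by (intro PiE_fun_upd)
    moreover have "insert i ({1..L} - {i}) = {1..L}" using i by blast
    ultimately show "(case p of (V, w) \<Rightarrow> V(i := w)) \<in> message_vectors L M" unfolding p(1) by simp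
  next
    fix W assume W: "W \<in> message_vectors L M"
    show "(case (W(i := undefined), W i) of (V, w) \<Rightarrow> V(i := w)) = W" by simp
    have "W(i := undefined) \<in> {1..L} - {i} \<rightarrow>\<^sub>E {0..M}"
      by (rule PiE_I) (use PiE_mem[OF W] PiE_arb[OF W] in \<open>auto split: if_splits\<close>)
    then show "(W(i := undefined), W i) \<in> ({1..L} - {i} \<rightarrow>\<^sub>E {0..M}) \<times> {0..M}"
      using PiE_mem[OF W i] by blast
  qed (auto simp: case_prod_beta)
  finally show ?thesis by simp
qed

lemma message_prob_upd:
  assumes "i \<in> {1..L}"
  shows "message_prob a L M (V(i := w))
    = pmf (message_pmf a M) w * (\<Prod>k\<in>{1..L}-{i}. pmf (message_pmf a M) (V k))"
  using assms by (simp add: message_prob_def prod.remove[where x = i])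

lemma superposition_upd:
  assumes "i \<in> {1..L}"
  shows "superposition L x (V(i := w)) j = (\<Sum>k\<in>{1..L}-{i}. x k (V k) j) + x i w j"
  using assms by (simp add: superposition_def sum.remove[where x = i])

lemma sum_other_users:
  fixes i L :: nat
  assumes a: "0 < a" "a \<le> 1" "1 \<le> M"
  shows "(\<Sum>V\<in>{1..L} - {i} \<rightarrow>\<^sub>E {0..M}. \<Prod>k\<in>{1..L}-{i}. pmf (message_pmf a M) (V k)) = 1"
  by (subst prod_sum_PiE[symmetric]) (auto simp: sum_pmf_message[OF a])

text \<open>Given the other messages, the nonzero messages of user \<open>i\<close> all have weight
  \<open>a / M\<close>; this is where the uniform law of the messages enters.\<close>

lemma sum_active_user:
  assumes i: "i \<in> {1..L}" and a: "0 < a" "a \<le> 1" "1 \<le> M"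
  shows "(\<Sum>W\<in>message_vectors L M. message_prob a L M W * of_bool (W i \<noteq> 0) * f W)
    = (a / M) * (\<Sum>V\<in>{1..L} - {i} \<rightarrow>\<^sub>E {0..M}.
        (\<Prod>k\<in>{1..L}-{i}. pmf (message_pmf a M) (V k)) * (\<Sum>w=1..M. f (V(i := w))))"
proof -
  have "(\<Sum>w=0..M. message_prob a L M (V(i := w)) * of_bool ((V(i := w)) i \<noteq> 0) * f (V(i := w)))
     = (a / M) * ((\<Prod>k\<in>{1..L}-{i}. pmf (message_pmf a M) (V k)) * (\<Sum>w=1..M. f (V(i := w))))" for V
  proof -
    have "(\<Sum>w=0..M. message_prob a L M (V(i := w)) * of_bool ((V(i := w)) i \<noteq> 0) * f (V(i := w)))
       = (\<Sum>w=1..M. message_prob a L M (V(i := w)) * f (V(i := w)))"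
      by (rule sum.mono_neutral_cong_right) auto
    also have "\<dots> = (\<Sum>w=1..M. (a / M) * ((\<Prod>k\<in>{1..L}-{i}. pmf (message_pmf a M) (V k)) * f (V(i := w))))"
      using a by (intro sum.cong refl) (simp add: message_prob_upd[OF i] pmf_message_active)
    finally show ?thesis by (simp only: sum_distrib_left)
  qed
  then show ?thesis
    by (simp add: sum_message_vectors_split[OF i] sum_distrib_left)
qed

text \<open>For fixed messages of the others, the regions of \<open>V(i := w)\<close> are disjoint
  in \<open>w\<close>, so a single-user bound applies with the other codewords as offset. The
  codebook \<open>c\<close> need not be \<open>x i\<close>: the attenuation argument inserts a
  scaled one.\<close>

lemma user_bound_lift:
  fixes s :: real
  assumes N0: "N0 > 0" and i: "i \<in> {1..L}" and a: "0 < a" "a \<le> 1" "1 \<le> M" and D: "D \<in> decoders L n M"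
    and c: "user_bound N0 n M c s"
  shows "(\<Sum>W\<in>message_vectors L M. message_prob a L M W * of_bool (W i \<noteq> 0) *
     hit_prob N0 n (\<lambda>j. superposition L x W j - x i (W i) j + c (W i) j) (decision_region n D W)) \<le> a * s"
proof -
  let ?q = "\<lambda>V. \<Prod>k\<in>{1..L}-{i}. pmf (message_pmf a M) (V k)"
  let ?f = "\<lambda>W. hit_prob N0 n (\<lambda>j. superposition L x W j - x i (W i) j + c (W i) j) (decision_region n D W)"
  have "(\<Sum>w=1..M. ?f (V(i := w))) \<le> M * s" for V
  proof -
    have "disjoint_family_on (\<lambda>w. decision_region n D (V(i := w))) {1..M}"
      by (auto simp: disjoint_family_on_def decision_region_def) (metis fun_upd_same)
    from user_boundD[OF c decision_region_sets[OF D] this, of "\<lambda>j. \<Sum>k\<in>{1..L}-{i}. x k (V k) j"]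
    show ?thesis by (simp add: superposition_upd[OF i])
  qed
  then have "(\<Sum>V\<in>{1..L} - {i} \<rightarrow>\<^sub>E {0..M}. ?q V * (\<Sum>w=1..M. ?f (V(i := w))))
     \<le> (\<Sum>V\<in>{1..L} - {i} \<rightarrow>\<^sub>E {0..M}. ?q V * (M * s))"
    by (intro sum_mono mult_left_mono prod_nonneg) auto
  also have "\<dots> = M * s" using sum_other_users[OF a, of L i] by (simp add: sum_distrib_right[symmetric])
  finally have "(a / M) * (\<Sum>V\<in>{1..L} - {i} \<rightarrow>\<^sub>E {0..M}. ?q V * (\<Sum>w=1..M. ?f (V(i := w)))) \<le> (a / M) * (M * s)"
    using a by (intro mult_left_mono) auto
  also have "(a / M) * (M * s) = a * s" using a by simp
  finally show ?thesis unfolding sum_active_user[OF i a] .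
qed

lemma weighted_success_eq:
  "(\<Sum>W\<in>message_vectors L M. message_prob a L M W * num_active L W * f W)
    = (\<Sum>i=1..L. \<Sum>W\<in>message_vectors L M. message_prob a L M W * of_bool (W i \<noteq> 0) * f W)"
proof -
  have "(\<Sum>W\<in>message_vectors L M. message_prob a L M W * num_active L W * f W)
     = (\<Sum>W\<in>message_vectors L M. \<Sum>i=1..L. message_prob a L M W * of_bool (W i \<noteq> 0) * f W)"
    by (simp only: num_active_def sum_distrib_left sum_distrib_right)
  also have "\<dots> = (\<Sum>i=1..L. \<Sum>W\<in>message_vectors L M. message_prob a L M W * of_bool (W i \<noteq> 0) * f W)"
    by (rule sum.swap)
  finally show ?thesis .
qed

lemma weighted_success_users:
  assumes N0: "N0 > 0" and a: "0 < a" "a \<le> 1" "1 \<le> M" and D: "D \<in> decoders L n M"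
    and c: "\<And>i. i \<in> {1..L} \<Longrightarrow> user_bound N0 n M (x i) (s i)"
  shows "(\<Sum>W\<in>message_vectors L M. message_prob a L M W * num_active L W *
      hit_prob N0 n (superposition L x W) (decision_region n D W)) \<le> a * (\<Sum>i=1..L. s i)"
  unfolding weighted_success_eq sum_distrib_left
proof (rule sum_mono)
  fix i assume i: "i \<in> {1..L}"
  show "(\<Sum>W\<in>message_vectors L M. message_prob a L M W * of_bool (W i \<noteq> 0) *
      hit_prob N0 n (superposition L x W) (decision_region n D W)) \<le> a * s i"
    using user_bound_lift[OF N0 i a D c[OF i], where x = x] by simp
qed

text \<open>
  One active user, together with its message, is hidden among all the inactive ones. The
  vector in which this user is inactive serves as the common reference.
\<close>

lemma weighted_success_activity:
  fixes \<gamma> s e :: real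
  assumes N0: "N0 > 0" and a: "0 < a" "a < 1" "1 \<le> M" and D: "D \<in> decoders L n M"
    and g: "\<gamma> > 0" and s: "s \<ge> 0"
    and x0: "\<And>i j. i \<in> {1..L} \<Longrightarrow> j \<in> {1..n} \<Longrightarrow> x i 0 j = 0"
    and e: "\<And>i w. i \<in> {1..L} \<Longrightarrow> w \<in> {1..M} \<Longrightarrow> ip n (x i w) (x i w) \<le> e"
  shows "(\<Sum>W\<in>message_vectors L M. message_prob a L M W * num_active L W *
      hit_prob N0 n (superposition L x W) (decision_region n D W))
    \<le> a / (1 - a) * (\<gamma> / M + L * (\<gamma> powr (-s) * exp (s * (1 + s) * e / N0)))"
proof -
  let ?\<Omega> = "message_vectors L M" and ?p = "message_prob a L M"
  let ?\<tau> = "\<gamma> powr (-s) * exp (s * (1 + s) * e / N0)"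
  let ?R = "decision_region n D"
  let ?S = "\<lambda>W. hit_prob N0 n (superposition L x W) (?R W)"
  let ?h = "\<lambda>V W. hit_prob N0 n (superposition L x V) (?R W)"
  have al: "a \<le> 1" using a by simp
  \<comment> \<open>A change of prior: activating user \<open>i\<close> with message
    \<open>w\<close> multiplies the probability of the vector by \<open>a / ((1 - a) * M)\<close>.
    The sum then runs over the vectors that serve as references.\<close>
  have change: "(\<Sum>W\<in>?\<Omega>. ?p W * of_bool (W i \<noteq> 0) * ?S W)
    = a / ((1 - a) * M) * (\<Sum>V\<in>?\<Omega>. ?p V * of_bool (V i = 0) * (\<Sum>w=1..M. ?S (V(i := w))))"
    if i: "i \<in> {1..L}" for i
  proof -
    let ?q = "\<lambda>V. \<Prod>k\<in>{1..L}-{i}. pmf (message_pmf a M) (V k)"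
    have "(\<Sum>w=0..M. ?p (V(i := w)) * of_bool ((V(i := w)) i = 0) * (\<Sum>w'=1..M. ?S (V(i := w, i := w'))))
       = (1 - a) * (?q V * (\<Sum>w'=1..M. ?S (V(i := w'))))" for V
    proof -
      have "(\<Sum>w=0..M. ?p (V(i := w)) * of_bool ((V(i := w)) i = 0) * (\<Sum>w'=1..M. ?S (V(i := w, i := w'))))
        = (\<Sum>w\<in>{0}. ?p (V(i := w)) * of_bool ((V(i := w)) i = 0) * (\<Sum>w'=1..M. ?S (V(i := w, i := w'))))"
        by (rule sum.mono_neutral_right) auto
      then show ?thesis using a by (simp add: message_prob_upd[OF i] pmf_message_0)
    qed
    then have "(\<Sum>V\<in>?\<Omega>. ?p V * of_bool (V i = 0) * (\<Sum>w=1..M. ?S (V(i := w))))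
       = (1 - a) * (\<Sum>V\<in>{1..L} - {i} \<rightarrow>\<^sub>E {0..M}. ?q V * (\<Sum>w'=1..M. ?S (V(i := w'))))"
      by (simp add: sum_message_vectors_split[OF i] sum_distrib_left)
    then show ?thesis unfolding sum_active_user[OF i a(1) al a(3)] using a by simp
  qed
  have step: "(\<Sum>i=1..L. of_bool (V i = 0) * (\<Sum>w=1..M. ?S (V(i := w)))) \<le> \<gamma> + L * M * ?\<tau>" if V: "V \<in> ?\<Omega>" for V
  proof -
    let ?J = "{i\<in>{1..L}. V i = 0}"
    have fin: "finite ?J" by simp
    have "(\<Sum>i=1..L. of_bool (V i = 0) * (\<Sum>w=1..M. ?S (V(i := w)))) = (\<Sum>i\<in>?J. \<Sum>w=1..M. ?S (V(i := w)))"
      by (rule sum.mono_neutral_cong_right) auto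
    also have "\<dots> \<le> (\<Sum>i\<in>?J. \<Sum>w=1..M. \<gamma> * ?h V (V(i := w)) + ?\<tau>)"
    proof (intro sum_mono)
      fix i w assume i: "i \<in> ?J" and w: "w \<in> {1..M}"
      have i1: "i \<in> {1..L}" using i by simp
      \<comment> \<open>Because message 0 is silent, switching on user \<open>i\<close> only adds
        its codeword to the reference signal.\<close>
      have "?S (V(i := w)) = hit_prob N0 n (\<lambda>j. superposition L x V j + x i w j) (?R (V(i := w)))"
      proof (rule hit_prob_cong)
        fix j assume j: "j \<in> {1..n}"
        have "superposition L x V j = (\<Sum>k\<in>{1..L}-{i}. x k (V k) j) + x i 0 j"
          using superposition_upd[OF i1, of x V 0 j] i by (simp add: fun_upd_idem)
        then show "superposition L x (V(i := w)) j = superposition L x V j + x i w j"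
          using x0[OF i1 j] by (simp add: superposition_upd[OF i1])
      qed
      also have "\<dots> \<le> \<gamma> * ?h V (V(i := w)) + ?\<tau>"
        by (rule hit_prob_change_of_measure[OF N0 decision_region_sets[OF D] g s e[OF i1 w]])
      finally show "?S (V(i := w)) \<le> \<gamma> * ?h V (V(i := w)) + ?\<tau>" .
    qed
    also have "\<dots> = \<gamma> * (\<Sum>(i, w)\<in>?J \<times> {1..M}. ?h V (V(i := w))) + card ?J * (M * ?\<tau>)"
      by (simp add: sum.distrib sum_distrib_left sum.cartesian_product case_prod_beta)
    finally have A: "(\<Sum>i=1..L. of_bool (V i = 0) * (\<Sum>w=1..M. ?S (V(i := w))))
      \<le> \<gamma> * (\<Sum>(i, w)\<in>?J \<times> {1..M}. ?h V (V(i := w))) + card ?J * (M * ?\<tau>)" .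
    \<comment> \<open>Different pairs \<open>(i, w)\<close> give different vectors, so about
      \<open>L * M\<close> hypotheses, not just \<open>M\<close>, share total probability one at the
      same reference. This is the source of the additional \<open>ln L\<close>.\<close>
    have "(\<Sum>(i, w)\<in>?J \<times> {1..M}. ?h V (V(i := w))) = (\<Sum>k\<in>?J \<times> {1..M}. ?h V (V(fst k := snd k)))"
      by (simp add: case_prod_beta)
    also have "\<dots> \<le> 1"
    proof (rule sum_hit_prob_le_1[OF N0])
      show "disjoint_family_on (\<lambda>k. ?R (V(fst k := snd k))) (?J \<times> {1..M})"
        unfolding disjoint_family_on_def
      proof (intro ballI impI)
        fix k l assume kl: "k \<in> ?J \<times> {1..M}" "l \<in> ?J \<times> {1..M}" "k \<noteq> l"
        have "V(fst k := snd k) \<noteq> V(fst l := snd l)"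
        proof
          assume eq: "V(fst k := snd k) = V(fst l := snd l)"
          from fun_cong[OF eq, of "fst k"] fun_cong[OF eq, of "fst l"] kl show False
            by (cases k; cases l) (auto split: if_splits)
        qed
        then show "?R (V(fst k := snd k)) \<inter> ?R (V(fst l := snd l)) = {}"
          by (auto simp: decision_region_def)
      qed
    qed (use decision_region_sets[OF D] in auto)
    finally have "\<gamma> * (\<Sum>(i, w)\<in>?J \<times> {1..M}. ?h V (V(i := w))) \<le> \<gamma> * 1"
      using g by (intro mult_left_mono) auto
    note bound = add_right_mono[OF this]
    have cJ: "card ?J \<le> card {1..L}" by (rule card_mono) auto
    note A
    also note bound
    also have "\<gamma> * 1 + card ?J * (M * ?\<tau>) \<le> \<gamma> * 1 + L * (M * ?\<tau>)"
      using cJ by (intro add_left_mono mult_right_mono) auto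
    finally show ?thesis by (simp add: mult.assoc)
  qed
  let ?G = "\<lambda>i V. of_bool (V i = 0) * (\<Sum>w=1..M. ?S (V(i := w)))"
  have "(\<Sum>W\<in>?\<Omega>. ?p W * num_active L W * ?S W)
    = (\<Sum>i=1..L. a / ((1 - a) * M) * (\<Sum>V\<in>?\<Omega>. ?p V * ?G i V))"
    unfolding weighted_success_eq using change by (intro sum.cong refl) (simp only: mult.assoc)
  also have "\<dots> = a / ((1 - a) * M) * (\<Sum>i=1..L. \<Sum>V\<in>?\<Omega>. ?p V * ?G i V)"
    by (rule sum_distrib_left[symmetric])
  also have "(\<Sum>i=1..L. \<Sum>V\<in>?\<Omega>. ?p V * ?G i V) = (\<Sum>V\<in>?\<Omega>. \<Sum>i=1..L. ?p V * ?G i V)"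
    by (rule sum.swap)
  also have "\<dots> = (\<Sum>V\<in>?\<Omega>. ?p V * (\<Sum>i=1..L. ?G i V))"
    by (simp only: sum_distrib_left)
  also have "a / ((1 - a) * M) * \<dots> \<le> a / ((1 - a) * M) * (\<gamma> + L * M * ?\<tau>)"
  proof (rule mult_left_mono)
    have "(\<Sum>V\<in>?\<Omega>. ?p V * (\<Sum>i=1..L. ?G i V)) \<le> (\<Sum>V\<in>?\<Omega>. ?p V * (\<gamma> + L * M * ?\<tau>))"
      by (intro sum_mono mult_left_mono step message_prob_nonneg)
    then show "(\<Sum>V\<in>?\<Omega>. ?p V * (\<Sum>i=1..L. ?G i V)) \<le> \<gamma> + L * M * ?\<tau>"
      unfolding sum_distrib_right[symmetric] sum_message_prob[OF a(1) al a(3)] by simp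
  qed (use a in simp)
  also have "a / ((1 - a) * M) * (\<gamma> + L * M * ?\<tau>) = a / (1 - a) * (\<gamma> / M + L * ?\<tau>)"
    using a by (simp add: field_simps)
  finally show ?thesis .
qed

text \<open>
  Attenuating the codeword of one random active user by the factor \<open>1 - \<theta>\<close> is almost
  undetectable when there are many active users, because the chi-square distance of a mixture
  of orthogonal perturbations is inversely proportional to their number. This replaces
  the independence of the users' projections of the noise.
\<close>

lemma weighted_success_attenuation:
  fixes s t e :: real
  assumes N0: "N0 > 0" and a: "0 < a" "a \<le> 1" "1 \<le> M" and D: "D \<in> decoders L n M"
    and t: "t > 0" and \<theta>: "0 \<le> \<theta>"
    and e: "\<And>i w. i \<in> {1..L} \<Longrightarrow> w \<in> {1..M} \<Longrightarrow> ip n (x i w) (x i w) \<le> e"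
    and orth: "orthogonal_access L n M x"
    and c: "\<And>i. i \<in> {1..L} \<Longrightarrow> user_bound N0 n M (\<lambda>w j. (1 - \<theta>) * x i w j) s"
  shows "(\<Sum>W\<in>message_vectors L M. message_prob a L M W * num_active L W *
      hit_prob N0 n (superposition L x W) (decision_region n D W))
    \<le> a * L * (s + t) + exp (2 * (\<theta>\<^sup>2 * e) / N0) / (4 * t)"
proof -
  let ?\<Omega> = "message_vectors L M" and ?p = "message_prob a L M"
  let ?S = "\<lambda>W. hit_prob N0 n (superposition L x W) (decision_region n D W)"
  let ?T = "\<lambda>i W. hit_prob N0 n (\<lambda>j. superposition L x W j - x i (W i) j + (1 - \<theta>) * x i (W i) j) (decision_region n D W)"
  let ?\<chi> = "exp (2 * (\<theta>\<^sup>2 * e) / N0) / (4 * t)"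
  have step: "num_active L W * ?S W \<le> (\<Sum>i=1..L. of_bool (W i \<noteq> 0) * ?T i W) + num_active L W * t + ?\<chi>"
    if W: "W \<in> ?\<Omega>" for W
  proof -
    let ?I = "{i\<in>{1..L}. W i \<noteq> 0}"
    have m: "num_active L W = card ?I"
      by (simp add: num_active_def Int_def)
    show ?thesis
    proof (cases "?I = {}")
      case True
      have "num_active L W = 0" unfolding m True by simp
      then show ?thesis using t by (simp add: sum_nonneg)
    next
      case False
      \<comment> \<open>\<open>hit_prob_mixture\<close> bounds perturbed probabilities by
        unperturbed ones. Applied to failure, it bounds the true success from above by the average
        success with one attenuated codeword.\<close>
      let ?A = "space (outputs n) - decision_region n D W"
      let ?d = "\<lambda>i j. - \<theta> * x i (W i) j"
      have w: "W i \<in> {1..M}" if "i \<in> ?I" for i using W that PiE_mem[OF W, of i] by auto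
      have "(\<Sum>i\<in>?I. hit_prob N0 n (\<lambda>j. superposition L x W j + ?d i j) ?A) / card ?I
        \<le> hit_prob N0 n (superposition L x W) ?A + t + exp (2 * (\<theta>\<^sup>2 * e) / N0) / (4 * t * card ?I)"
      proof (rule hit_prob_mixture[OF N0 _ _ False t])
        show "ip n (?d i) (?d i) \<le> \<theta>\<^sup>2 * e" if "i \<in> ?I" for i
        proof -
          have "ip n (?d i) (?d i) = \<theta>\<^sup>2 * ip n (x i (W i)) (x i (W i))"
            by (simp only: ip_scale_left ip_scale_right) (simp add: power2_eq_square)
          also have "\<dots> \<le> \<theta>\<^sup>2 * e" using e[of i "W i"] w[OF that] that by (intro mult_left_mono) auto
          finally show ?thesis .
        qed
        show "ip n (?d i) (?d i') = 0" if "i \<in> ?I" "i' \<in> ?I" "i \<noteq> i'" for i i'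
          using orth that w unfolding orthogonal_access_def
          by (simp only: ip_scale_left ip_scale_right) (simp add: ip_def)
      qed (use decision_region_sets[OF D] in auto)
      moreover have "hit_prob N0 n (\<lambda>j. superposition L x W j + ?d i j) ?A = 1 - ?T i W" for i
        using decision_region_sets[OF D] by (simp add: hit_prob_compl[OF N0] algebra_simps)
      moreover have "hit_prob N0 n (superposition L x W) ?A = 1 - ?S W"
        using decision_region_sets[OF D] by (simp add: hit_prob_compl[OF N0])
      ultimately have "(\<Sum>i\<in>?I. 1 - ?T i W) / card ?I \<le> 1 - ?S W + t + ?\<chi> / card ?I"
        by (simp add: mult.commute)
      moreover have c0: "real (card ?I) > 0" using False by (simp add: card_gt_0_iff)
      moreover have alg: "y / c \<le> 1 - S + t + z / c \<Longrightarrow> c > 0 \<Longrightarrow> y \<le> c - c * S + c * t + z" for y c S z :: real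
        by (simp add: field_simps)
      ultimately have "(\<Sum>i\<in>?I. 1 - ?T i W) \<le> card ?I - card ?I * ?S W + card ?I * t + ?\<chi>"
        by (intro alg)
      then have "card ?I * ?S W \<le> (\<Sum>i\<in>?I. ?T i W) + card ?I * t + ?\<chi>"
        by (simp add: sum_subtractf)
      also have "(\<Sum>i\<in>?I. ?T i W) = (\<Sum>i=1..L. of_bool (W i \<noteq> 0) * ?T i W)"
        by (rule sum.mono_neutral_cong_left) auto
      finally show ?thesis unfolding m .
    qed
  qed
  have "(\<Sum>W\<in>?\<Omega>. ?p W * num_active L W * ?S W)
    \<le> (\<Sum>W\<in>?\<Omega>. ?p W * ((\<Sum>i=1..L. of_bool (W i \<noteq> 0) * ?T i W) + num_active L W * t + ?\<chi>))"
    using step by (simp only: mult.assoc) (intro sum_mono mult_left_mono; simp)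
  also have "\<dots> = (\<Sum>W\<in>?\<Omega>. \<Sum>i=1..L. ?p W * of_bool (W i \<noteq> 0) * ?T i W)
      + (\<Sum>W\<in>?\<Omega>. ?p W * num_active L W) * t + (\<Sum>W\<in>?\<Omega>. ?p W) * ?\<chi>"
    by (simp only: distrib_left sum.distrib sum_distrib_left sum_distrib_right mult.assoc)
  also have "(\<Sum>W\<in>?\<Omega>. \<Sum>i=1..L. ?p W * of_bool (W i \<noteq> 0) * ?T i W)
      = (\<Sum>i=1..L. \<Sum>W\<in>?\<Omega>. ?p W * of_bool (W i \<noteq> 0) * ?T i W)"
    by (rule sum.swap)
  also have "\<dots> \<le> (\<Sum>i=1..L. a * s)"
    by (intro sum_mono user_bound_lift[OF N0 _ a D c]) auto
  finally show ?thesis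
    by (simp only: sum_num_active[OF a] sum_message_prob[OF a]) (simp add: algebra_simps)
qed

section \<open>Orthogonal codebooks and covers\<close>

definition orthonormal :: "nat \<Rightarrow> 'i set \<Rightarrow> ('i \<Rightarrow> nat \<Rightarrow> real) \<Rightarrow> bool" where
  "orthonormal n K b \<longleftrightarrow> (\<forall>k\<in>K. \<forall>l\<in>K. ip n (b k) (b l) = of_bool (k = l))"

lemma ip_cong: "(\<And>j. j \<in> {1..n} \<Longrightarrow> u j = u' j) \<Longrightarrow> (\<And>j. j \<in> {1..n} \<Longrightarrow> v j = v' j) \<Longrightarrow> ip n u v = ip n u' v'"
  by (simp add: ip_def)

lemma ip_combination_left: "ip n (\<lambda>j. \<Sum>k\<in>K. a k * b k j) w = (\<Sum>k\<in>K. a k * ip n (b k) w)"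
  by (subst ip_sum_left) (simp add: ip_scale_left)

lemma ip_combination_basis:
  assumes "finite K" "orthonormal n K b" "l \<in> K"
  shows "ip n (\<lambda>j. \<Sum>k\<in>K. a k * b k j) (b l) = a l"
proof -
  have "ip n (\<lambda>j. \<Sum>k\<in>K. a k * b k j) (b l) = (\<Sum>k\<in>K. if k = l then a k else 0)"
    using assms by (auto simp: ip_combination_left orthonormal_def intro!: sum.cong)
  then show ?thesis using assms by simp
qed

lemma parseval:
  assumes "finite K" "orthonormal n K b"
  shows "ip n (\<lambda>j. \<Sum>k\<in>K. a k * b k j) (\<lambda>j. \<Sum>k\<in>K. a k * b k j) = (\<Sum>k\<in>K. (a k)\<^sup>2)"
proof -
  let ?v = "\<lambda>j. \<Sum>k\<in>K. a k * b k j"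
  have "ip n ?v ?v = (\<Sum>k\<in>K. a k * ip n ?v (b k))"
    by (subst ip_combination_left) (simp add: ip_commute)
  also have "\<dots> = (\<Sum>k\<in>K. (a k)\<^sup>2)"
    using ip_combination_basis[OF assms] by (intro sum.cong) (auto simp: power2_eq_square)
  finally show ?thesis .
qed

lemma bessel:
  assumes "finite K" "orthonormal n K b"
  shows "(\<Sum>k\<in>K. (ip n v (b k))\<^sup>2) \<le> ip n v v"
proof -
  let ?p = "\<lambda>j. \<Sum>k\<in>K. ip n v (b k) * b k j"
  have "0 \<le> ip n (\<lambda>j. v j - ?p j) (\<lambda>j. v j - ?p j)" by (rule ip_self_nonneg)
  also have "\<dots> = ip n v v - 2 * ip n ?p v + ip n ?p ?p"
    by (simp add: ip_diff_left ip_commute[of n _ "\<lambda>j. v j - ?p j"]) (simp add: ip_commute[of n v])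
  also have "ip n ?p v = (\<Sum>k\<in>K. (ip n v (b k))\<^sup>2)"
    by (simp add: ip_combination_left ip_commute[of n _ v] power2_eq_square)
  also have "ip n ?p ?p = (\<Sum>k\<in>K. (ip n v (b k))\<^sup>2)" by (rule parseval[OF assms])
  finally show ?thesis by simp
qed

text \<open>A trace argument: the squared norms add up to \<open>card K\<close>, and Bessel's
  inequality for the unit vectors shows that each of the \<open>n\<close> coordinates contributes at
  most 1.\<close>

lemma orthonormal_card_le:
  assumes fin: "finite K" and on: "orthonormal n K b"
  shows "card K \<le> n"
proof -
  have "real (card K) = (\<Sum>k\<in>K. ip n (b k) (b k))"
    using on by (simp add: orthonormal_def)
  also have "\<dots> = (\<Sum>j=1..n. \<Sum>k\<in>K. (b k j)\<^sup>2)"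
    unfolding ip_def power2_eq_square by (rule sum.swap)
  also have "\<dots> \<le> (\<Sum>j=1..n. 1)"
  proof (rule sum_mono)
    fix j assume j: "j \<in> {1..n}"
    let ?e = "\<lambda>i. of_bool (i = j) :: real"
    have e: "ip n ?e v = v j" for v using j by (simp add: ip_def of_bool_def if_distrib[of "\<lambda>x. x * _"] cong: if_cong)
    show "(\<Sum>k\<in>K. (b k j)\<^sup>2) \<le> 1" using bessel[OF fin on, of ?e] by (simp add: e)
  qed
  finally show ?thesis by simp
qed

lemma ip_self_eq_0:
  assumes "ip n r r = 0" "j \<in> {1..n}"
  shows "r j = 0"
  using assms by (simp add: ip_def sum_nonneg_eq_0_iff)

text \<open>
  The last clause says that the basis lies in the span of the codebook, in a form in which
  orthogonality passes from codebooks to bases.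
\<close>

lemma orthonormal_basis_exists:
  fixes c :: "nat \<Rightarrow> nat \<Rightarrow> real"
  shows "\<exists>(d :: nat) b. orthonormal n {..<d} b
    \<and> (\<forall>w\<in>{1..M}. \<forall>j\<in>{1..n}. c w j = (\<Sum>k<d. ip n (c w) (b k) * b k j))
    \<and> (\<forall>k<d. \<forall>y. (\<forall>w\<in>{1..M}. ip n y (c w) = 0) \<longrightarrow> ip n y (b k) = 0)"
proof (induction M)
  case 0
  show ?case by (rule exI[of _ "0::nat"], rule exI[of _ "\<lambda>_ _. 0"]) (simp add: orthonormal_def)
next
  case (Suc M)
  then obtain d and b :: "nat \<Rightarrow> nat \<Rightarrow> real" where on: "orthonormal n {..<d} b"
    and rep: "\<And>w j. w \<in> {1..M} \<Longrightarrow> j \<in> {1..n} \<Longrightarrow> c w j = (\<Sum>k<d. ip n (c w) (b k) * b k j)"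
    and sp: "\<And>k y. k < d \<Longrightarrow> (\<And>w. w \<in> {1..M} \<Longrightarrow> ip n y (c w) = 0) \<Longrightarrow> ip n y (b k) = 0"
    by blast
  let ?v = "c (Suc M)"
  \<comment> \<open>One step of Gram-Schmidt: \<open>p\<close> projects the new codeword on the
    current basis, and the residual \<open>r\<close> yields a new basis vector only if it is
    nonzero.\<close>
  define p where "p = (\<lambda>j. \<Sum>k<d. ip n ?v (b k) * b k j)"
  define r where "r = (\<lambda>j. ?v j - p j)"
  have pb: "ip n p (b k) = ip n ?v (b k)" if "k < d" for k
    unfolding p_def using that by (intro ip_combination_basis on) auto
  have rb: "ip n r (b k) = 0" if "k < d" for k
    unfolding r_def using pb[OF that] by (simp add: ip_diff_left)
  have rp: "ip n r p = 0"
    by (subst ip_commute) (simp add: p_def ip_combination_left ip_commute[of n _ r] rb)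
  have vr: "ip n ?v r = ip n r r"
  proof -
    have "ip n r r = ip n ?v r - ip n p r" unfolding r_def by (rule ip_diff_left)
    then show ?thesis using rp by (simp add: ip_commute)
  qed
  have cr: "ip n (c w) r = 0" if "w \<in> {1..M}" for w
  proof -
    have "ip n (c w) r = ip n (\<lambda>j. \<Sum>k<d. ip n (c w) (b k) * b k j) r"
      using rep[OF that] by (intro ip_cong) auto
    also have "\<dots> = 0" by (simp add: ip_combination_left ip_commute[of n _ r] rb)
    finally show ?thesis .
  qed
  have yr: "ip n y r = 0" if y: "\<And>w. w \<in> {1..Suc M} \<Longrightarrow> ip n y (c w) = 0" for y
  proof -
    have "ip n y p = 0"
      by (subst ip_commute) (use sp[of _ y] y in \<open>simp add: p_def ip_combination_left ip_commute[of n _ y]\<close>)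
    moreover have "ip n y r = ip n y ?v - ip n y p"
      unfolding r_def by (subst (1 2 3) ip_commute) (rule ip_diff_left)
    ultimately show ?thesis using y[of "Suc M"] by simp
  qed
  have set: "{1..Suc M} = insert (Suc M) {1..M}" by auto
  show ?case
  proof (cases "ip n r r = 0")
    case True
    have "?v j = (\<Sum>k<d. ip n ?v (b k) * b k j)" if "j \<in> {1..n}" for j
      using ip_self_eq_0[OF True that] by (simp add: r_def p_def)
    then show ?thesis using on rep sp unfolding set by (intro exI[of _ d] exI[of _ b]) auto
  next
    case False
    define s where "s = sqrt (ip n r r)"
    have s: "s > 0" "s * s = ip n r r" using False ip_self_nonneg[of n r] by (auto simp: s_def less_le)
    define q where "q = (\<lambda>j. (1 / s) * r j)"
    define b' where "b' = b(d := q)"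
    have b'1: "b' k = b k" if "k < d" for k using that by (simp add: b'_def)
    have b'2: "b' d = q" by (simp add: b'_def)
    have sum': "(\<Sum>k<Suc d. ip n v (b' k) * b' k j) = (\<Sum>k<d. ip n v (b k) * b k j) + ip n v q * q j" for v j
      by (simp add: b'1 b'2)
    have qq: "ip n q q = 1" unfolding q_def ip_scale_left ip_scale_right s(2)[symmetric] using s(1) by simp
    have qb: "ip n q (b k) = 0" if "k < d" for k unfolding q_def ip_scale_left using rb[OF that] by simp
    have bq: "ip n (b k) q = 0" if "k < d" for k using qb[OF that] by (simp only: ip_commute[of n "b k"])
    have "orthonormal n {..<Suc d} b'"
      unfolding orthonormal_def
    proof (intro ballI)
      fix k l assume "k \<in> {..<Suc d}" "l \<in> {..<Suc d}"
      then consider "k < d" "l < d" | "k = d" "l < d" | "k < d" "l = d" | "k = d" "l = d" by force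
      then show "ip n (b' k) (b' l) = of_bool (k = l)"
        using on qq qb bq by cases (auto simp: b'1 b'2 orthonormal_def)
    qed
    moreover have "c w j = (\<Sum>k<Suc d. ip n (c w) (b' k) * b' k j)" if w: "w \<in> {1..Suc M}" and j: "j \<in> {1..n}" for w j
    proof (cases "w = Suc M")
      case True
      have "ip n ?v q * q j = r j" unfolding q_def ip_scale_right vr s(2)[symmetric] using s(1) by simp
      then show ?thesis unfolding sum' True by (simp add: r_def p_def)
    next
      case False
      then have w': "w \<in> {1..M}" using w by simp
      have "ip n (c w) q = 0" unfolding q_def ip_scale_right using cr[OF w'] by simp
      then show ?thesis unfolding sum' using rep[OF w' j] by simp
    qed
    moreover have "ip n y (b' k) = 0" if k: "k < Suc d" and y: "\<forall>w\<in>{1..Suc M}. ip n y (c w) = 0" for k y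
    proof (cases "k < d")
      case True
      then show ?thesis using sp[of k y] y by (simp add: b'1)
    next
      case False
      then have "k = d" using k by simp
      then show ?thesis using yr[of y] y unfolding \<open>k = d\<close> b'2 q_def ip_scale_right by simp
    qed
    ultimately show ?thesis by blast
  qed
qed

text \<open>Applying the span clause once for each of two users carries orthogonality of codewords
  over to their bases. The union of all bases is then orthonormal and has at most \<open>n\<close>
  elements.\<close>

lemma orthogonal_dimensions:
  assumes orth: "orthogonal_access L n M x"
  shows "\<exists>d b. (\<Sum>i=1..L. d i) \<le> n \<and> (\<forall>i\<in>{1..L}. orthonormal n {..<d i} (b i)
    \<and> (\<forall>w\<in>{1..M}. \<forall>j\<in>{1..n}. x i w j = (\<Sum>k<d i. ip n (x i w) (b i k) * b i k j)))"
proof -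
  have "\<forall>i. \<exists>(d :: nat) b. orthonormal n {..<d} b
    \<and> (\<forall>w\<in>{1..M}. \<forall>j\<in>{1..n}. x i w j = (\<Sum>k<d. ip n (x i w) (b k) * b k j))
    \<and> (\<forall>k<d. \<forall>y. (\<forall>w\<in>{1..M}. ip n y (x i w) = 0) \<longrightarrow> ip n y (b k) = 0)"
    using orthonormal_basis_exists by blast
  from choice[OF this] obtain d where "\<forall>i. \<exists>b. orthonormal n {..<d i :: nat} b
    \<and> (\<forall>w\<in>{1..M}. \<forall>j\<in>{1..n}. x i w j = (\<Sum>k<d i. ip n (x i w) (b k) * b k j))
    \<and> (\<forall>k<d i. \<forall>y. (\<forall>w\<in>{1..M}. ip n y (x i w) = 0) \<longrightarrow> ip n y (b k) = 0)" by blast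
  from choice[OF this] obtain b where b: "\<forall>i. orthonormal n {..<d i} (b i)
    \<and> (\<forall>w\<in>{1..M}. \<forall>j\<in>{1..n}. x i w j = (\<Sum>k<d i. ip n (x i w) (b i k) * b i k j))
    \<and> (\<forall>k<d i. \<forall>y. (\<forall>w\<in>{1..M}. ip n y (x i w) = 0) \<longrightarrow> ip n y (b i k) = 0)" by blast
  then have on: "\<And>i. orthonormal n {..<d i} (b i)"
    and rep: "\<And>i w j. w \<in> {1..M} \<Longrightarrow> j \<in> {1..n} \<Longrightarrow> x i w j = (\<Sum>k<d i. ip n (x i w) (b i k) * b i k j)"
    by blast+
  have sp: "ip n y (b i k) = 0" if "k < d i" "\<And>w. w \<in> {1..M} \<Longrightarrow> ip n y (x i w) = 0" for i k y
    using b that by blast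
  let ?K = "SIGMA i:{1..L}. {..<d i}"
  have cross: "ip n (b i k) (b i' k') = 0" if "i \<in> {1..L}" "i' \<in> {1..L}" "i \<noteq> i'" "k < d i" "k' < d i'" for i i' k k'
  proof (rule sp[OF that(5)])
    fix w' assume w': "w' \<in> {1..M}"
    have "ip n (x i' w') (b i k) = 0"
    proof (rule sp[OF that(4)])
      fix w assume "w \<in> {1..M}"
      then show "ip n (x i' w') (x i w) = 0"
        using orth that w' by (auto simp: orthogonal_access_def ip_def)
    qed
    then show "ip n (b i k) (x i' w') = 0" by (simp add: ip_commute)
  qed
  have "orthonormal n ?K (\<lambda>(i, k). b i k)"
    unfolding orthonormal_def
  proof (intro ballI)
    fix p q assume pq: "p \<in> ?K" "q \<in> ?K"
    obtain i k i' k' where e: "p = (i, k)" "q = (i', k')" by (cases p; cases q) auto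
    show "ip n (case p of (i, k) \<Rightarrow> b i k) (case q of (i, k) \<Rightarrow> b i k) = of_bool (p = q)"
    proof (cases "i = i'")
      case True
      then show ?thesis using on[of i] pq unfolding e by (simp add: orthonormal_def)
    next
      case False
      then show ?thesis using cross[of i i' k k'] pq unfolding e by simp
    qed
  qed
  then have "card ?K \<le> n" by (intro orthonormal_card_le) auto
  then show ?thesis using on rep by (intro exI[of _ d] exI[of _ b]) auto
qed

section \<open>Counting lattice points and covering codebooks\<close>

lemma abs_le_square_int: "\<bar>y\<bar> \<le> y\<^sup>2" for y :: int
proof (cases "y = 0")
  case False
  then have "\<bar>y\<bar> * 1 \<le> \<bar>y\<bar> * \<bar>y\<bar>" by (intro mult_left_mono) auto
  then show ?thesis by (simp add: power2_eq_square)
qed simp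

lemma sum_geometric_int: "(\<Sum>z=- int Z..int Z. (1/2::real) ^ nat \<bar>z\<bar>) = 3 - 2 * (1/2) ^ Z"
proof (induction Z)
  case (Suc Z)
  have "{- int (Suc Z)..int (Suc Z)} = insert (int (Suc Z)) (insert (- int (Suc Z)) {- int Z..int Z})" by auto
  moreover have "nat (1 + int Z) = Suc Z" "nat (int Z + 1) = Suc Z" by auto
  ultimately show ?case using Suc by simp
qed simp

text \<open>
  Weighting the lattice point \<open>z\<close> by \<open>2\<close> to the power \<open>-\<Sum>\<bar>z\<^sub>k\<bar>\<close> makes the total
  weight at most \<open>3\<^sup>d\<close>.
\<close>

lemma card_lattice_points:
  fixes C :: "(nat \<Rightarrow> int) set"
  assumes C: "C \<subseteq> {..<d} \<rightarrow>\<^sub>E UNIV" and B: "\<And>z. z \<in> C \<Longrightarrow> real_of_int (\<Sum>k<d. (z k)\<^sup>2) \<le> B" and B0: "B \<ge> 0"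
  shows "card C \<le> 2 powr B * 3 ^ d"
proof -
  \<comment> \<open>Only makes the box finite; the final bound does not depend on it.\<close>
  define Z where "Z = nat \<lceil>B\<rceil>"
  have zb: "z \<in> {..<d} \<rightarrow>\<^sub>E {- int Z..int Z}" if z: "z \<in> C" for z
  proof (rule PiE_I)
    fix k assume k: "k \<in> {..<d}"
    have "\<bar>z k\<bar> \<le> (z k)\<^sup>2" by (rule abs_le_square_int)
    also have "\<dots> \<le> (\<Sum>k<d. (z k)\<^sup>2)" using k by (intro member_le_sum) auto
    finally have "real_of_int \<bar>z k\<bar> \<le> B" using B[OF z] by linarith
    then show "z k \<in> {- int Z..int Z}" using B0 by (auto simp: Z_def abs_le_iff le_ceiling_iff) linarith+
  next
    fix k assume "k \<notin> {..<d}"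
    then show "z k = undefined" using C z by (auto simp: PiE_def extensional_def)
  qed
  have fin: "finite ({..<d} \<rightarrow>\<^sub>E {- int Z..int Z})" by (intro finite_PiE) auto
  have "real (card C) = (\<Sum>z\<in>C. 1)" by simp
  \<comment> \<open>An integer is at most its square in absolute value, so every point of
    \<open>C\<close> has weight at least \<open>2 powr (- B)\<close>.\<close>
  also have "\<dots> \<le> (\<Sum>z\<in>C. 2 powr B * (\<Prod>k<d. (1/2) ^ nat \<bar>z k\<bar>))"
  proof (rule sum_mono)
    fix z assume z: "z \<in> C"
    let ?s = "\<Sum>k<d. nat \<bar>z k\<bar>"
    have "(\<Sum>k<d. \<bar>z k\<bar>) \<le> (\<Sum>k<d. (z k)\<^sup>2)" by (intro sum_mono abs_le_square_int)
    moreover have "real ?s = real_of_int (\<Sum>k<d. \<bar>z k\<bar>)" by simp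
    ultimately have "real ?s \<le> B" using B[OF z] by linarith
    then have "1 \<le> 2 powr (B - real ?s)" by (simp add: ge_one_powr_ge_zero)
    also have "\<dots> = 2 powr B / 2 ^ ?s" by (subst powr_diff, subst powr_realpow) auto
    also have "\<dots> = 2 powr B * (1/2) ^ ?s" by (simp add: power_one_over)
    finally show "1 \<le> 2 powr B * (\<Prod>k<d. (1/2) ^ nat \<bar>z k\<bar>)" by (simp add: power_sum)
  qed
  also have "\<dots> \<le> (\<Sum>z\<in>{..<d} \<rightarrow>\<^sub>E {- int Z..int Z}. 2 powr B * (\<Prod>k<d. (1/2) ^ nat \<bar>z k\<bar>))"
    using zb fin by (intro sum_mono2) (auto intro!: prod_nonneg mult_nonneg_nonneg)
  also have "\<dots> = 2 powr B * (\<Prod>k<d. \<Sum>z=- int Z..int Z. (1/2) ^ nat \<bar>z\<bar>)"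
    by (subst prod_sum_PiE) (auto simp: sum_distrib_left)
  also have "\<dots> = 2 powr B * (3 - 2 * (1/2) ^ Z) ^ d"
    by (simp add: sum_geometric_int)
  also have "\<dots> \<le> 2 powr B * 3 ^ d"
    using power_le_one[of "1/2::real" Z] by (intro mult_left_mono power_mono) auto
  finally show ?thesis .
qed

text \<open>Coefficients are rounded down to a grid of width \<open>h\<close>. The squared error is
  at most \<open>d * h\<^sup>2\<close>, and the lattice points have squared norm at most
  \<open>2 * E / h\<^sup>2 + 2 * d\<close>. With \<open>h\<close> proportional to
  \<open>sqrt (E / d)\<close> the size of the cover depends on \<open>d\<close> and
  \<open>\<rho>\<close> but not on \<open>E\<close>.\<close>

lemma codebook_cover:
  fixes d M :: nat and E :: real
  assumes on: "orthonormal n {..<d} b" and rep: "\<And>w j. w \<in> {1..M} \<Longrightarrow> j \<in> {1..n} \<Longrightarrow> c w j = (\<Sum>k<d. ip n (c w) (b k) * b k j)"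
    and e: "\<And>w. w \<in> {1..M} \<Longrightarrow> ip n (c w) (c w) \<le> E" and E: "E > 0" and \<rho>: "\<rho> > 0"
  shows "\<exists>(C :: (nat \<Rightarrow> int) set) z u. finite C \<and> card C \<le> exp (((2 / \<rho>\<^sup>2 + 2) * ln 2 + ln 3) * d)
    \<and> (\<forall>w\<in>{1..M}. z w \<in> C \<and> ip n (\<lambda>j. c w j - u (z w) j) (\<lambda>j. c w j - u (z w) j) \<le> \<rho>\<^sup>2 * E)"
proof -
  \<comment> \<open>The value 1 for \<open>d = 0\<close> only keeps \<open>h\<close>
    positive.\<close>
  define h where "h = (if d = 0 then 1 else \<rho> * sqrt (E / d))"
  have h: "h > 0" using E \<rho> by (simp add: h_def)
  have dh: "d * h\<^sup>2 \<le> \<rho>\<^sup>2 * E" using E by (simp add: h_def power_mult_distrib)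
  have Eh: "E / h\<^sup>2 = d / \<rho>\<^sup>2" if "d > 0" using that E \<rho> by (simp add: h_def power_mult_distrib)
  define a where "a w k = ip n (c w) (b k)" for w k
  define z where "z w = (\<lambda>k\<in>{..<d}. \<lfloor>a w k / h\<rfloor>)" for w
  define u where "u y j = (\<Sum>k<d. h * real_of_int (y k) * b k j)" for y :: "nat \<Rightarrow> int" and j
  define C where "C = z ` {1..M}"
  have a2: "(\<Sum>k<d. (a w k)\<^sup>2) \<le> E" if w: "w \<in> {1..M}" for w
  proof -
    have "ip n (c w) (c w) = ip n (\<lambda>j. \<Sum>k<d. a w k * b k j) (\<lambda>j. \<Sum>k<d. a w k * b k j)"
      using rep[OF w] unfolding a_def by (intro ip_cong) auto
    then show ?thesis using e[OF w] parseval[OF _ on, of "a w"] by simp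
  qed
  have "real (card C) \<le> 2 powr ((2 / \<rho>\<^sup>2 + 2) * d) * 3 ^ d"
  proof (rule card_lattice_points)
    show "C \<subseteq> {..<d} \<rightarrow>\<^sub>E UNIV" by (auto simp: C_def z_def split: if_splits)
    show "0 \<le> (2 / \<rho>\<^sup>2 + 2) * real d" by simp
    fix y assume "y \<in> C"
    then obtain w where w: "w \<in> {1..M}" "y = z w" by (auto simp: C_def)
    have "real_of_int ((y k)\<^sup>2) \<le> 2 * (a w k)\<^sup>2 / h\<^sup>2 + 2" if "k < d" for k
    proof -
      let ?r = "a w k / h"
      have "(?r - real_of_int \<lfloor>?r\<rfloor>)\<^sup>2 \<le> 1"
        by (rule power_le_one) (linarith+)
      moreover have "q\<^sup>2 \<le> 2 * r\<^sup>2 + 2" if "(r - q)\<^sup>2 \<le> 1" for q r :: real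
        using that zero_le_power2[of "2 * r - q"] by (simp add: power2_eq_square algebra_simps)
      ultimately have "(real_of_int \<lfloor>?r\<rfloor>)\<^sup>2 \<le> 2 * ?r\<^sup>2 + 2" by blast
      then show ?thesis using that by (simp add: w(2) z_def power_divide)
    qed
    then have "(\<Sum>k<d. real_of_int ((y k)\<^sup>2)) \<le> (\<Sum>k<d. 2 * (a w k)\<^sup>2 / h\<^sup>2 + 2)"
      by (intro sum_mono) auto
    also have "\<dots> = 2 * ((\<Sum>k<d. (a w k)\<^sup>2) / h\<^sup>2) + 2 * d"
      by (simp add: sum.distrib sum_distrib_left sum_divide_distrib)
    also have "\<dots> \<le> 2 * (E / h\<^sup>2) + 2 * d"
      using a2[OF w(1)] by (intro add_right_mono mult_left_mono divide_right_mono) auto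
    also have "\<dots> \<le> (2 / \<rho>\<^sup>2 + 2) * d" if "d > 0" using Eh[OF that] by (simp add: algebra_simps)
    finally show "real_of_int (\<Sum>k<d. (y k)\<^sup>2) \<le> (2 / \<rho>\<^sup>2 + 2) * d" by (cases "d = 0") simp_all
  qed
  also have "\<dots> = exp (((2 / \<rho>\<^sup>2 + 2) * ln 2 + ln 3) * d)"
  proof -
    have "(3::real) ^ d = exp (ln 3 * d)" by (simp add: exp_of_nat2_mult)
    then show ?thesis by (simp add: powr_def exp_add algebra_simps)
  qed
  finally have "card C \<le> exp (((2 / \<rho>\<^sup>2 + 2) * ln 2 + ln 3) * d)" .
  moreover have "ip n (\<lambda>j. c w j - u (z w) j) (\<lambda>j. c w j - u (z w) j) \<le> \<rho>\<^sup>2 * E" if w: "w \<in> {1..M}" for w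
  proof -
    let ?r = "\<lambda>k. a w k - h * real_of_int (z w k)"
    have "ip n (\<lambda>j. c w j - u (z w) j) (\<lambda>j. c w j - u (z w) j)
        = ip n (\<lambda>j. \<Sum>k<d. ?r k * b k j) (\<lambda>j. \<Sum>k<d. ?r k * b k j)"
      using rep[OF w] by (intro ip_cong) (auto simp: u_def a_def sum_subtractf left_diff_distrib)
    also have "\<dots> = (\<Sum>k<d. (?r k)\<^sup>2)" by (rule parseval[OF _ on]) simp
    also have "\<dots> \<le> (\<Sum>k<d. h\<^sup>2)"
    proof (rule sum_mono)
      fix k assume k: "k \<in> {..<d}"
      have "h * real_of_int \<lfloor>a w k / h\<rfloor> \<le> h * (a w k / h)"
        "h * (a w k / h) \<le> h * (real_of_int \<lfloor>a w k / h\<rfloor> + 1)"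
        using h by (intro mult_left_mono; linarith)+
      then have "0 \<le> ?r k" "?r k \<le> h" using h k by (auto simp: z_def distrib_left)
      then show "(?r k)\<^sup>2 \<le> h\<^sup>2" by (intro power_mono) auto
    qed
    also have "\<dots> \<le> \<rho>\<^sup>2 * E" using dh by simp
    finally show ?thesis .
  qed
  ultimately show ?thesis by (intro exI[of _ C] exI[of _ z] exI[of _ u]) (auto simp: C_def)
qed

section \<open>Codes for time division\<close>

text \<open>A cruder bound than \<open>cosh x \<le> exp (x^2 / 2)\<close>, but enough for small
  correlations, and it follows from quadratic bounds on both exponentials.\<close>

lemma cosh_le_exp_square:
  fixes x :: real
  assumes "0 \<le> x" "x \<le> 1"
  shows "exp x + exp (- x) \<le> 2 * exp (x\<^sup>2)"
proof -
  have "exp (- x) \<le> 1 / (1 + x)"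
    using assms exp_ge_add_one_self[of x] by (simp add: exp_minus field_simps)
  also have "\<dots> \<le> 1 - x + x\<^sup>2"
    using assms by (simp add: field_simps power2_eq_square)
  finally have "exp x + exp (- x) \<le> 2 * (1 + x\<^sup>2)"
    using exp_bound[OF assms] by simp
  also have "\<dots> \<le> 2 * exp (x\<^sup>2)" by (intro mult_left_mono exp_ge_add_one_self) simp
  finally show ?thesis .
qed

text \<open>Derandomization: the signs are chosen one coordinate at a time.\<close>

lemma sign_vector_exists:
  fixes v :: "'k \<Rightarrow> nat \<Rightarrow> real"
  assumes fin: "finite K" and v: "\<And>k j. k \<in> K \<Longrightarrow> v k j \<in> {1, -1}" and \<beta>: "0 \<le> \<beta>" "\<beta> \<le> 1"
  shows "\<exists>c. (\<forall>j. c j \<in> {1, -1}) \<and> (\<Sum>k\<in>K. exp (\<beta> * (\<Sum>j=1..N. c j * v k j))) \<le> exp (\<beta>\<^sup>2 * N) * card K"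
proof (induction N)
  case 0
  show ?case by (intro exI[of _ "\<lambda>_. 1"]) simp
next
  case (Suc N)
  then obtain c where c: "\<And>j. c j \<in> {1, -1}"
    and le: "(\<Sum>k\<in>K. exp (\<beta> * (\<Sum>j=1..N. c j * v k j))) \<le> exp (\<beta>\<^sup>2 * N) * card K" by blast
  let ?G = "\<lambda>k. exp (\<beta> * (\<Sum>j=1..N. c j * v k j))"
  let ?c = "\<lambda>\<sigma>. c(Suc N := \<sigma>)"
  let ?F = "\<lambda>\<sigma>. \<Sum>k\<in>K. exp (\<beta> * (\<Sum>j=1..Suc N. ?c \<sigma> j * v k j))"
  have F: "?F \<sigma> = (\<Sum>k\<in>K. ?G k * exp (\<beta> * (\<sigma> * v k (Suc N))))" for \<sigma>
    by (intro sum.cong refl) (simp add: exp_add[symmetric] algebra_simps)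
  have "?F 1 + ?F (-1) = (\<Sum>k\<in>K. ?G k * (exp \<beta> + exp (- \<beta>)))"
    unfolding F sum.distrib[symmetric]
  proof (rule sum.cong[OF refl])
    fix k assume "k \<in> K"
    from v[OF this, of "Suc N"]
    show "?G k * exp (\<beta> * (1 * v k (Suc N))) + ?G k * exp (\<beta> * (- 1 * v k (Suc N))) = ?G k * (exp \<beta> + exp (- \<beta>))"
      by (auto simp: algebra_simps)
  qed
  also have "\<dots> = (\<Sum>k\<in>K. ?G k) * (exp \<beta> + exp (- \<beta>))" by (rule sum_distrib_right[symmetric])
  also have "\<dots> \<le> (exp (\<beta>\<^sup>2 * N) * card K) * (2 * exp (\<beta>\<^sup>2))"
    by (intro mult_mono le cosh_le_exp_square \<beta>) (auto intro: add_nonneg_nonneg)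
  also have "\<dots> = 2 * (exp (\<beta>\<^sup>2 * Suc N) * card K)"
    by (simp add: exp_add algebra_simps)
  \<comment> \<open>The two choices of the next sign meet the target on average, so one of them
    meets it.\<close>
  finally have "?F 1 \<le> exp (\<beta>\<^sup>2 * Suc N) * card K \<or> ?F (-1) \<le> exp (\<beta>\<^sup>2 * Suc N) * card K" by linarith
  then obtain \<sigma> :: real where "\<sigma> \<in> {1, -1}" "?F \<sigma> \<le> exp (\<beta>\<^sup>2 * Suc N) * card K" by blast
  then show ?case using c by (intro exI[of _ "?c \<sigma>"]) auto
qed

text \<open>Greedy construction: the exponential sum of the correlations with all earlier words
  bounds each single correlation of the new word.\<close>

lemma sign_codebook_exists:
  assumes \<theta>: "0 < \<theta>" "\<theta> \<le> 1" and M: "real M \<le> exp (\<theta>\<^sup>2 * N / 4)"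
  shows "\<exists>c :: nat \<Rightarrow> nat \<Rightarrow> real. (\<forall>w j. c w j \<in> {1, -1})
    \<and> (\<forall>w\<in>{1..M}. \<forall>w'\<in>{1..M}. w \<noteq> w' \<longrightarrow> (\<Sum>j=1..N. c w j * c w' j) \<le> \<theta> * N)"
  using M
proof (induction M)
  case 0
  show ?case by (intro exI[of _ "\<lambda>_ _. 1"]) simp
next
  case (Suc M)
  from Suc.prems have "real M \<le> exp (\<theta>\<^sup>2 * N / 4)" by simp
  from Suc.IH[OF this] obtain v :: "nat \<Rightarrow> nat \<Rightarrow> real" where v: "\<And>w j. v w j \<in> {1, -1}"
    and corr: "\<And>w w'. w \<in> {1..M} \<Longrightarrow> w' \<in> {1..M} \<Longrightarrow> w \<noteq> w' \<Longrightarrow> (\<Sum>j=1..N. v w j * v w' j) \<le> \<theta> * N" by blast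
  \<comment> \<open>This maximises \<open>\<beta> * \<theta> - \<beta>^2\<close>. The maximum
    \<open>\<theta>^2 / 4\<close> is the exponent allowed for \<open>M\<close>.\<close>
  let ?\<beta> = "\<theta> / 2"
  obtain c where c: "\<And>j. c j \<in> {1, -1}"
    and le: "(\<Sum>k\<in>{1..M}. exp (?\<beta> * (\<Sum>j=1..N. c j * v k j))) \<le> exp (?\<beta>\<^sup>2 * N) * card {1..M}"
    using sign_vector_exists[of "{1..M}" v ?\<beta> N] v \<theta> by auto
  have new: "(\<Sum>j=1..N. c j * v k j) \<le> \<theta> * N" if k: "k \<in> {1..M}" for k
  proof -
    have "exp (?\<beta> * (\<Sum>j=1..N. c j * v k j)) \<le> (\<Sum>k\<in>{1..M}. exp (?\<beta> * (\<Sum>j=1..N. c j * v k j)))"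
      using k by (intro member_le_sum) auto
    also have "\<dots> \<le> exp (?\<beta>\<^sup>2 * N) * card {1..M}" by (rule le)
    also have "\<dots> \<le> exp (?\<beta>\<^sup>2 * N) * exp (\<theta>\<^sup>2 * N / 4)"
      using Suc.prems by (intro mult_left_mono) auto
    also have "\<dots> = exp (?\<beta> * (\<theta> * N))"
      by (simp add: exp_add[symmetric] power2_eq_square)
    finally show ?thesis using \<theta> by simp
  qed
  let ?u = "v(Suc M := c)"
  have "(\<Sum>j=1..N. ?u w j * ?u w' j) \<le> \<theta> * N" if "w \<in> {1..Suc M}" "w' \<in> {1..Suc M}" "w \<noteq> w'" for w w'
  proof -
    consider "w = Suc M" "w' \<in> {1..M}" | "w' = Suc M" "w \<in> {1..M}" | "w \<in> {1..M}" "w' \<in> {1..M}"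
      using \<open>w \<in> _\<close> \<open>w' \<in> _\<close> \<open>w \<noteq> w'\<close> by (cases "w = Suc M"; cases "w' = Suc M") auto
    then show ?thesis
    proof cases
      case 1
      then show ?thesis using new[of w'] by simp
    next
      case 2
      then show ?thesis using new[of w] by (simp add: mult.commute)
    next
      case 3
      then show ?thesis using corr[of w w'] that(3) by auto
    qed
  qed
  moreover have "\<forall>w j. ?u w j \<in> {1, -1}" using v c by auto
  ultimately show ?case by blast
qed

text \<open>A decoder may be specified by disjoint measurable regions that need not cover the output
  space; all remaining outputs go to the all-zero vector.\<close>

lemma decoder_exists:
  assumes sets: "\<And>W. W \<in> message_vectors L M \<Longrightarrow> B W \<in> sets (outputs n)"
    and dis: "disjoint_family_on B (message_vectors L M)"
  shows "\<exists>D\<in>decoders L n M. \<forall>W\<in>message_vectors L M. B W \<subseteq> decision_region n D W"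
proof -
  let ?\<Omega> = "message_vectors L M"
  define W0 where "W0 = (\<lambda>i\<in>{1..L}. 0::nat)"
  have W0: "W0 \<in> ?\<Omega>" by (auto simp: W0_def)
  have fin: "finite ?\<Omega>" by (intro finite_PiE) auto
  define D where "D y = (if \<exists>W\<in>?\<Omega>. y \<in> B W then THE W. W \<in> ?\<Omega> \<and> y \<in> B W else W0)" for y
  have D1: "D y = W" if "W \<in> ?\<Omega>" "y \<in> B W" for y W
  proof -
    have "(THE W. W \<in> ?\<Omega> \<and> y \<in> B W) = W"
    proof (rule the_equality)
      fix V assume V: "V \<in> ?\<Omega> \<and> y \<in> B V"
      show "V = W"
      proof (rule ccontr)
        assume "V \<noteq> W"
        then have "B V \<inter> B W = {}" using dis V that(1) unfolding disjoint_family_on_def by blast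
        then show False using V that(2) by blast
      qed
    qed (use that in simp)
    moreover have "\<exists>W\<in>?\<Omega>. y \<in> B W" using that by blast
    ultimately show ?thesis by (simp only: D_def if_True)
  qed
  have D0: "D y = W0" if "\<And>W. W \<in> ?\<Omega> \<Longrightarrow> y \<notin> B W" for y using that by (auto simp: D_def)
  have B: "B W \<subseteq> space (outputs n)" if "W \<in> ?\<Omega>" for W using sets.sets_into_space[OF sets[OF that]] .
  have "D \<in> decoders L n M"
    unfolding decoders_def
  proof (subst measurable_count_space_eq2[OF fin], intro conjI ballI)
    show "D \<in> space (outputs n) \<rightarrow> ?\<Omega>"
    proof
      fix y
      show "D y \<in> ?\<Omega>"
      proof (cases "\<exists>W\<in>?\<Omega>. y \<in> B W")
        case True
        then obtain W where "W \<in> ?\<Omega>" "y \<in> B W" by blast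
        then show ?thesis using D1 by simp
      next
        case False
        then have "D y = W0" by (intro D0) blast
        then show ?thesis using W0 by simp
      qed
    qed
    fix W assume W: "W \<in> ?\<Omega>"
    have "D -` {W} \<inter> space (outputs n) = B W \<union> (if W = W0 then space (outputs n) - (\<Union>V\<in>?\<Omega>. B V) else {})"
    proof (intro equalityI subsetI)
      fix y assume y: "y \<in> D -` {W} \<inter> space (outputs n)"
      show "y \<in> B W \<union> (if W = W0 then space (outputs n) - (\<Union>V\<in>?\<Omega>. B V) else {})"
      proof (cases "\<exists>V\<in>?\<Omega>. y \<in> B V")
        case True
        then obtain V where V: "V \<in> ?\<Omega>" "y \<in> B V" by blast
        then have "V = W" using D1[OF V] y by simp
        then show ?thesis using V by simp
      next
        case False
        then have "D y = W0" by (intro D0) blast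
        then show ?thesis using False y by simp
      qed
    next
      fix y assume y: "y \<in> B W \<union> (if W = W0 then space (outputs n) - (\<Union>V\<in>?\<Omega>. B V) else {})"
      show "y \<in> D -` {W} \<inter> space (outputs n)"
      proof (cases "y \<in> B W")
        case True
        then show ?thesis using D1[OF W True] B[OF W] by blast
      next
        case False
        then have W: "W = W0" and y': "y \<in> space (outputs n)" "y \<notin> (\<Union>V\<in>?\<Omega>. B V)"
          using y by (simp_all split: if_splits)
        then have "D y = W0" by (intro D0) blast
        then show ?thesis using W y' by simp
      qed
    qed
    also have "\<dots> \<in> sets (outputs n)"
    proof -
      have "(\<Union>V\<in>?\<Omega>. B V) \<in> sets (outputs n)" using sets fin by (intro sets.finite_UN) auto
      then have "space (outputs n) - (\<Union>V\<in>?\<Omega>. B V) \<in> sets (outputs n)" by (rule sets.compl_sets)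
      then show ?thesis using sets[OF W] by (intro sets.Un) simp_all
    qed
    finally show "D -` {W} \<inter> space (outputs n) \<in> sets (outputs n)" .
  qed
  moreover have "B W \<subseteq> decision_region n D W" if "W \<in> ?\<Omega>" for W
    using D1[OF that] B[OF that] by (auto simp: decision_region_def)
  ultimately show ?thesis by blast
qed

text \<open>User \<open>i\<close> owns the channel uses \<open>(i - 1) * N + 1\<close> to
  \<open>i * N\<close> and is silent elsewhere and for message 0. For signs \<open>c\<close> the
  energy is \<open>g\<^sup>2 * N\<close>, hence \<open>E\<close> for
  \<open>g = sqrt (E / N)\<close>.\<close>

definition tdma_codebook :: "real \<Rightarrow> nat \<Rightarrow> nat \<Rightarrow> (nat \<Rightarrow> nat \<Rightarrow> real) \<Rightarrow> nat \<Rightarrow> nat \<Rightarrow> nat \<Rightarrow> real" where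
  "tdma_codebook g N M c i w j =
     (if w \<in> {1..M} \<and> (i - 1) * N < j \<and> j \<le> i * N then g * c w (j - (i - 1) * N) else 0)"

lemma ip_tdma_same:
  assumes "i \<in> {1..L}" "L * N \<le> n" "w \<in> {1..M}" "w' \<in> {1..M}"
  shows "ip n (tdma_codebook g N M c i w) (tdma_codebook g N M c i w') = g\<^sup>2 * (\<Sum>j=1..N. c w j * c w' j)"
proof -
  let ?s = "(i - 1) * N"
  have iN: "i * N = N + ?s" using assms(1) by (cases i) auto
  have "i * N \<le> L * N" using assms(1) by simp
  then have le: "N + ?s \<le> n" using assms(2) iN by linarith
  have "ip n (tdma_codebook g N M c i w) (tdma_codebook g N M c i w')
     = (\<Sum>j\<in>{1 + ?s..N + ?s}. g\<^sup>2 * (c w (j - ?s) * c w' (j - ?s)))"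
    unfolding ip_def using assms(3,4) le
    by (intro sum.mono_neutral_cong_right) (auto simp: tdma_codebook_def iN power2_eq_square)
  also have "\<dots> = (\<Sum>j=1..N. g\<^sup>2 * (c w j * c w' j))"
    by (subst sum.shift_bounds_cl_nat_ivl) simp
  finally show ?thesis by (simp add: sum_distrib_left)
qed

lemma ip_tdma_other:
  assumes "i \<noteq> i'" "i \<ge> 1" "i' \<ge> 1"
  shows "ip n (tdma_codebook g N M c i w) (tdma_codebook g N M c i' w') = 0"
proof -
  have "tdma_codebook g N M c i w j * tdma_codebook g N M c i' w' j = 0" for j
  proof (rule ccontr)
    assume "tdma_codebook g N M c i w j * tdma_codebook g N M c i' w' j \<noteq> 0"
    then have j: "(i - 1) * N < j" "j \<le> i * N" "(i' - 1) * N < j" "j \<le> i' * N"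
      by (auto simp: tdma_codebook_def split: if_splits)
    then have "(i - 1) * N < i' * N" "(i' - 1) * N < i * N" by linarith+
    then have "i - 1 < i'" "i' - 1 < i" by auto
    then show False using assms by linarith
  qed
  then show ?thesis unfolding ip_def by (intro sum.neutral ballI)
qed

section \<open>Correlation thresholds and the error of time-division codes\<close>

lemma tdma_codebook_0 [simp]: "tdma_codebook g N M c i 0 j = 0"
  by (simp add: tdma_codebook_def)

lemma ip_superposition:
  "ip n u (superposition L x W) = (\<Sum>i=1..L. ip n u (x i (W i)))"
proof -
  have "ip n (superposition L x W) u = (\<Sum>i=1..L. ip n (x i (W i)) u)"
    unfolding superposition_def[abs_def] by (rule ip_sum_left)
  then show ?thesis by (simp add: ip_commute)
qed

lemma ip_translate: "ip n u (translate n v z) = ip n u v + ip n u z"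
  by (simp add: ip_def translate_def sum.distrib[symmetric] algebra_simps)

lemma hit_prob_upper_tail:
  assumes N0: "N0 > 0" and u: "ip n u u \<le> E" "E > 0" and s: "0 \<le> s" "ip n u v + s \<le> t"
  shows "hit_prob N0 n v {y \<in> space (outputs n). t \<le> ip n u y} \<le> exp (- s\<^sup>2 / (N0 * E))"
proof -
  interpret prob_space "noise N0 n" by (rule prob_space_noise) fact
  have "hit_prob N0 n v {y \<in> space (outputs n). t \<le> ip n u y}
     \<le> measure (noise N0 n) {z \<in> space (noise N0 n). s \<le> ip n u z}"
    unfolding hit_prob_def using s by (intro finite_measure_mono) (auto simp: ip_translate)
  also have "\<dots> \<le> exp (- s\<^sup>2 / (N0 * E))" by (rule noise_chernoff[OF N0 s(1) u])
  finally show ?thesis .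
qed

lemma hit_prob_lower_tail:
  assumes N0: "N0 > 0" and u: "ip n u u \<le> E" "E > 0" and s: "0 \<le> s" "t + s \<le> ip n u v"
  shows "hit_prob N0 n v {y \<in> space (outputs n). ip n u y < t} \<le> exp (- s\<^sup>2 / (N0 * E))"
proof -
  let ?u = "\<lambda>j. - 1 * u j"
  have neg: "ip n ?u y = - ip n u y" for y
    unfolding ip_scale_left by simp
  have "hit_prob N0 n v {y \<in> space (outputs n). ip n u y < t}
      \<le> hit_prob N0 n v {y \<in> space (outputs n). - t \<le> ip n ?u y}"
  proof (rule hit_prob_mono[OF N0])
    show "{y \<in> space (outputs n). - t \<le> ip n ?u y} \<in> sets (outputs n)" by measurable
  qed (auto simp only: neg)
  also have "\<dots> \<le> exp (- s\<^sup>2 / (N0 * E))"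
    by (rule hit_prob_upper_tail[OF N0 _ u(2) s(1)])
       (use u s in \<open>simp_all only: neg ip_scale_right\<close>)
  finally show ?thesis .
qed

text \<open>The correlation of the output with a codeword is compared with
  \<open>(1 - \<zeta>) * E\<close>. It has mean \<open>E\<close> for the sent codeword and at most
  \<open>\<theta> * E\<close> for any other of the same user, so errors need noise of size
  \<open>\<zeta> * E\<close> or \<open>(1 - \<zeta> - \<theta>) * E\<close>. Orthogonality removes
  the other users, and a union bound covers all users and messages.\<close>

lemma tdma_code_exists:
  fixes \<theta> \<zeta> E :: real and L N M n :: nat
  assumes N0: "N0 > 0" and a: "0 < a" "a \<le> 1" and L: "L \<ge> 1" and N: "N \<ge> 1" "L * N \<le> n" and M: "M \<ge> 1"
    and \<theta>: "0 < \<theta>" "\<theta> \<le> 1" and \<zeta>: "0 \<le> \<zeta>" "\<zeta> + \<theta> \<le> 1" and E: "E > 0"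
    and MN: "real M \<le> exp (\<theta>\<^sup>2 * N / 4)"
  shows "\<exists>x D. orthogonal_access L n M x \<and>
    symmetric_code N0 a L n M E (L * (exp (- (\<zeta>\<^sup>2 * E / N0)) + M * exp (- ((1 - \<zeta> - \<theta>)\<^sup>2 * E / N0)))) x D"
proof -
  let ?\<Omega> = "message_vectors L M"
  obtain c :: "nat \<Rightarrow> nat \<Rightarrow> real" where c: "\<And>w j. c w j \<in> {1, -1}"
    and corr: "\<And>w w'. w \<in> {1..M} \<Longrightarrow> w' \<in> {1..M} \<Longrightarrow> w \<noteq> w' \<Longrightarrow> (\<Sum>j=1..N. c w j * c w' j) \<le> \<theta> * N"
    using sign_codebook_exists[OF \<theta> MN] by blast
  define x where "x = tdma_codebook (sqrt (E / N)) N M c"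
  have x0: "x i 0 j = 0" for i j by (simp add: x_def)
  have x0': "x i 0 = (\<lambda>_. 0)" for i by (rule ext) (rule x0)
  have xx: "ip n (x i w) (x i w') = E / N * (\<Sum>j=1..N. c w j * c w' j)"
    if "i \<in> {1..L}" "w \<in> {1..M}" "w' \<in> {1..M}" for i w w'
    using ip_tdma_same[OF that(1) N(2) that(2,3), of "sqrt (E / N)" c] E by (simp add: x_def)
  have energy: "ip n (x i w) (x i w) = E" if "i \<in> {1..L}" "w \<in> {1..M}" for i w
  proof -
    have cc: "c w j * c w j = 1" for j using c[of w j] by auto
    show ?thesis unfolding xx[OF that that(2)] cc using N by simp
  qed
  have cross: "ip n (x i w) (x i w') \<le> \<theta> * E" if "i \<in> {1..L}" "w \<in> {1..M}" "w' \<in> {0..M}" "w \<noteq> w'" for i w w'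
  proof (cases "w' = 0")
    case True
    then show ?thesis using \<theta> E by (simp add: x0' ip_def)
  next
    case False
    then have w': "w' \<in> {1..M}" using that by auto
    have "E / N * (\<Sum>j=1..N. c w j * c w' j) \<le> E / N * (\<theta> * N)"
      using corr[OF that(2) w' that(4)] E by (intro mult_left_mono) auto
    then show ?thesis unfolding xx[OF that(1,2) w'] using N by (simp add: mult.commute)
  qed
  have orth: "ip n (x i w) (x i' w') = 0" if "i \<in> {1..L}" "i' \<in> {1..L}" "i \<noteq> i'" for i i' w w'
    unfolding x_def using that by (intro ip_tdma_other) auto
  have sup: "ip n (x i w) (superposition L x W) = ip n (x i w) (x i (W i))" if i: "i \<in> {1..L}" for i w W
  proof -
    have "(\<Sum>k=1..L. ip n (x i w) (x k (W k))) = (\<Sum>k\<in>{i}. ip n (x i w) (x k (W k)))"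
      using i orth by (intro sum.mono_neutral_right) auto
    then show ?thesis by (simp add: ip_superposition)
  qed
  define t where "t = (1 - \<zeta>) * E"
  \<comment> \<open>The correlation with codeword \<open>w\<close> of user \<open>i\<close> lies on
    the wrong side of the threshold. Outside all bad events the passed thresholds determine
    \<open>W\<close>, where inactivity means that none is passed.\<close>
  define bad where "bad W = (\<lambda>(i, w). if w = W i then {y \<in> space (outputs n). ip n (x i w) y < t}
      else {y \<in> space (outputs n). t \<le> ip n (x i w) y})" for W :: "nat \<Rightarrow> nat"
  define B where "B W = space (outputs n) - (\<Union>k\<in>{1..L} \<times> {1..M}. bad W k)" for W
  have bad_sets: "bad W k \<in> sets (outputs n)" for W k
    by (cases k) (auto simp: bad_def)
  have UN_sets: "(\<Union>k\<in>{1..L} \<times> {1..M}. bad W k) \<in> sets (outputs n)" for W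
    by (intro sets.finite_UN bad_sets) auto
  have B_sets: "B W \<in> sets (outputs n)" for W
    unfolding B_def by (rule sets.compl_sets[OF UN_sets])
  have inB: "t \<le> ip n (x i w) y \<longleftrightarrow> w = W i" if "y \<in> B W" "i \<in> {1..L}" "w \<in> {1..M}" for y W i w
  proof -
    have "y \<notin> bad W (i, w)" "y \<in> space (outputs n)" using that by (auto simp: B_def)
    then show ?thesis by (auto simp: bad_def split: if_splits)
  qed
  have dis: "disjoint_family_on B ?\<Omega>"
    unfolding disjoint_family_on_def
  proof (intro ballI impI)
    fix V W assume V: "V \<in> ?\<Omega>" and W: "W \<in> ?\<Omega>" and ne: "V \<noteq> W"
    obtain i where i: "i \<in> {1..L}" "V i \<noteq> W i" using PiE_ext[OF V W] ne by blast
    have r: "V i \<in> {0..M}" "W i \<in> {0..M}" using PiE_mem[OF V i(1)] PiE_mem[OF W i(1)] by auto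
    show "B V \<inter> B W = {}"
    proof (rule ccontr)
      assume "B V \<inter> B W \<noteq> {}"
      then obtain y where y: "y \<in> B V" "y \<in> B W" by blast
      have eq: "w = V i \<longleftrightarrow> w = W i" if "w \<in> {1..M}" for w
        using inB[OF y(1) i(1) that] inB[OF y(2) i(1) that] by simp
      have "V i \<in> {1..M} \<or> W i \<in> {1..M}" using r i(2) by auto
      then show False using eq[of "V i"] eq[of "W i"] i(2) by auto
    qed
  qed
  obtain D where D: "D \<in> decoders L n M" and BD: "\<And>W. W \<in> ?\<Omega> \<Longrightarrow> B W \<subseteq> decision_region n D W"
    using decoder_exists[of L M B n, OF B_sets dis] by blast
  define A1 where "A1 = exp (- (\<zeta>\<^sup>2 * E / N0))"
  define A2 where "A2 = exp (- ((1 - \<zeta> - \<theta>)\<^sup>2 * E / N0))"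
  \<comment> \<open>Keeping \<open>A2\<close> also in the case \<open>w = W i\<close> makes one
    bound serve both cases.\<close>
  have bad_prob: "hit_prob N0 n (superposition L x W) (bad W (i, w)) \<le> of_bool (w = W i) * A1 + A2"
    if W: "W \<in> ?\<Omega>" and i: "i \<in> {1..L}" and w: "w \<in> {1..M}" for W i w
  proof (cases "w = W i")
    case True
    have "hit_prob N0 n (superposition L x W) {y \<in> space (outputs n). ip n (x i w) y < t} \<le> exp (- (\<zeta> * E)\<^sup>2 / (N0 * E))"
      using energy[OF i w] E \<zeta> by (intro hit_prob_lower_tail N0) (auto simp: sup[OF i] True[symmetric] t_def algebra_simps)
    also have "- (\<zeta> * E)\<^sup>2 / (N0 * E) = - (\<zeta>\<^sup>2 * E / N0)" using E by (simp add: power2_eq_square)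
    finally show ?thesis using True by (simp add: bad_def A1_def A2_def add_increasing2)
  next
    case False
    have Wi: "W i \<in> {0..M}" using PiE_mem[OF W i] .
    have le: "\<zeta> * E + \<theta> * E \<le> E" using mult_right_mono[OF \<zeta>(2), of E] E by (simp add: distrib_right)
    have "hit_prob N0 n (superposition L x W) {y \<in> space (outputs n). t \<le> ip n (x i w) y} \<le> exp (- ((1 - \<zeta> - \<theta>) * E)\<^sup>2 / (N0 * E))"
      using energy[OF i w] E \<zeta> le cross[OF i w Wi False]
      by (intro hit_prob_upper_tail N0) (simp_all add: sup[OF i] t_def left_diff_distrib)
    also have "- ((1 - \<zeta> - \<theta>) * E)\<^sup>2 / (N0 * E) = - ((1 - \<zeta> - \<theta>)\<^sup>2 * E / N0)" using E by (simp add: power2_eq_square)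
    finally show ?thesis using False by (simp add: bad_def A2_def)
  qed
  have succ: "1 - L * (A1 + M * A2) \<le> hit_prob N0 n (superposition L x W) (decision_region n D W)" if W: "W \<in> ?\<Omega>" for W
  proof -
    have "hit_prob N0 n (superposition L x W) (\<Union>k\<in>{1..L} \<times> {1..M}. bad W k)
       \<le> (\<Sum>k\<in>{1..L} \<times> {1..M}. hit_prob N0 n (superposition L x W) (bad W k))"
      by (intro hit_prob_UN_le N0 bad_sets) auto
    also have "\<dots> = (\<Sum>i=1..L. \<Sum>w=1..M. hit_prob N0 n (superposition L x W) (bad W (i, w)))"
      by (simp add: sum.cartesian_product case_prod_beta)
    also have "\<dots> \<le> (\<Sum>i=1..L. \<Sum>w=1..M. of_bool (w = W i) * A1 + A2)"
      by (intro sum_mono bad_prob W)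
    also have "\<dots> \<le> (\<Sum>i=1..L. A1 + M * A2)"
    proof (rule sum_mono)
      fix i
      have "(\<Sum>w=1..M. of_bool (w = W i)) \<le> (1::real)"
        by (cases "W i \<in> {1..M}") (auto simp: of_bool_def)
      then have "(\<Sum>w=1..M. of_bool (w = W i)) * A1 \<le> 1 * A1"
        by (rule mult_right_mono) (simp add: A1_def)
      then show "(\<Sum>w=1..M. of_bool (w = W i) * A1 + A2) \<le> A1 + M * A2"
        by (simp add: sum.distrib sum_distrib_right[symmetric])
    qed
    finally have "1 - L * (A1 + M * A2) \<le> 1 - hit_prob N0 n (superposition L x W) (\<Union>k\<in>{1..L} \<times> {1..M}. bad W k)" by simp
    also have "\<dots> = hit_prob N0 n (superposition L x W) (B W)"
      unfolding B_def by (rule hit_prob_compl[OF N0 UN_sets, symmetric])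
    also have "\<dots> \<le> hit_prob N0 n (superposition L x W) (decision_region n D W)"
      by (intro hit_prob_mono N0 BD W decision_region_sets[OF D])
    finally show ?thesis .
  qed
  have "(\<Sum>W\<in>?\<Omega>. message_prob a L M W * (1 - L * (A1 + M * A2)))
    \<le> (\<Sum>W\<in>?\<Omega>. message_prob a L M W * hit_prob N0 n (superposition L x W) (decision_region n D W))"
    by (intro sum_mono mult_left_mono succ message_prob_nonneg)
  then have "error_prob N0 a L n M x D \<le> L * (A1 + M * A2)"
    unfolding error_prob_eq[OF N0 a M D] sum_distrib_right[symmetric] sum_message_prob[OF a M] mult_1
    by (subst diff_le_eq, subst add.commute, subst diff_le_eq[symmetric])
  moreover have "(\<Sum>j=1..n. (x i w j)\<^sup>2) \<le> E" if "i \<in> {1..L}" "w \<in> {0..M}" for i w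
  proof (cases "w = 0")
    case True
    then show ?thesis using E by (simp add: x0)
  next
    case False
    then show ?thesis using energy[of i w] that by (simp add: ip_def power2_eq_square)
  qed
  ultimately have "symmetric_code N0 a L n M E (L * (A1 + M * A2)) x D"
    using M E D by (simp add: symmetric_code_def x0)
  moreover have "orthogonal_access L n M x"
    using orth by (auto simp: orthogonal_access_def ip_def)
  ultimately show ?thesis unfolding A1_def A2_def by blast
qed

section \<open>Error floors\<close>

text \<open>Serves complete attenuation, which turns all codewords of a user into zero and leaves
  pure guessing.\<close>

lemma user_bound_const:
  assumes N0: "N0 > 0" and M: "1 \<le> M"
  shows "user_bound N0 n M (\<lambda>w. c) (1 / M)"
  unfolding user_bound_def
proof (intro allI impI)
  fix v B assume "\<forall>w. B w \<in> sets (outputs n)" "disjoint_family_on B {1..M}"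
  then have "(\<Sum>w=1..M. hit_prob N0 n (\<lambda>j. v j + c j) (B w)) \<le> 1"
    by (intro sum_hit_prob_le_1 N0) auto
  then show "(\<Sum>w=1..M. hit_prob N0 n (\<lambda>j. v j + c j) (B w)) \<le> real M * (1 / M)"
    using M by simp
qed

lemma symmetric_codeD:
  assumes "symmetric_code N0 a L n M E \<epsilon> x D"
  shows "1 \<le> M" "0 < E" "\<And>i j. i \<in> {1..L} \<Longrightarrow> j \<in> {1..n} \<Longrightarrow> x i 0 j = 0"
    "\<And>i w. i \<in> {1..L} \<Longrightarrow> w \<in> {1..M} \<Longrightarrow> ip n (x i w) (x i w) \<le> E"
    "D \<in> decoders L n M" "error_prob N0 a L n M x D \<le> \<epsilon>"
  using assms by (auto simp: symmetric_code_def ip_def power2_eq_square)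

lemma exp_neg_le_quarter:
  assumes "ln 4 \<le> y"
  shows "exp (- y) \<le> 1 / (4 :: real)"
proof -
  have "exp (- y) \<le> exp (- ln 4)" using assms by simp
  then show ?thesis by (simp add: exp_minus)
qed

text \<open>Bounded energy is handled by \<open>user_bound_small_energy\<close>, large energy by
  \<open>user_bound_ball\<close>; \<open>\<beta>\<close> is the weaker of the two resulting gaps and
  depends only on \<open>N0\<close> and \<open>\<delta>\<close>.\<close>

lemma converse_rate:
  assumes N0: "N0 > 0" and \<delta>: "\<delta> > 0"
  shows "\<exists>\<beta>>0. \<beta> \<le> 1 \<and> (\<forall>(a :: real) L n M (E :: real) (\<epsilon> :: real) x D. 0 < a \<longrightarrow> a \<le> 1 \<longrightarrow> 1 \<le> L \<longrightarrow>
    symmetric_code N0 a L n M E \<epsilon> x D \<longrightarrow> (1 + \<delta>) * E / N0 \<le> ln M \<longrightarrow>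
    \<beta>\<^sup>2 * (a * L) / (1 + a * L) \<le> \<epsilon>)"
proof -
  define s where "s = \<delta> / 4"
  have s: "s > 0" using \<delta> by (simp add: s_def)
  \<comment> \<open>The two summands are the energies from which
    \<open>exp (- s\<^sup>2 * E / N0)\<close> and \<open>exp (- 2 * s * E / N0)\<close> are at most
    1/4.\<close>
  define E0 where "E0 = N0 * ln 4 / s\<^sup>2 + N0 * ln 4 / (2 * s)"
  define \<beta> where "\<beta> = min (1/2) (exp (- 2 * E0 / N0) / 16)"
  have \<beta>_le: "\<beta> \<le> 1/2" "\<beta> \<le> exp (- 2 * E0 / N0) / 16"
    unfolding \<beta>_def by (rule min.cobounded1, rule min.cobounded2)
  have \<beta>: "0 < \<beta>" "\<beta> \<le> 1" using \<beta>_le(1) by (auto simp: \<beta>_def)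
  have "\<beta>\<^sup>2 * (a * L) / (1 + a * L) \<le> \<epsilon>"
    if a: "0 < a" "a \<le> 1" and L: "1 \<le> L" and code: "symmetric_code N0 a L n M E \<epsilon> x D"
      and rate: "(1 + \<delta>) * E / N0 \<le> ln M" for a E \<epsilon> :: real and L n M x D
  proof -
    note c = symmetric_codeD[OF code]
    have "0 < (1 + \<delta>) * E / N0" using \<delta> c(2) N0 by simp
    then have "ln (real M) > 0" using rate by linarith
    then have M2: "2 \<le> M" using c(1) by (cases "M = 1") auto
    have ub: "user_bound N0 n M (x i) (1 - \<beta>)" if i: "i \<in> {1..L}" for i
    proof (cases "E \<le> E0")
      case True
      have "user_bound N0 n M (x i) (1 - exp (- 2 * E / N0) / 16)"
        by (rule user_bound_small_energy[OF N0 M2 c(4)[OF i]])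
      moreover have "exp (- 2 * E0 / N0) \<le> exp (- 2 * E / N0)"
        using True N0 by (simp add: divide_right_mono)
      then have "1 - exp (- 2 * E / N0) / 16 \<le> 1 - \<beta>" using \<beta>_le(2) by linarith
      ultimately show ?thesis by (rule user_bound_mono)
    next
      case False
      \<comment> \<open>Halfway between the energy exponent 1 and the rate exponent
        \<open>1 + 4 * s\<close>, so that both terms of the ball bound decay.\<close>
      define \<gamma> where "\<gamma> = exp ((1 + 2 * s) * E / N0)"
      have "user_bound N0 n M (x i) (\<gamma> / M + \<gamma> powr (-s) * exp (s * (1 + s) * E / N0))"
        using s by (intro user_bound_ball N0 c(1) c(4)[OF i]) (auto simp: \<gamma>_def)
      moreover have "\<gamma> / M + \<gamma> powr (-s) * exp (s * (1 + s) * E / N0) \<le> 1 - \<beta>"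
      proof -
        have nonneg: "0 \<le> N0 * ln 4 / s\<^sup>2" "0 \<le> N0 * ln 4 / (2 * s)" using N0 s by auto
        have E1: "N0 * ln 4 / s\<^sup>2 \<le> E" "N0 * ln 4 / (2 * s) \<le> E"
          using False nonneg unfolding E0_def by linarith+
        have "\<gamma> / M = exp ((1 + 2 * s) * E / N0 - ln M)"
          using c(1) by (simp add: \<gamma>_def exp_diff)
        also have "\<dots> \<le> exp (- (2 * s * E / N0))"
          using rate by (simp add: s_def algebra_simps add_divide_distrib)
        also have "\<dots> \<le> 1/4"
          using E1 s N0 by (intro exp_neg_le_quarter) (simp add: field_simps)
        finally have "\<gamma> / M \<le> 1/4" .
        moreover have "\<gamma> powr (-s) * exp (s * (1 + s) * E / N0) = exp (- (s\<^sup>2 * E / N0))"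
          by (simp add: \<gamma>_def powr_def exp_add[symmetric] power2_eq_square algebra_simps add_divide_distrib)
        moreover have "\<dots> \<le> 1/4"
          using E1 s N0 by (intro exp_neg_le_quarter) (simp add: field_simps)
        ultimately show ?thesis using \<beta>_le(1) by linarith
      qed
      ultimately show ?thesis by (rule user_bound_mono)
    qed
    have "(\<Sum>W\<in>message_vectors L M. message_prob a L M W * num_active L W *
      hit_prob N0 n (superposition L x W) (decision_region n D W)) \<le> a * (\<Sum>i=1..L. 1 - \<beta>)"
      by (rule weighted_success_users[OF N0 a c(1,5) ub])
    then have "\<beta>\<^sup>2 * (a * L) / (1 + a * L) \<le> error_prob N0 a L n M x D"
      by (intro error_prob_lower_bound[OF N0 a L c(1,5) \<beta>]) (simp add: algebra_simps)
    then show ?thesis using c(6) by linarith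
  qed
  then show ?thesis using \<beta> by blast
qed

text \<open>Here \<open>r\<close> may be arbitrarily small: \<open>exp (r * E)\<close> messages lie
  in \<open>exp (r * E / 4)\<close> balls whose energy is a small multiple of \<open>E\<close>, so
  most messages share a ball with too many others.\<close>

lemma converse_dimension:
  assumes N0: "N0 > 0" and r: "r > 0"
  shows "\<exists>\<kappa>>0. \<exists>E0. \<forall>(a :: real) L n M (E :: real) (\<epsilon> :: real) x D. 0 < a \<longrightarrow> a \<le> 1 \<longrightarrow> 1 \<le> L \<longrightarrow> 1 \<le> n \<longrightarrow>
    symmetric_code N0 a L n M E \<epsilon> x D \<longrightarrow> orthogonal_access L n M x \<longrightarrow>
    E0 \<le> E \<longrightarrow> r * E \<le> ln M \<longrightarrow> 2 * real n \<le> \<kappa> * E * L \<longrightarrow>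
    (1/4)\<^sup>2 * (a * L) / (1 + a * L) \<le> \<epsilon>"
proof -
  \<comment> \<open>Balls of energy \<open>\<rho>\<^sup>2 * E\<close> cost only
    \<open>exp (r * E / 8)\<close>. With \<open>\<gamma> = exp (r * E / 4)\<close> and exponent 1/2
    the remainder is \<open>exp (- r * E / 32)\<close>, whence \<open>E0\<close>.\<close>
  define \<rho> where "\<rho> = sqrt (r * N0 / 8)"
  have \<rho>: "\<rho> > 0" "\<rho>\<^sup>2 = r * N0 / 8" using N0 r by (auto simp: \<rho>_def)
  define \<kappa>1 where "\<kappa>1 = (2 / \<rho>\<^sup>2 + 2) * ln 2 + ln 3"
  have \<kappa>1: "\<kappa>1 > 0" unfolding \<kappa>1_def using \<rho>(1) by (intro add_pos_pos mult_pos_pos) auto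
  \<comment> \<open>Makes the size of the cover at most \<open>exp (r * E / 4)\<close> for users of
    dimension at most \<open>\<kappa> * E\<close>.\<close>
  define \<kappa> where "\<kappa> = r / (4 * \<kappa>1)"
  have \<kappa>: "\<kappa> > 0" using r \<kappa>1 by (simp add: \<kappa>_def)
  define E0 where "E0 = 32 * ln 4 / r"
  have "(1/4)\<^sup>2 * (a * L) / (1 + a * L) \<le> \<epsilon>"
    if a: "0 < a" "a \<le> 1" and L: "1 \<le> L" and n: "1 \<le> n" and code: "symmetric_code N0 a L n M E \<epsilon> x D"
      and orth: "orthogonal_access L n M x" and E0: "E0 \<le> E" and rate: "r * E \<le> ln M"
      and dim: "2 * real n \<le> \<kappa> * E * L" for a E \<epsilon> :: real and L n M x D
  proof -
    note c = symmetric_codeD[OF code]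
    obtain d b where d: "(\<Sum>i=1..L. d i) \<le> n" and b: "\<And>i. i \<in> {1..L} \<Longrightarrow> orthonormal n {..<d i} (b i)"
      and rep: "\<And>i w j. i \<in> {1..L} \<Longrightarrow> w \<in> {1..M} \<Longrightarrow> j \<in> {1..n} \<Longrightarrow> x i w j = (\<Sum>k<d i. ip n (x i w) (b i k) * b i k j)"
      using orthogonal_dimensions[OF orth] by blast
    let ?s = "\<lambda>i. if d i * L \<le> 2 * n then 1/2 else (1::real)"
    have ub: "user_bound N0 n M (x i) (?s i)" if i: "i \<in> {1..L}" for i
    proof (cases "d i * L \<le> 2 * n")
      case True
      have "\<exists>(C :: (nat \<Rightarrow> int) set) z u. finite C \<and> card C \<le> exp (\<kappa>1 * d i)
        \<and> (\<forall>w\<in>{1..M}. z w \<in> C \<and> ip n (\<lambda>j. x i w j - u (z w) j) (\<lambda>j. x i w j - u (z w) j) \<le> \<rho>\<^sup>2 * E)"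
        unfolding \<kappa>1_def by (rule codebook_cover[OF b[OF i] rep[OF i] c(4)[OF i] c(2) \<rho>(1)])
      then obtain C :: "(nat \<Rightarrow> int) set" and z u where "finite C \<and> card C \<le> exp (\<kappa>1 * d i)
        \<and> (\<forall>w\<in>{1..M}. z w \<in> C \<and> ip n (\<lambda>j. x i w j - u (z w) j) (\<lambda>j. x i w j - u (z w) j) \<le> \<rho>\<^sup>2 * E)"
        by (elim exE)
      then have C: "finite C" "card C \<le> exp (\<kappa>1 * d i)"
        and zu: "\<And>w. w \<in> {1..M} \<Longrightarrow> z w \<in> C"
          "\<And>w. w \<in> {1..M} \<Longrightarrow> ip n (\<lambda>j. x i w j - u (z w) j) (\<lambda>j. x i w j - u (z w) j) \<le> \<rho>\<^sup>2 * E"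
        by simp_all
      define \<gamma> where "\<gamma> = exp (r * E / 4)"
      have ubc: "user_bound N0 n M (x i) (\<gamma> * card C / M + \<gamma> powr (-(1/2)) * exp (1/2 * (1 + 1/2) * (\<rho>\<^sup>2 * E) / N0))"
        by (rule user_bound_cover[OF N0 c(1) _ _ C(1), where c = "x i" and z = z and u = u]) (auto simp: \<gamma>_def zu)
      have "real (d i) * L \<le> \<kappa> * E * L"
      proof -
        have "real (d i) * real L \<le> 2 * real n" using True by (metis of_nat_le_iff of_nat_mult of_nat_numeral)
        then show ?thesis using dim by linarith
      qed
      then have "real (d i) \<le> \<kappa> * E" using L by simp
      then have "\<kappa>1 * d i \<le> \<kappa>1 * (\<kappa> * E)" using \<kappa>1 by (intro mult_left_mono) auto
      also have "\<dots> = r * E / 4" using \<kappa>1 by (simp add: \<kappa>_def)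
      finally have kd: "\<kappa>1 * d i \<le> r * E / 4" .
      have big: "ln 4 \<le> r * E / 32" using E0 r by (simp add: E0_def field_simps)
      have rE: "0 < r * E" using r c(2) by simp
      have "\<gamma> * card C / M \<le> \<gamma> * exp (\<kappa>1 * d i) / M"
        using C(2) by (intro divide_right_mono mult_left_mono) (auto simp: \<gamma>_def)
      also have "\<dots> = exp (r * E / 4 + \<kappa>1 * d i - ln M)"
        using c(1) by (simp add: \<gamma>_def exp_diff exp_add)
      also have "\<dots> \<le> exp (- (r * E / 32))" using kd rate rE by simp
      also have "\<dots> \<le> 1/4" by (rule exp_neg_le_quarter[OF big])
      finally have t1: "\<gamma> * card C / M \<le> 1/4" .
      have "\<gamma> powr (-(1/2)) * exp (1/2 * (1 + 1/2) * (\<rho>\<^sup>2 * E) / N0) = exp (- (r * E / 32))"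
        using N0 by (simp add: \<gamma>_def powr_def \<rho>(2) exp_add[symmetric] field_simps)
      also have "\<dots> \<le> 1/4" by (rule exp_neg_le_quarter[OF big])
      finally have "\<gamma> * card C / M + \<gamma> powr (-(1/2)) * exp (1/2 * (1 + 1/2) * (\<rho>\<^sup>2 * E) / N0) \<le> 1/2"
        using t1 by linarith
      then show ?thesis using True by (simp only: if_True) (rule user_bound_mono[OF ubc])
    qed (use user_bound_1[OF N0] in simp)
    \<comment> \<open>Users of dimension above \<open>2 * n / L\<close> get the trivial bound 1.
      They are at most half of all, so the average is at most 3/4.\<close>
    have sum_s: "(\<Sum>i=1..L. ?s i) \<le> 3/4 * L"
    proof -
      let ?B = "{i\<in>{1..L}. \<not> d i * L \<le> 2 * n}"
      have "card ?B * (2 * n) = (\<Sum>i\<in>?B. 2 * n)" by simp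
      also have "\<dots> \<le> (\<Sum>i\<in>?B. d i * L)" by (intro sum_mono) auto
      also have "\<dots> \<le> (\<Sum>i=1..L. d i * L)" by (intro sum_mono2) auto
      also have "\<dots> \<le> n * L" using d by (simp add: sum_distrib_right[symmetric])
      finally have "2 * card ?B \<le> L" using n by (simp add: mult.commute mult.left_commute)
      moreover have "(\<Sum>i=1..L. ?s i) = (\<Sum>i=1..L. 1/2 + 1/2 * of_bool (\<not> d i * L \<le> 2 * n))"
        by (intro sum.cong) auto
      moreover have "\<dots> = L / 2 + 1/2 * card ?B"
      proof -
        have "(\<Sum>i=1..L. of_bool (\<not> d i * L \<le> 2 * n)) = real (card ?B)" by (simp add: Int_def)
        then show ?thesis unfolding sum.distrib sum_distrib_left[symmetric] by simp
      qed
      ultimately show ?thesis by simp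
    qed
    have "(\<Sum>W\<in>message_vectors L M. message_prob a L M W * num_active L W *
      hit_prob N0 n (superposition L x W) (decision_region n D W)) \<le> a * (\<Sum>i=1..L. ?s i)"
      by (rule weighted_success_users[OF N0 a c(1,5) ub])
    also have "\<dots> \<le> a * (3/4 * L)" using sum_s a by (intro mult_left_mono) auto
    finally have "(1/4)\<^sup>2 * (a * L) / (1 + a * L) \<le> error_prob N0 a L n M x D"
      by (intro error_prob_lower_bound[OF N0 a L c(1,5)]) simp_all
    then show ?thesis using c(6) by linarith
  qed
  then show ?thesis using \<kappa> by blast
qed

text \<open>The competition among \<open>L * M\<close> hypotheses gains \<open>ln L\<close>. Half of
  it enlarges \<open>\<gamma>\<close>; a quarter pays for the rate defect
  \<open>\<eta> * E / N0\<close>, and the last quarter is the remaining decay.\<close>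

lemma converse_activity:
  fixes a E \<epsilon> :: real and L n M :: nat
  assumes N0: "N0 > 0" and A: "A > 0" and \<eta>: "0 \<le> \<eta>" "\<eta> * A / N0 \<le> 1/4"
    and a: "0 < a" "a \<le> 1/2" and L: "1 \<le> L" and code: "symmetric_code N0 a L n M E \<epsilon> x D"
    and E: "E \<le> A * ln L" and rate: "(1 - \<eta>) * E / N0 \<le> ln M"
    and large: "ln 16 \<le> ln L / 4" "ln 16 \<le> N0 / (16 * A) * ln L"
  shows "(1/4)\<^sup>2 * (a * L) / (1 + a * L) \<le> \<epsilon>"
proof -
  note c = symmetric_codeD[OF code]
  \<comment> \<open>Ensures \<open>s\<^sup>2 * E / N0 \<le> s * ln L / 4\<close>, half of the gain
    \<open>s * ln L / 2\<close> that \<open>\<gamma>\<close> provides.\<close>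
  define s where "s = N0 / (4 * A)"
  have s: "s > 0" using N0 A by (simp add: s_def)
  define \<gamma> where "\<gamma> = exp (E / N0 + ln L / 2)"
  let ?\<tau> = "\<gamma> powr (-s) * exp (s * (1 + s) * E / N0)"
  have sixteen: "exp (- y) \<le> 1/16" if "ln 16 \<le> y" for y :: real
  proof -
    have "exp (- y) \<le> exp (- ln 16)" using that by simp
    then show ?thesis by (simp add: exp_minus)
  qed
  have a1: "a < 1" using a by simp
  have al: "a \<le> 1" using a by simp
  have "real L * real M = exp (ln L + ln M)" using L c(1) by (simp add: exp_add)
  then have "\<gamma> / (L * M) = exp (E / N0 + ln L / 2 - (ln L + ln M))"
    by (simp only: \<gamma>_def exp_diff of_nat_mult)
  also have "\<dots> = exp (E / N0 - ln L / 2 - ln M)" by simp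
  also have "\<dots> \<le> exp (- (ln L / 4))"
  proof -
    have "\<eta> * E / N0 \<le> \<eta> * (A * ln L) / N0" using E \<eta>(1) N0 by (intro divide_right_mono mult_left_mono) auto
    also have "\<dots> = (\<eta> * A / N0) * ln L" by simp
    also have "\<dots> \<le> 1/4 * ln L" using \<eta>(2) L by (intro mult_right_mono) auto
    finally show ?thesis using rate by (simp add: left_diff_distrib diff_divide_distrib)
  qed
  also have "\<dots> \<le> 1/16" by (rule sixteen) (use large in simp)
  finally have t1: "\<gamma> / (L * M) \<le> 1/16" .
  have "?\<tau> = exp (s\<^sup>2 * E / N0 - s * ln L / 2)"
    by (simp add: \<gamma>_def powr_def exp_add[symmetric] power2_eq_square algebra_simps add_divide_distrib)
  also have "\<dots> \<le> exp (- (s / 4 * ln L))"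
  proof -
    have "s\<^sup>2 * E / N0 \<le> s\<^sup>2 * (A * ln L) / N0" using E N0 by (intro divide_right_mono mult_left_mono) auto
    also have "\<dots> = s * (s * A / N0) * ln L" by (simp add: power2_eq_square)
    also have "s * A / N0 = 1/4" using N0 A by (simp add: s_def)
    finally show ?thesis unfolding exp_le_cancel_iff by linarith
  qed
  also have "\<dots> \<le> 1/16" by (rule sixteen) (use large in \<open>simp add: s_def\<close>)
  finally have t2: "?\<tau> \<le> 1/16" .
  have "(\<Sum>W\<in>message_vectors L M. message_prob a L M W * num_active L W *
      hit_prob N0 n (superposition L x W) (decision_region n D W))
    \<le> a / (1 - a) * (\<gamma> / M + L * ?\<tau>)"
    using s by (intro weighted_success_activity N0 a a1 c(1,3,4,5)) (auto simp: \<gamma>_def)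
  also have "\<dots> = a * L / (1 - a) * (\<gamma> / (L * M) + ?\<tau>)"
    using L by (simp add: field_simps)
  also have "\<dots> \<le> a * L * 2 * (1/16 + 1/16)"
  proof (intro mult_mono add_mono t1 t2)
    have "1 / (1 - a) \<le> 2" using a by (simp add: field_simps)
    then show "a * L / (1 - a) \<le> a * L * 2" using a mult_left_mono[of "1 / (1 - a)" 2 "a * L"] by simp
  qed (use a in \<open>auto simp: \<gamma>_def\<close>)
  also have "\<dots> \<le> (1 - 1/4) * (a * L)" using a by simp
  finally have "(1/4)\<^sup>2 * (a * L) / (1 + a * L) \<le> error_prob N0 a L n M x D"
    by (intro error_prob_lower_bound[OF N0 a(1) al L c(1,5)]) simp_all
  then show ?thesis using c(6) by linarith
qed

text \<open>The bound on \<open>E\<close> limits the chi-square term to \<open>sqrt L\<close>,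
  negligible against about \<open>L / 2\<close> active users. What remains is the success of the
  attenuated codebook, at most 1/2 by assumption.\<close>

lemma converse_attenuation:
  fixes a E \<epsilon> :: real and L n M :: nat
  assumes N0: "N0 > 0" and a: "1/2 < a" "a \<le> 1" and L: "1024 \<le> L"
    and code: "symmetric_code N0 a L n M E \<epsilon> x D" and orth: "orthogonal_access L n M x"
    and \<theta>: "0 \<le> \<theta>" and E: "2 * \<theta>\<^sup>2 * E / N0 \<le> ln L / 2"
    and ub: "\<And>i. i \<in> {1..L} \<Longrightarrow> user_bound N0 n M (\<lambda>w j. (1 - \<theta>) * x i w j) (1/2)"
  shows "(1/4)\<^sup>2 * (a * L) / (1 + a * L) \<le> \<epsilon>"
proof -
  note c = symmetric_codeD[OF code]
  have a0: "0 < a" using a by simp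
  have L1: "1 \<le> L" using L by simp
  have "exp (2 * (\<theta>\<^sup>2 * E) / N0) \<le> exp (ln L / 2)" using E by simp
  also have "\<dots> = sqrt L" using L by (simp add: ln_sqrt[symmetric])
  finally have chi: "exp (2 * (\<theta>\<^sup>2 * E) / N0) \<le> sqrt L" .
  have "sqrt 1024 \<le> sqrt (real L)" by (rule real_sqrt_le_mono) (use L in simp)
  moreover have "sqrt 1024 = (32::real)" by (rule real_sqrt_unique) auto
  ultimately have "32 * sqrt L \<le> sqrt L * sqrt L" by (intro mult_right_mono) auto
  then have sq: "32 * sqrt L \<le> L" by simp
  have "(\<Sum>W\<in>message_vectors L M. message_prob a L M W * num_active L W *
      hit_prob N0 n (superposition L x W) (decision_region n D W))
    \<le> a * L * (1/2 + 1/8) + exp (2 * (\<theta>\<^sup>2 * E) / N0) / (4 * (1/8))"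
    by (rule weighted_success_attenuation[OF N0 a0 a(2) c(1,5) _ \<theta> c(4) orth ub]) auto
  also have "\<dots> \<le> a * L * (5/8) + 2 * sqrt L" using chi by simp
  \<comment> \<open>\<open>L \<ge> 1024\<close> makes \<open>2 * sqrt L\<close> at most
    \<open>L / 16\<close>, hence at most \<open>a * L / 8\<close>, and 5/8 + 1/8 = 3/4.\<close>
  also have "\<dots> \<le> (1 - 1/4) * (a * L)"
  proof -
    have "1/2 * real L \<le> a * L" using a by (intro mult_right_mono) auto
    then show ?thesis using sq by simp
  qed
  finally have "(1/4)\<^sup>2 * (a * L) / (1 + a * L) \<le> error_prob N0 a L n M x D"
    by (intro error_prob_lower_bound[OF N0 a0 a(2) L1 c(1,5)]) simp_all
  then show ?thesis using c(6) by linarith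
qed

section \<open>Asymptotic rates\<close>

lemma eventually_ln_ge: "eventually (\<lambda>n::nat. K \<le> ln (real n)) at_top"
  using filterlim_compose[OF ln_at_top filterlim_real_sequentially] by (simp add: filterlim_at_top)

text \<open>For \<open>a > 1/2\<close> two attenuations are available. Very low energy allows
  erasing a codeword altogether, whatever the rate. Up to \<open>A * ln L\<close> only a factor
  \<open>1 - \<theta>\<close> stays hidden, which suffices if the rate is so close to the maximum
  that the attenuated energy cannot support it.\<close>

lemma converse_low_energy:
  assumes N0: "N0 > 0" and A: "A > 0" and \<eta>: "0 \<le> \<eta>" "\<eta> * A / N0 \<le> 1/4"
    and \<theta>: "0 < \<theta>" "\<theta> < 1" "2 * \<theta>\<^sup>2 * A / N0 \<le> 1/2"
  shows "eventually (\<lambda>L. \<forall>(a :: real) n M (E :: real) (\<epsilon> :: real) x D. 0 < a \<longrightarrow> a \<le> 1 \<longrightarrow>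
    symmetric_code N0 a L n M E \<epsilon> x D \<longrightarrow> orthogonal_access L n M x \<longrightarrow> 2 \<le> M \<longrightarrow>
    E \<le> A * ln L \<longrightarrow> (1 - \<eta>) * E / N0 \<le> ln M \<longrightarrow> (E \<le> N0 / 4 * ln L \<or> \<eta> \<le> \<theta> / 4) \<longrightarrow>
    (1/4)\<^sup>2 * (a * L) / (1 + a * L) \<le> \<epsilon>) at_top"
proof -
  have "eventually (\<lambda>L. 1024 \<le> L \<and> 4 * ln 16 \<le> ln (real L) \<and> 16 * A * ln 16 / N0 \<le> ln (real L)
      \<and> 64 * ln 4 / \<theta>\<^sup>2 \<le> ln (real L)) at_top"
    by (intro eventually_conj eventually_ge_at_top eventually_ln_ge)
  then show ?thesis
  proof (eventually_elim, intro allI impI)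
    fix L n M :: nat and a E \<epsilon> :: real and x D
    assume L: "1024 \<le> L \<and> 4 * ln 16 \<le> ln (real L) \<and> 16 * A * ln 16 / N0 \<le> ln (real L) \<and> 64 * ln 4 / \<theta>\<^sup>2 \<le> ln (real L)"
      and a: "0 < a" "a \<le> 1" and code: "symmetric_code N0 a L n M E \<epsilon> x D" and orth: "orthogonal_access L n M x"
      and M: "2 \<le> M" and E: "E \<le> A * ln (real L)" and rate: "(1 - \<eta>) * E / N0 \<le> ln (real M)"
      and alt: "E \<le> N0 / 4 * ln (real L) \<or> \<eta> \<le> \<theta> / 4"
    note c = symmetric_codeD[OF code]
    show "(1/4)\<^sup>2 * (a * L) / (1 + a * L) \<le> \<epsilon>"
    proof (cases "a \<le> 1/2")
      case True
      have "ln 16 \<le> N0 / (16 * A) * ln L"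
        using L N0 A by (simp add: field_simps)
      then show ?thesis
        using L by (intro converse_activity[OF N0 A \<eta> a(1) True _ code E rate]) auto
    next
      case False
      then have a': "1/2 < a" by simp
      have L': "1024 \<le> L" using L by simp
      have lnL: "0 < ln (real L)" using L' by simp
      show ?thesis
      proof (cases "E \<le> N0 / 4 * ln L")
        case True
        show ?thesis
        proof (rule converse_attenuation[OF N0 a' a(2) L' code orth, where \<theta> = 1])
          show "2 * 1\<^sup>2 * E / N0 \<le> ln L / 2" using True N0 by (simp add: field_simps)
          fix i
          have "1 / real M \<le> 1/2" using M by (simp add: field_simps)
          from user_bound_mono[OF user_bound_const[OF N0 c(1)] this]
          show "user_bound N0 n M (\<lambda>w j. (1 - 1) * x i w j) (1/2)" by simp
        qed simp
      next
        case E1: False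
        then have \<eta>\<theta>: "\<eta> \<le> \<theta> / 4" using alt by simp
        show ?thesis
        proof (rule converse_attenuation[OF N0 a' a(2) L' code orth, where \<theta> = \<theta>])
          have "2 * \<theta>\<^sup>2 * E / N0 \<le> 2 * \<theta>\<^sup>2 * (A * ln L) / N0"
            using E N0 by (intro divide_right_mono mult_left_mono) auto
          also have "\<dots> = (2 * \<theta>\<^sup>2 * A / N0) * ln L" by simp
          also have "\<dots> \<le> 1/2 * ln L" using \<theta>(3) lnL by (intro mult_right_mono) auto
          finally show "2 * \<theta>\<^sup>2 * E / N0 \<le> ln L / 2" by simp
          fix i assume i: "i \<in> {1..L}"
          \<comment> \<open>Coarser than the true \<open>(1 - \<theta>)^2 * E\<close>, but enough:
            the exponent \<open>1 - \<theta> / 2\<close> of \<open>\<gamma>\<close> lies strictly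
            between \<open>1 - \<theta>\<close> and the rate exponent
            \<open>1 - \<eta> \<ge> 1 - \<theta> / 4\<close>.\<close>
          let ?e = "(1 - \<theta>) * E"
          define s where "s = \<theta> / 4"
          define \<gamma> where "\<gamma> = exp ((1 - \<theta> / 2) * E / N0)"
          have en: "ip n (\<lambda>j. (1 - \<theta>) * x i w j) (\<lambda>j. (1 - \<theta>) * x i w j) \<le> ?e" if w: "w \<in> {1..M}" for w
          proof -
            have "ip n (\<lambda>j. (1 - \<theta>) * x i w j) (\<lambda>j. (1 - \<theta>) * x i w j) = (1 - \<theta>) * ((1 - \<theta>) * ip n (x i w) (x i w))"
              by (simp only: ip_scale_left ip_scale_right)
            also have "\<dots> \<le> (1 - \<theta>) * (1 * E)"
              using c(4)[OF i w] c(2) \<theta> by (intro mult_left_mono mult_mono) auto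
            finally show ?thesis by simp
          qed
          have ubd: "user_bound N0 n M (\<lambda>w j. (1 - \<theta>) * x i w j) (\<gamma> / M + \<gamma> powr (-s) * exp (s * (1 + s) * ?e / N0))"
            by (rule user_bound_ball[OF N0 c(1) _ _ en]) (use \<theta> in \<open>auto simp: \<gamma>_def s_def\<close>)
          \<comment> \<open>Not being in the very low energy case, \<open>E\<close> grows with
            \<open>ln L\<close>, and so the exponential terms are small.\<close>
          have "16 * N0 * ln 4 / \<theta>\<^sup>2 = 64 * ln 4 / \<theta>\<^sup>2 * (N0 / 4)" by simp
          also have "\<dots> \<le> ln L * (N0 / 4)" using L N0 by (intro mult_right_mono) auto
          also have "\<dots> \<le> E" using E1 by (simp add: mult.commute)
          finally have "16 * N0 * ln 4 / \<theta>\<^sup>2 \<le> E" .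
          then have big: "ln 4 \<le> \<theta>\<^sup>2 / 16 * (E / N0)" using N0 \<theta> by (simp add: field_simps)
          have u0: "0 \<le> E / N0" using c(2) N0 by simp
          have "\<gamma> / M = exp ((1 - \<theta> / 2) * (E / N0) - ln M)" using c(1) by (simp add: \<gamma>_def exp_diff)
          also have "\<dots> \<le> exp (- (\<theta>\<^sup>2 / 16 * (E / N0)))"
          proof -
            have "\<theta>\<^sup>2 / 16 \<le> \<theta> / 4" using \<theta> by (simp add: power2_eq_square mult_left_le)
            then have "(1 - \<theta> / 2) + \<theta>\<^sup>2 / 16 \<le> 1 - \<eta>" using \<eta>\<theta> by linarith
            then have "((1 - \<theta> / 2) + \<theta>\<^sup>2 / 16) * (E / N0) \<le> (1 - \<eta>) * (E / N0)" using u0 by (rule mult_right_mono)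
            moreover have "(1 - \<eta>) * (E / N0) \<le> ln M" using rate by simp
            moreover have "y * u - l \<le> - (z * u)" if "(y + z) * u \<le> w" "w \<le> l" for y z u w l :: real
              using that by (simp add: distrib_right)
            ultimately show ?thesis unfolding exp_le_cancel_iff by blast
          qed
          also have "\<dots> \<le> 1/4" by (rule exp_neg_le_quarter[OF big])
          finally have t1: "\<gamma> / M \<le> 1/4" .
          have "\<gamma> powr (-s) * exp (s * (1 + s) * ?e / N0) = exp ((s * (1 + s) * (1 - \<theta>) - s * (1 - \<theta> / 2)) * (E / N0))"
            using N0 by (simp add: \<gamma>_def powr_def exp_add[symmetric]) (simp add: field_simps)
          also have "\<dots> \<le> exp (- (\<theta>\<^sup>2 / 16) * (E / N0))"
          proof -
            have "s * (1 + s) * (1 - \<theta>) - s * (1 - \<theta> / 2) = - (\<theta>\<^sup>2 / 16) - \<theta>^3 / 16"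
              by (simp add: s_def field_simps power2_eq_square power3_eq_cube)
            then have "s * (1 + s) * (1 - \<theta>) - s * (1 - \<theta> / 2) \<le> - (\<theta>\<^sup>2 / 16)" using \<theta> by simp
            from mult_right_mono[OF this u0] show ?thesis by simp
          qed
          also have "\<dots> = exp (- (\<theta>\<^sup>2 / 16 * (E / N0)))" by simp
          also have "\<dots> \<le> 1/4" by (rule exp_neg_le_quarter[OF big])
          finally have "\<gamma> / M + \<gamma> powr (-s) * exp (s * (1 + s) * ?e / N0) \<le> 1/2" using t1 by linarith
          then show "user_bound N0 n M (\<lambda>w j. (1 - \<theta>) * x i w j) (1/2)" by (rule user_bound_mono[OF ubd])
        qed (use \<theta> in simp)
      qed
    qed
  qed
qed

text \<open>\<open>\<beta>\<^sup>2 k / (1 + k)\<close> stays away from zero because \<open>k\<close> does.\<close>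

lemma not_achievableI:
  assumes c: "c > 0" "eventually (\<lambda>n. c \<le> \<alpha> n * real (L n)) sequentially"
    and \<beta>: "0 < \<beta>" "\<beta> \<le> 1" and \<delta>: "\<delta> > 0"
    and conv: "eventually (\<lambda>n. \<forall>M (E :: real) (\<epsilon> :: real) x D. symmetric_code N0 (\<alpha> n) (L n) n M E \<epsilon> x D \<longrightarrow>
      orthogonal_access (L n) n M x \<longrightarrow> R - \<delta> < log 2 M / E \<longrightarrow>
      \<beta>\<^sup>2 * (\<alpha> n * L n) / (1 + \<alpha> n * L n) \<le> \<epsilon>) sequentially"
  shows "\<not> orthogonal_achievable N0 \<alpha> L R"
proof
  assume ach: "orthogonal_achievable N0 \<alpha> L R"
  \<comment> \<open>Half the floor at \<open>k = c\<close>; the floor increases with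
    \<open>k\<close>.\<close>
  define \<epsilon> where "\<epsilon> = \<beta>\<^sup>2 * (c / (1 + c)) / 2"
  have "c / (1 + c) < 1" using c by simp
  moreover have "\<beta>\<^sup>2 \<le> 1" using \<beta> by (simp add: power_le_one)
  ultimately have "\<beta>\<^sup>2 * (c / (1 + c)) \<le> 1 * 1" using c by (intro mult_mono) auto
  moreover have "y / 2 < 1" if "y \<le> 1 * 1" for y :: real using that by simp
  ultimately have "\<epsilon> < 1" unfolding \<epsilon>_def by blast
  moreover have \<epsilon>0: "0 < \<epsilon>" using \<beta> c by (simp add: \<epsilon>_def)
  ultimately obtain n0 where n0: "\<forall>n\<ge>n0. \<exists>M E x D. symmetric_code N0 (\<alpha> n) (L n) n M E \<epsilon> x D \<and>
           orthogonal_access (L n) n M x \<and> log 2 (real M) / E > R - \<delta>"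
    using ach \<delta> unfolding orthogonal_achievable_def by blast
  have "eventually (\<lambda>n. n0 \<le> n) sequentially" by (rule eventually_ge_at_top)
  then have "eventually (\<lambda>n. False) sequentially"
    using conv c(2)
  proof eventually_elim
    case (elim n)
    then obtain M E x D where "symmetric_code N0 (\<alpha> n) (L n) n M E \<epsilon> x D"
      "orthogonal_access (L n) n M x" "R - \<delta> < log 2 (real M) / E"
      using n0 by blast
    then have le: "\<beta>\<^sup>2 * (\<alpha> n * L n) / (1 + \<alpha> n * L n) \<le> \<epsilon>" using elim(2) by blast
    have "2 * (y / 2) = y" for y :: real by simp
    then have "2 * \<epsilon> = \<beta>\<^sup>2 * (c / (1 + c))" unfolding \<epsilon>_def by blast
    also have "\<dots> \<le> \<beta>\<^sup>2 * ((\<alpha> n * L n) / (1 + \<alpha> n * L n))"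
      using c(1) elim(3) by (intro mult_left_mono) (simp_all add: field_simps)
    also have "\<dots> = \<beta>\<^sup>2 * (\<alpha> n * L n) / (1 + \<alpha> n * L n)" by simp
    also note le
    finally have "2 * \<epsilon> \<le> \<epsilon>" .
    then show False using \<epsilon>0 by simp
  qed
  then show False by simp
qed

lemma rate_nats:
  assumes "E > 0" "M \<ge> 1" "q < log 2 (real M) / E"
  shows "q * ln 2 * E < ln M"
  using assms by (simp add: log_def field_simps)

lemma achievable_le:
  assumes N0: "N0 > 0" and L: "\<And>n. n \<ge> 1 \<Longrightarrow> L n \<ge> 1"
    and \<alpha>: "\<And>n. n \<ge> 1 \<Longrightarrow> 0 < \<alpha> n \<and> \<alpha> n \<le> 1"
    and c: "c > 0" "eventually (\<lambda>n. c \<le> \<alpha> n * real (L n)) sequentially"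
    and ach: "orthogonal_achievable N0 \<alpha> L R"
  shows "R \<le> log 2 (exp 1) / N0"
proof (rule ccontr)
  assume "\<not> R \<le> log 2 (exp 1) / N0"
  then have R: "1 / (N0 * ln 2) < R" by (simp add: log_def mult.commute)
  \<comment> \<open>Half of the excess, so that \<open>R - \<delta>\<close> still exceeds the
    maximal rate; in nats it is \<open>(1 + \<delta>') / N0\<close>.\<close>
  define \<delta> where "\<delta> = (R - 1 / (N0 * ln 2)) / 2"
  have \<delta>: "\<delta> > 0" using R by (simp add: \<delta>_def)
  define \<delta>' where "\<delta>' = \<delta> * N0 * ln 2"
  have \<delta>': "\<delta>' > 0" using \<delta> N0 by (simp add: \<delta>'_def)
  have eq: "(R - \<delta>) * ln 2 = (1 + \<delta>') / N0"
  proof -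
    have "R - \<delta> = 1 / (N0 * ln 2) + \<delta>" by (simp add: \<delta>_def field_simps)
    then show ?thesis using N0 by (simp add: \<delta>'_def field_simps)
  qed
  obtain \<beta> where \<beta>: "0 < \<beta>" "\<beta> \<le> 1" and conv: "\<And>(a :: real) L n M (E :: real) (\<epsilon> :: real) x D. 0 < a \<Longrightarrow> a \<le> 1 \<Longrightarrow> 1 \<le> L \<Longrightarrow>
    symmetric_code N0 a L n M E \<epsilon> x D \<Longrightarrow> (1 + \<delta>') * E / N0 \<le> ln M \<Longrightarrow>
    \<beta>\<^sup>2 * (a * L) / (1 + a * L) \<le> \<epsilon>"
    using converse_rate[OF N0 \<delta>'] by blast
  have "\<not> orthogonal_achievable N0 \<alpha> L R"
  proof (rule not_achievableI[OF c \<beta> \<delta>])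
    have "eventually (\<lambda>n::nat. 1 \<le> n) sequentially" by (rule eventually_ge_at_top)
    then show "eventually (\<lambda>n. \<forall>M (E :: real) (\<epsilon> :: real) x D. symmetric_code N0 (\<alpha> n) (L n) n M E \<epsilon> x D \<longrightarrow>
      orthogonal_access (L n) n M x \<longrightarrow> R - \<delta> < log 2 M / E \<longrightarrow>
      \<beta>\<^sup>2 * (\<alpha> n * L n) / (1 + \<alpha> n * L n) \<le> \<epsilon>) sequentially"
    proof (eventually_elim, intro allI impI)
      fix n M :: nat and E \<epsilon> :: real and x D assume n: "1 \<le> n" and code: "symmetric_code N0 (\<alpha> n) (L n) n M E \<epsilon> x D"
        and rate: "R - \<delta> < log 2 (real M) / E"
      have "(R - \<delta>) * ln 2 * E < ln M"
        using rate_nats[OF symmetric_codeD(2,1)[OF code] rate] .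
      then have "(1 + \<delta>') * E / N0 \<le> ln M" unfolding eq by simp
      then show "\<beta>\<^sup>2 * (\<alpha> n * L n) / (1 + \<alpha> n * L n) \<le> \<epsilon>"
        using \<alpha>[OF n] L[OF n] code by (intro conv) auto
    qed
  qed
  then show False using ach by simp
qed

text \<open>The crude bound \<open>L n \<ge> sqrt n\<close> already gives
  \<open>ln L \<ge> ln n / 2\<close>; multiplied by the assumed lower bound on \<open>L n\<close> it
  cancels the logarithm.\<close>

lemma growth_of_users:
  fixes L :: "nat \<Rightarrow> nat"
  assumes C: "C > 0" "eventually (\<lambda>n. C * (real n / log 2 (real n)) \<le> real (L n)) sequentially"
  shows "filterlim L at_top sequentially"
    "eventually (\<lambda>n. C * ln 2 / 2 * n \<le> ln (real (L n)) * L n) sequentially"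
proof -
  have C': "C * ln 2 > 0" using C by simp
  have "eventually (\<lambda>n::nat. sqrt n \<le> (C * ln 2) * (n / ln n)) sequentially"
    using C' by real_asymp
  then have sq: "eventually (\<lambda>n. sqrt n \<le> real (L n)) sequentially"
    using C(2) by eventually_elim (simp add: log_def field_simps)
  have "filterlim (\<lambda>n. sqrt (real n)) at_top sequentially" by real_asymp
  then have "filterlim (\<lambda>n. real (L n)) at_top sequentially"
    using sq by (rule filterlim_at_top_mono)
  then show "filterlim L at_top sequentially"
    unfolding filterlim_at_top by (metis (mono_tags, lifting) eventually_mono of_nat_le_iff)
  show "eventually (\<lambda>n. C * ln 2 / 2 * n \<le> ln (real (L n)) * L n) sequentially"
    using sq C(2) eventually_gt_at_top[of 1]
  proof eventually_elim
    case (elim n)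
    then have n: "n > 1" by simp
    have "ln (sqrt n) \<le> ln (real (L n))" using elim n by (intro ln_mono) auto
    then have l: "ln n / 2 \<le> ln (real (L n))" using n by (simp add: ln_sqrt)
    have "C * ln 2 / 2 * n = (ln n / 2) * (C * (n / log 2 n))"
      using n by (simp add: log_def)
    also have "\<dots> \<le> ln (real (L n)) * L n"
      using l elim(2) n C(1) by (intro mult_mono) (auto intro: order_trans[of 0 "ln n / 2"])
    finally show ?case .
  qed
qed

text \<open>Energies up to \<open>A * ln L\<close> fall to \<open>converse_low_energy\<close>,
  larger ones to the dimension bound, which applies because \<open>n\<close> is at most a multiple
  of \<open>L * ln L\<close>. The parameters serve two uses: \<open>\<eta> = 1\<close> with
  \<open>A = N0 / 4\<close> excludes every positive rate; small \<open>\<eta>\<close> with large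
  \<open>A\<close> excludes rates near the maximum.\<close>

lemma not_achievable_crowded:
  assumes N0: "N0 > 0" and L: "\<And>n. n \<ge> 1 \<Longrightarrow> L n \<ge> 1"
    and \<alpha>: "\<And>n. n \<ge> 1 \<Longrightarrow> 0 < \<alpha> n \<and> \<alpha> n \<le> 1"
    and c: "c > 0" "eventually (\<lambda>n. c \<le> \<alpha> n * real (L n)) sequentially"
    and Linf: "filterlim L at_top sequentially"
    and r: "r > 0" and A: "A > 0" and \<eta>: "0 \<le> \<eta>" "\<eta> * A / N0 \<le> 1/4"
    and \<theta>: "0 < \<theta>" "\<theta> < 1" "2 * \<theta>\<^sup>2 * A / N0 \<le> 1/2" and alt: "A \<le> N0 / 4 \<or> \<eta> \<le> \<theta> / 4"
    and \<delta>: "\<delta> > 0" and Rr: "r \<le> (R - \<delta>) * ln 2" "(1 - \<eta>) / N0 \<le> (R - \<delta>) * ln 2"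
    and \<kappa>: "\<And>(a :: real) L n M (E :: real) (\<epsilon> :: real) x D. 0 < a \<Longrightarrow> a \<le> 1 \<Longrightarrow> 1 \<le> L \<Longrightarrow> 1 \<le> n \<Longrightarrow>
      symmetric_code N0 a L n M E \<epsilon> x D \<Longrightarrow> orthogonal_access L n M x \<Longrightarrow>
      E0 \<le> E \<Longrightarrow> r * E \<le> ln M \<Longrightarrow> 2 * real n \<le> \<kappa> * E * L \<Longrightarrow>
      (1/4)\<^sup>2 * (a * L) / (1 + a * L) \<le> \<epsilon>" and \<kappa>0: "\<kappa> > 0"
    and dim: "eventually (\<lambda>n. 2 * real n \<le> \<kappa> * A * (ln (real (L n)) * L n)) sequentially"
  shows "\<not> orthogonal_achievable N0 \<alpha> L R"
proof (rule not_achievableI[OF c _ _ \<delta>, where \<beta> = "1/4"])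
  note low = eventually_compose_filterlim[OF converse_low_energy[OF N0 A \<eta> \<theta>] Linf]
  have "eventually (\<lambda>n. E0 / A \<le> ln (real (L n))) sequentially"
    using eventually_compose_filterlim[OF eventually_ln_ge Linf] .
  then show "eventually (\<lambda>n. \<forall>M (E :: real) (\<epsilon> :: real) x D. symmetric_code N0 (\<alpha> n) (L n) n M E \<epsilon> x D \<longrightarrow>
      orthogonal_access (L n) n M x \<longrightarrow> R - \<delta> < log 2 M / E \<longrightarrow>
      (1/4)\<^sup>2 * (\<alpha> n * L n) / (1 + \<alpha> n * L n) \<le> \<epsilon>) sequentially"
    using low dim eventually_ge_at_top[of 1]
  proof (eventually_elim, intro allI impI)
    fix n M :: nat and E \<epsilon> :: real and x D
    assume E0: "E0 / A \<le> ln (real (L n))" and low: "\<forall>(a :: real) na M (E :: real) (\<epsilon> :: real) x D. 0 < a \<longrightarrow> a \<le> 1 \<longrightarrow>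
      symmetric_code N0 a (L n) na M E \<epsilon> x D \<longrightarrow> orthogonal_access (L n) na M x \<longrightarrow> 2 \<le> M \<longrightarrow>
      E \<le> A * ln (L n) \<longrightarrow> (1 - \<eta>) * E / N0 \<le> ln M \<longrightarrow> (E \<le> N0 / 4 * ln (L n) \<or> \<eta> \<le> \<theta> / 4) \<longrightarrow>
      (1/4)\<^sup>2 * (a * L n) / (1 + a * L n) \<le> \<epsilon>"
      and dim: "2 * real n \<le> \<kappa> * A * (ln (real (L n)) * L n)" and n: "1 \<le> n"
      and code: "symmetric_code N0 (\<alpha> n) (L n) n M E \<epsilon> x D" and orth: "orthogonal_access (L n) n M x"
      and high: "R - \<delta> < log 2 (real M) / E"
    note cd = symmetric_codeD[OF code]
    have a: "0 < \<alpha> n" "\<alpha> n \<le> 1" using \<alpha> n by auto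
    have rate: "(R - \<delta>) * ln 2 * E < ln M" using rate_nats[OF cd(2,1) high] .
    have r1: "r * E \<le> ln M" by (rule order_trans[OF mult_right_mono[OF Rr(1) less_imp_le[OF cd(2)]] less_imp_le[OF rate]])
    have r2: "(1 - \<eta>) * E / N0 \<le> ln M" using order_trans[OF mult_right_mono[OF Rr(2) less_imp_le[OF cd(2)]] less_imp_le[OF rate]] by simp
    have "0 < ln (real M)" using r1 r cd(2) by (smt (verit) mult_pos_pos)
    then have M: "2 \<le> M" using cd(1) by (cases "M = 1") auto
    show "(1/4)\<^sup>2 * (\<alpha> n * L n) / (1 + \<alpha> n * L n) \<le> \<epsilon>"
    proof (cases "E \<le> A * ln (real (L n))")
      case True
      have "E \<le> N0 / 4 * ln (real (L n)) \<or> \<eta> \<le> \<theta> / 4"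
      proof (cases "\<eta> \<le> \<theta> / 4")
        case False
        then have "A * ln (real (L n)) \<le> N0 / 4 * ln (real (L n))"
          using alt L[OF n] by (intro mult_right_mono) auto
        then show ?thesis using True by simp
      qed simp
      then show ?thesis by (rule low[rule_format, OF a code orth M True r2])
    next
      case False
      have "E0 \<le> E" using False E0 A by (simp add: field_simps)
      moreover have "2 * real n \<le> \<kappa> * E * L n"
      proof -
        have "\<kappa> * (A * ln (real (L n))) * L n \<le> \<kappa> * E * L n"
          using False \<kappa>0 by (intro mult_right_mono mult_left_mono) auto
        then show ?thesis using dim by (simp add: mult.assoc)
      qed
      ultimately show ?thesis
        using a L[OF n] n r1 by (intro \<kappa>[OF _ _ _ _ code orth]) auto
    qed
  qed
qed auto

text \<open>\<open>e1\<close> and \<open>e2\<close> make both error terms of a user at most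
  \<open>1 / n^2\<close>, in \<open>e2\<close> after paying for \<open>exp (r * E)\<close> messages;
  \<open>L n \<le> n\<close> then bounds the total by \<open>2 / n\<close>. \<open>rC\<close> makes
  the slots of length \<open>n div L n\<close> long enough for the sign codebook.\<close>

lemma achievableI:
  assumes N0: "N0 > 0" and L: "\<And>n. n \<ge> 1 \<Longrightarrow> L n \<ge> 1"
    and \<alpha>: "\<And>n. n \<ge> 1 \<Longrightarrow> 0 < \<alpha> n \<and> \<alpha> n \<le> 1"
    and r: "r > 0" and A: "A > 0" and \<theta>: "0 < \<theta>" "\<theta> \<le> 1" and \<zeta>: "0 \<le> \<zeta>" "\<zeta> + \<theta> \<le> 1"
    and e1: "2 \<le> \<zeta>\<^sup>2 * A / N0" and e2: "2 + r * A \<le> (1 - \<zeta> - \<theta>)\<^sup>2 * A / N0"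
    and C: "C > 0" "eventually (\<lambda>n. real (L n) \<le> C * (real n / log 2 (real n))) sequentially"
    and rC: "8 * r * A * C * ln 2 \<le> \<theta>\<^sup>2" and \<epsilon>: "\<epsilon> > 0" and \<delta>: "\<delta> > 0"
  shows "eventually (\<lambda>n. \<exists>M E x D. symmetric_code N0 (\<alpha> n) (L n) n M E \<epsilon> x D \<and>
    orthogonal_access (L n) n M x \<and> log 2 (real M) / E > r / ln 2 - \<delta>) sequentially"
proof -
  \<comment> \<open>Absorbs the rounding in \<open>n div L n\<close>, where only
    \<open>N + 1\<close> is bounded below directly.\<close>
  have "eventually (\<lambda>n. 2 * C * ln 2 \<le> ln (real n)) sequentially" by (rule eventually_ln_ge)
  moreover have "eventually (\<lambda>n. ln 2 / (r * A) \<le> ln (real n)) sequentially" by (rule eventually_ln_ge)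
  moreover have "eventually (\<lambda>n. 2 / (A * \<delta>) \<le> ln (real n)) sequentially" by (rule eventually_ln_ge)
  moreover have "eventually (\<lambda>n. 2 / \<epsilon> \<le> real n) sequentially"
    using filterlim_real_sequentially by (simp add: filterlim_at_top)
  ultimately show ?thesis
    using C(2) eventually_gt_at_top[of 1]
  proof eventually_elim
    case (elim n)
    then have n: "n > 1" by simp
    have ln: "ln (real n) > 0" using n by simp
    have Ln: "L n \<ge> 1" using L n by simp
    define N where "N = n div L n"
    define E where "E = A * ln n"
    have E: "E > 0" using A ln by (simp add: E_def)
    have NL: "L n * N \<le> n" by (simp add: N_def)
    have "n < (N + 1) * L n" using Ln div_mod_decomp[of n "L n"] mod_less_divisor[of "L n" n]
      unfolding N_def add_mult_distrib by linarith
    then have "real n \<le> real (N + 1) * real (L n)" by (metis less_imp_le of_nat_le_iff of_nat_mult)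
    also have "\<dots> \<le> real (N + 1) * (C * (n / log 2 n))" using elim(5) by (intro mult_left_mono) auto
    also have "\<dots> = n * ((N + 1) * C * ln 2 / ln n)" by (simp add: log_def)
    finally have "real n * 1 \<le> n * ((N + 1) * C * ln 2 / ln n)" by simp
    then have "1 \<le> (N + 1) * C * ln 2 / ln n" by (rule mult_left_le_imp_le) (use n in simp)
    then have "ln n \<le> (N + 1) * (C * ln 2)" using ln by (simp add: field_simps)
    then have N: "ln n / 2 \<le> N * (C * ln 2)" using elim(1) by (simp add: algebra_simps)
    then have N1: "N \<ge> 1" using ln by (cases N) auto
    have LN: "L n \<le> n"
    proof -
      have "L n * 1 \<le> L n * N" using N1 by (intro mult_left_mono) auto
      then show ?thesis using NL by linarith
    qed
    have "8 * r * A * C * ln 2 * N \<le> \<theta>\<^sup>2 * N" using rC by (intro mult_right_mono) auto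
    moreover have "4 * (r * E) \<le> 8 * r * A * C * ln 2 * N"
      using mult_left_mono[OF N, of "8 * (r * A)"] r A by (simp add: E_def mult_ac)
    ultimately have "4 * (r * E) \<le> \<theta>\<^sup>2 * N" by (rule order_trans[rotated])
    then have rE: "r * E \<le> \<theta>\<^sup>2 * N / 4" by simp
    \<comment> \<open>Rounding loses at most a factor 2, that is \<open>1 / E\<close> in the rate,
      which vanishes.\<close>
    define M where "M = nat \<lfloor>exp (r * E)\<rfloor>"
    have "ln 2 \<le> r * E" using elim(2) r A by (simp add: E_def field_simps)
    then have "exp (ln 2) \<le> exp (r * E)" by (subst exp_le_cancel_iff)
    then have e2': "2 \<le> exp (r * E)" by simp
    have M1: "real M \<le> exp (r * E)" using e2' by (simp add: M_def)
    have M2: "exp (r * E) / 2 \<le> M" using e2' unfolding M_def by linarith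
    have M: "M \<ge> 1" using M2 e2' by linarith
    have an: "0 < \<alpha> n" "\<alpha> n \<le> 1" using \<alpha>[of n] n by auto
    have "real M \<le> exp (\<theta>\<^sup>2 * N / 4)" using M1 rE by (meson exp_le_cancel_iff order_trans)
    then obtain x D where orth: "orthogonal_access (L n) n M x" and
      code: "symmetric_code N0 (\<alpha> n) (L n) n M E (L n * (exp (- (\<zeta>\<^sup>2 * E / N0)) + M * exp (- ((1 - \<zeta> - \<theta>)\<^sup>2 * E / N0)))) x D"
      using tdma_code_exists[OF N0 an Ln N1 NL M \<theta> \<zeta> E] by blast
    have en: "exp (- 2 * ln n) = 1 / (real n)\<^sup>2"
      using n by (simp add: exp_minus exp_double power2_eq_square field_simps)
    have "exp (- (\<zeta>\<^sup>2 * E / N0)) \<le> exp (- 2 * ln n)"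
      using mult_right_mono[OF e1, of "ln n"] ln by (simp add: E_def mult.assoc)
    moreover have "M * exp (- ((1 - \<zeta> - \<theta>)\<^sup>2 * E / N0)) \<le> exp (- 2 * ln n)"
    proof -
      have "M * exp (- ((1 - \<zeta> - \<theta>)\<^sup>2 * E / N0)) \<le> exp (r * E) * exp (- ((1 - \<zeta> - \<theta>)\<^sup>2 * E / N0))"
        using M1 by (rule mult_right_mono) simp
      also have "\<dots> = exp (r * E - (1 - \<zeta> - \<theta>)\<^sup>2 * E / N0)" by (simp add: exp_add[symmetric])
      also have "\<dots> \<le> exp (- 2 * ln n)"
        using mult_right_mono[OF e2, of "ln n"] ln by (simp add: E_def distrib_right mult.assoc)
      finally show ?thesis .
    qed
    ultimately have "L n * (exp (- (\<zeta>\<^sup>2 * E / N0)) + M * exp (- ((1 - \<zeta> - \<theta>)\<^sup>2 * E / N0))) \<le> L n * (2 * (1 / (real n)\<^sup>2))"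
      unfolding en by (intro mult_left_mono) auto
    also have "\<dots> \<le> n * (2 * (1 / (real n)\<^sup>2))" using LN by (intro mult_right_mono) auto
    also have "\<dots> = 2 / n" using n by (simp add: power2_eq_square)
    also have "\<dots> \<le> \<epsilon>" using elim(4) \<epsilon> n by (simp add: field_simps)
    finally have "symmetric_code N0 (\<alpha> n) (L n) n M E \<epsilon> x D" using code by (auto simp: symmetric_code_def)
    moreover have "log 2 (real M) / E > r / ln 2 - \<delta>"
    proof -
      have "ln (exp (r * E) / 2) \<le> ln (real M)" using M2 by (intro ln_mono) auto
      then have "r * E - ln 2 \<le> ln (real M)" by (simp add: ln_div)
      then have "(r * E - ln 2) / (E * ln 2) \<le> ln (real M) / (E * ln 2)" using E by (intro divide_right_mono) auto
      moreover have "(r * E - ln 2) / (E * ln 2) = r / ln 2 - 1 / E" using E by (simp add: field_simps)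
      moreover have "1 / E < \<delta>" using elim(3) A \<delta> ln by (simp add: E_def field_simps)
      moreover have "log 2 (real M) / E = ln (real M) / (E * ln 2)" by (simp add: log_def)
      ultimately show ?thesis by linarith
    qed
    ultimately show ?case using orth by blast
  qed
qed

theorem theorem8:
  fixes N0 :: real and \<alpha> :: "nat \<Rightarrow> real" and L :: "nat \<Rightarrow> nat"
  assumes "N0 > 0"
    and "\<And>n. n \<ge> 1 \<Longrightarrow> L n \<ge> 1"
    and "\<And>n. n \<ge> 1 \<Longrightarrow> 0 < \<alpha> n \<and> \<alpha> n \<le> 1"
    and "(\<lambda>n. \<alpha> n * real (L n)) \<in> \<Omega>(\<lambda>n. 1)"
  shows "((\<lambda>n. real (L n)) \<in> o(\<lambda>n. real n / log 2 (real n)) \<longrightarrow>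
            orthogonal_capacity N0 \<alpha> L = ennreal (log 2 (exp 1) / N0)) \<and>
         ((\<lambda>n. real (L n)) \<in> \<omega>(\<lambda>n. real n / log 2 (real n)) \<longrightarrow>
            orthogonal_capacity N0 \<alpha> L = 0) \<and>
         ((\<lambda>n. real (L n)) \<in> \<Theta>(\<lambda>n. real n / log 2 (real n)) \<longrightarrow>
            0 < orthogonal_capacity N0 \<alpha> L \<and>
            orthogonal_capacity N0 \<alpha> L < ennreal (log 2 (exp 1) / N0))"
proof -
  note N0 = assms(1) and L = assms(2) and \<alpha> = assms(3)
  let ?g = "\<lambda>n. real n / log 2 (real n)"
  let ?C = "log 2 (exp 1) / N0"
  have C: "?C = 1 / N0 / ln 2" by (simp add: log_def)
  have C0: "?C > 0" unfolding C using N0 by simp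
  obtain c where c: "c > 0" "eventually (\<lambda>n. c \<le> \<alpha> n * real (L n)) sequentially"
  proof -
    obtain c where c: "c > 0" "eventually (\<lambda>n. norm (\<alpha> n * real (L n)) \<ge> c * norm (1 :: real)) sequentially"
      using landau_omega.bigE[OF assms(4)] by blast
    have "eventually (\<lambda>n. c \<le> \<alpha> n * real (L n)) sequentially"
      using c(2) eventually_ge_at_top[of 1]
    proof eventually_elim
      case (elim n)
      then have "0 \<le> \<alpha> n * real (L n)" using \<alpha>[of n] by simp
      then show ?case using elim by (simp add: abs_of_nonneg del: abs_mult)
    qed
    then show ?thesis using c(1) that by blast
  qed
  have ev1: "eventually (\<lambda>n::nat. 1 < n) sequentially" by (rule eventually_gt_at_top)
  have norm_g: "norm (?g n) = ?g n" if "1 < n" for n :: nat using that by (simp add: abs_of_nonneg)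
  have upper: "ennreal R \<le> ennreal ?C" if "orthogonal_achievable N0 \<alpha> L R" for R
    using achievable_le[OF N0 L \<alpha> c that] by (rule ennreal_leI)
  show ?thesis
  proof (intro conjI impI)
    assume small: "(\<lambda>n. real (L n)) \<in> o(?g)"
    have "orthogonal_achievable N0 \<alpha> L ?C"
      unfolding orthogonal_achievable_def
    proof (intro allI impI)
      fix \<epsilon> \<delta> :: real assume ed: "0 < \<epsilon> \<and> \<epsilon> < 1 \<and> 0 < \<delta>"
      \<comment> \<open>The relative rate loss: it costs at most \<open>\<delta> / 2\<close> in
        bits, the other half being left to \<open>achievableI\<close>.\<close>
      define \<mu> where "\<mu> = min (1/2) (\<delta> / 2 * N0 * ln 2)"
      have \<mu>: "0 < \<mu>" "\<mu> \<le> 1/2" "\<mu> / N0 / ln 2 \<le> \<delta> / 2"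
      proof -
        show "0 < \<mu>" using ed N0 by (simp add: \<mu>_def)
        show "\<mu> \<le> 1/2" by (simp add: \<mu>_def)
        have "\<mu> \<le> \<delta> / 2 * N0 * ln 2" unfolding \<mu>_def by (rule min.cobounded2)
        then show "\<mu> / N0 / ln 2 \<le> \<delta> / 2" using N0 by (simp add: field_simps)
      qed
      define r where "r = (1 - \<mu>) / N0"
      \<comment> \<open>Chosen with \<open>\<theta> = \<mu> / 8\<close>, which also serves as
        \<open>\<zeta>\<close>, so that \<open>\<theta>\<^sup>2 * A / N0\<close> is exactly
        2.\<close>
      define A where "A = 128 * N0 / \<mu>\<^sup>2"
      define \<theta> where "\<theta> = \<mu> / 8"
      have r: "r > 0" and A: "A > 0" using \<mu> N0 by (auto simp: r_def A_def)
      have \<theta>: "0 < \<theta>" "\<theta> \<le> 1" "0 \<le> \<theta>" "\<theta> + \<theta> \<le> 1" using \<mu> by (auto simp: \<theta>_def)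
      have AN: "A / N0 = 128 / \<mu>\<^sup>2" using N0 by (simp add: A_def)
      have e1: "2 \<le> \<theta>\<^sup>2 * A / N0" using N0 \<mu> by (simp add: A_def \<theta>_def power_divide)
      have e2: "2 + r * A \<le> (1 - \<theta> - \<theta>)\<^sup>2 * A / N0"
      proof -
        have "(1 - \<theta> - \<theta>)\<^sup>2 - (1 - \<mu>) = \<mu> / 2 + \<mu>\<^sup>2 / 16"
          by (simp add: \<theta>_def power2_eq_square field_simps)
        then have "\<mu> / 2 \<le> (1 - \<theta> - \<theta>)\<^sup>2 - (1 - \<mu>)" by simp
        then have "\<mu> / 2 * (A / N0) \<le> ((1 - \<theta> - \<theta>)\<^sup>2 - (1 - \<mu>)) * (A / N0)"
          using A N0 by (intro mult_right_mono) auto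
        moreover have "2 \<le> \<mu> / 2 * (A / N0)" unfolding AN using \<mu>(1,2) by (simp add: power2_eq_square pos_le_divide_eq)
        ultimately show ?thesis by (simp add: r_def left_diff_distrib diff_divide_distrib)
      qed
      \<comment> \<open>The little-o hypothesis supplies every positive constant, so
        \<open>K\<close> may be adapted to \<open>A\<close>, which grows as \<open>\<delta>\<close>
        shrinks.\<close>
      define K where "K = \<theta>\<^sup>2 / (8 * r * A * ln 2)"
      have K: "K > 0" using \<theta> r A by (simp add: K_def)
      have KC: "8 * r * A * K * ln 2 \<le> \<theta>\<^sup>2" using r A by (simp add: K_def)
      have "eventually (\<lambda>n. real (L n) \<le> K * ?g n) sequentially"
        using landau_o.smallD[OF small K] ev1
      proof eventually_elim
        case (elim n)
        then show ?case unfolding norm_g[OF elim(2)] by simp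
      qed
      then have "eventually (\<lambda>n. \<exists>M E x D. symmetric_code N0 (\<alpha> n) (L n) n M E \<epsilon> x D \<and>
        orthogonal_access (L n) n M x \<and> log 2 (real M) / E > r / ln 2 - \<delta> / 2) sequentially"
        using ed by (intro achievableI[OF N0 L \<alpha> r A \<theta> e1 e2 K _ KC]) auto
      moreover have "?C - \<delta> \<le> r / ln 2 - \<delta> / 2"
      proof -
        have "r / ln 2 = ?C - \<mu> / N0 / ln 2" unfolding C r_def by (simp add: diff_divide_distrib)
        then show ?thesis using \<mu>(3) by linarith
      qed
      ultimately have "eventually (\<lambda>n. \<exists>M E x D. symmetric_code N0 (\<alpha> n) (L n) n M E \<epsilon> x D \<and>
        orthogonal_access (L n) n M x \<and> log 2 (real M) / E > ?C - \<delta>) sequentially"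
        by (elim eventually_mono) (meson le_less_trans)
      then show "\<exists>n0. \<forall>n\<ge>n0. \<exists>M E x D. symmetric_code N0 (\<alpha> n) (L n) n M E \<epsilon> x D \<and>
        orthogonal_access (L n) n M x \<and> log 2 (real M) / E > ?C - \<delta>"
        by (simp add: eventually_sequentially)
    qed
    then have "ennreal ?C \<le> orthogonal_capacity N0 \<alpha> L"
      unfolding orthogonal_capacity_def using C0 by (intro SUP_upper) auto
    moreover have "orthogonal_capacity N0 \<alpha> L \<le> ennreal ?C"
      unfolding orthogonal_capacity_def using upper by (intro SUP_least) auto
    ultimately show "orthogonal_capacity N0 \<alpha> L = ennreal ?C" by (rule antisym[rotated])
  next
    assume large: "(\<lambda>n. real (L n)) \<in> \<omega>(?g)"
    have "R = 0" if R: "0 \<le> R" "orthogonal_achievable N0 \<alpha> L R" for R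
    proof (rule ccontr)
      assume "R \<noteq> 0"
      then have R0: "R > 0" using R by simp
      define r where "r = R / 2 * ln 2"
      have r: "r > 0" using R0 by (simp add: r_def)
      obtain \<kappa> E0 where \<kappa>0: "\<kappa> > 0" and \<kappa>: "\<And>(a :: real) L n M (E :: real) (\<epsilon> :: real) x D. 0 < a \<Longrightarrow> a \<le> 1 \<Longrightarrow> 1 \<le> L \<Longrightarrow> 1 \<le> n \<Longrightarrow>
        symmetric_code N0 a L n M E \<epsilon> x D \<Longrightarrow> orthogonal_access L n M x \<Longrightarrow>
        E0 \<le> E \<Longrightarrow> r * E \<le> ln M \<Longrightarrow> 2 * real n \<le> \<kappa> * E * L \<Longrightarrow>
        (1/4)\<^sup>2 * (a * L) / (1 + a * L) \<le> \<epsilon>"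
        using converse_dimension[OF N0 r] by blast
      \<comment> \<open>Solves \<open>\<kappa> * (N0 / 4) * (K * ln 2 / 2) = 2\<close>, the
        dimension condition at the split \<open>N0 / 4 * ln L\<close>.\<close>
      define K where "K = 16 / (\<kappa> * N0 * ln 2)"
      have K: "K > 0" using \<kappa>0 N0 by (simp add: K_def)
      have "eventually (\<lambda>n. K * ?g n \<le> real (L n)) sequentially"
        using landau_omega.smallD[OF large K] ev1
      proof eventually_elim
        case (elim n)
        then show ?case unfolding norm_g[OF elim(2)] by simp
      qed
      note gr = growth_of_users[OF K this]
      have "eventually (\<lambda>n. 2 * real n \<le> \<kappa> * (N0 / 4) * (ln (real (L n)) * L n)) sequentially"
        using gr(2)
      proof eventually_elim
        case (elim n)
        have "\<kappa> * (N0 / 4) * (K * ln 2 / 2 * n) \<le> \<kappa> * (N0 / 4) * (ln (real (L n)) * L n)"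
          using elim \<kappa>0 N0 by (intro mult_left_mono) auto
        moreover have "\<kappa> * (N0 / 4) * (K * ln 2 / 2 * n) = 2 * real n"
          using \<kappa>0 N0 by (simp add: K_def)
        ultimately show ?case by (simp only:)
      qed
      \<comment> \<open>\<open>\<eta> = 1\<close> makes the near-maximal rate condition vacuous, and
        \<open>A = N0 / 4\<close> keeps low energies in the range of full erasure.\<close>
      then have "\<not> orthogonal_achievable N0 \<alpha> L R"
        using R0 N0 \<kappa>0
        by (intro not_achievable_crowded[OF N0 L \<alpha> c gr(1) r, where A = "N0 / 4" and \<eta> = 1 and \<theta> = "1/2"
              and \<delta> = "R / 2" and \<kappa> = \<kappa> and ?E0.0 = E0] \<kappa>) (auto simp: r_def power2_eq_square)
      then show False using R(2) by simp
    qed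
    then have "orthogonal_capacity N0 \<alpha> L \<le> 0"
      unfolding orthogonal_capacity_def by (intro SUP_least) auto
    then show "orthogonal_capacity N0 \<alpha> L = 0" by simp
  next
    assume theta: "(\<lambda>n. real (L n)) \<in> \<Theta>(?g)"
    have bigo: "(\<lambda>n. real (L n)) \<in> O(?g)" using theta by (rule bigthetaD1)
    obtain K where K: "K > 0" "eventually (\<lambda>n. norm (real (L n)) \<le> K * norm (?g n)) sequentially"
      using landau_o.bigE[OF bigo] by blast
    have KL: "eventually (\<lambda>n. real (L n) \<le> K * ?g n) sequentially"
      using K(2) ev1
    proof eventually_elim
      case (elim n)
      then show ?case unfolding norm_g[OF elim(2)] by simp
    qed
    \<comment> \<open>With \<open>\<theta> = \<zeta> = 1/4\<close> the two exponents are 2 and 8.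
      The first bound on \<open>r\<close> gives \<open>r * A \<le> 2\<close>; the second fits the
      codebook into the slots.\<close>
    define A where "A = 32 * N0"
    define r where "r = min (1 / (16 * N0)) (1 / (128 * A * K * ln 2))"
    have A: "A > 0" using N0 by (simp add: A_def)
    have r: "r > 0" using A N0 K by (simp add: r_def)
    have r1: "r * A \<le> 2"
    proof -
      have "r \<le> 1 / (16 * N0)" unfolding r_def by (rule min.cobounded1)
      then show ?thesis using N0 by (simp add: A_def field_simps)
    qed
    have r2: "8 * r * A * K * ln 2 \<le> (1/4)\<^sup>2"
    proof -
      have "r \<le> 1 / (128 * A * K * ln 2)" unfolding r_def by (rule min.cobounded2)
      then have "r * (128 * A * K * ln 2) \<le> 1" using A K by (simp add: pos_le_divide_eq)
      then show ?thesis by (simp add: power2_eq_square mult_ac)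
    qed
    have "orthogonal_achievable N0 \<alpha> L (r / ln 2)"
      unfolding orthogonal_achievable_def
    proof (intro allI impI)
      fix \<epsilon> \<delta> :: real assume ed: "0 < \<epsilon> \<and> \<epsilon> < 1 \<and> 0 < \<delta>"
      have "eventually (\<lambda>n. \<exists>M E x D. symmetric_code N0 (\<alpha> n) (L n) n M E \<epsilon> x D \<and>
        orthogonal_access (L n) n M x \<and> log 2 (real M) / E > r / ln 2 - \<delta>) sequentially"
        by (rule achievableI[OF N0 L \<alpha> r A, where \<theta> = "1/4" and \<zeta> = "1/4" and C = K])
           (use K(1) KL r1 r2 ed N0 in \<open>auto simp: A_def power2_eq_square\<close>)
      then show "\<exists>n0. \<forall>n\<ge>n0. \<exists>M E x D. symmetric_code N0 (\<alpha> n) (L n) n M E \<epsilon> x D \<and>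
        orthogonal_access (L n) n M x \<and> log 2 (real M) / E > r / ln 2 - \<delta>"
        by (simp add: eventually_sequentially)
    qed
    then have "ennreal (r / ln 2) \<le> orthogonal_capacity N0 \<alpha> L"
      unfolding orthogonal_capacity_def using r by (intro SUP_upper) auto
    moreover have "0 < ennreal (r / ln 2)" using r by simp
    ultimately show "0 < orthogonal_capacity N0 \<alpha> L" by (rule order.strict_trans2[rotated])
  next
    assume theta: "(\<lambda>n. real (L n)) \<in> \<Theta>(?g)"
    have bigom: "(\<lambda>n. real (L n)) \<in> \<Omega>(?g)" using theta by (rule bigthetaD2)
    obtain K where K: "K > 0" "eventually (\<lambda>n. norm (real (L n)) \<ge> K * norm (?g n)) sequentially"
      using landau_omega.bigE[OF bigom] by blast
    have KL: "eventually (\<lambda>n. K * ?g n \<le> real (L n)) sequentially"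
      using K(2) ev1
    proof eventually_elim
      case (elim n)
      then show ?case unfolding norm_g[OF elim(2)] by simp
    qed
    note gr = growth_of_users[OF K(1) KL]
    \<comment> \<open>A rate fixed in advance, below all rates to be excluded since
      \<open>\<eta> \<le> 1/2\<close>. So \<open>\<kappa>\<close> is known before \<open>A\<close>,
      \<open>\<theta>\<close> and \<open>\<eta>\<close>, and the choice is not circular.\<close>
    define r where "r = 1 / (2 * N0)"
    have r: "r > 0" using N0 by (simp add: r_def)
    obtain \<kappa> E0 where \<kappa>0: "\<kappa> > 0" and \<kappa>: "\<And>(a :: real) L n M (E :: real) (\<epsilon> :: real) x D. 0 < a \<Longrightarrow> a \<le> 1 \<Longrightarrow> 1 \<le> L \<Longrightarrow> 1 \<le> n \<Longrightarrow>
      symmetric_code N0 a L n M E \<epsilon> x D \<Longrightarrow> orthogonal_access L n M x \<Longrightarrow>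
      E0 \<le> E \<Longrightarrow> r * E \<le> ln M \<Longrightarrow> 2 * real n \<le> \<kappa> * E * L \<Longrightarrow>
      (1/4)\<^sup>2 * (a * L) / (1 + a * L) \<le> \<epsilon>"
      using converse_dimension[OF N0 r] by blast
    define A where "A = 4 / (\<kappa> * K * ln 2)"
    have A: "A > 0" using \<kappa>0 K by (simp add: A_def)
    have dim: "eventually (\<lambda>n. 2 * real n \<le> \<kappa> * A * (ln (real (L n)) * L n)) sequentially"
      using gr(2)
    proof eventually_elim
      case (elim n)
      have "\<kappa> * A * (K * ln 2 / 2 * n) \<le> \<kappa> * A * (ln (real (L n)) * L n)"
        using elim \<kappa>0 A by (intro mult_left_mono) auto
      moreover have "\<kappa> * A * (K * ln 2 / 2 * n) = 2 * real n"
        using \<kappa>0 K by (simp add: A_def)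
      ultimately show ?case by (simp only:)
    qed
    \<comment> \<open>Keeps the attenuation hidden for all energies up to
      \<open>A * ln L\<close>.\<close>
    define \<theta> where "\<theta> = min (1/2) (N0 / (4 * A))"
    have \<theta>: "0 < \<theta>" "\<theta> \<le> 1/2" "\<theta> \<le> N0 / (4 * A)"
      unfolding \<theta>_def using N0 A by (auto intro: min.cobounded1 min.cobounded2)
    have \<theta>A: "\<theta> * A / N0 \<le> 1/4" using \<theta>(3) A N0 by (simp add: field_simps)
    define \<eta> where "\<eta> = \<theta> / 4"
    have \<eta>: "0 < \<eta>" "\<eta> \<le> 1/2" using \<theta> by (auto simp: \<eta>_def)
    have \<eta>A: "\<eta> * A / N0 \<le> 1/4" using \<theta>A A N0 \<theta> by (simp add: \<eta>_def field_simps)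
    have \<theta>2: "2 * \<theta>\<^sup>2 * A / N0 \<le> 1/2"
    proof -
      have "2 * \<theta>\<^sup>2 * A / N0 = 2 * \<theta> * (\<theta> * A / N0)" by (simp add: power2_eq_square)
      also have "\<dots> \<le> 1 * (1/4)" using \<theta> \<theta>A A N0 by (intro mult_mono) auto
      finally show ?thesis by simp
    qed
    \<comment> \<open>As \<open>\<eta>\<close> does not depend on \<open>R\<close>, the gap survives
      the supremum and the inequality is strict.\<close>
    have "R \<le> (1 - \<eta>) * ?C" if R: "orthogonal_achievable N0 \<alpha> L R" for R
    proof (rule ccontr)
      assume "\<not> R \<le> (1 - \<eta>) * ?C"
      then have \<delta>: "R - (1 - \<eta>) * ?C > 0" by simp
      have eq: "(R - (R - (1 - \<eta>) * ?C)) * ln 2 = (1 - \<eta>) / N0" unfolding C by simp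
      have rle: "r \<le> (1 - \<eta>) / N0" using \<eta> N0 by (simp add: r_def field_simps)
      have "\<not> orthogonal_achievable N0 \<alpha> L R"
      proof (rule not_achievable_crowded[OF N0 L \<alpha> c gr(1) r A _ \<eta>A \<theta>(1) _ \<theta>2 _ \<delta> _ _ \<kappa> \<kappa>0 dim])
        show "r \<le> (R - (R - (1 - \<eta>) * ?C)) * ln 2" unfolding eq by (rule rle)
        show "(1 - \<eta>) / N0 \<le> (R - (R - (1 - \<eta>) * ?C)) * ln 2" unfolding eq by simp
      qed (use \<eta> \<theta> in \<open>simp_all add: \<eta>_def\<close>)
      then show False using R by simp
    qed
    then have "orthogonal_capacity N0 \<alpha> L \<le> ennreal ((1 - \<eta>) * ?C)"
      unfolding orthogonal_capacity_def by (intro SUP_least ennreal_leI) auto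
    also have "\<dots> < ennreal ?C"
    proof (rule ennreal_lessI[OF C0])
      have "(1 - \<eta>) * ?C < 1 * ?C" using \<eta> C0 by (intro mult_strict_right_mono) auto
      then show "(1 - \<eta>) * ?C < ?C" by simp
    qed
    finally show "orthogonal_capacity N0 \<alpha> L < ennreal ?C" .
  qed
qed

end
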